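(* Given $s\in(3/2,2)$, it holds that $$\Phi\in C^{1-}\big(H^s(\mathbb{S}),\mathcal{L}(H^2(\mathbb{S}),H^1(\mathbb{S}))\big),$$ where $\Phi(f)[h]:=\Phi_0(f)[h]-\Phi_1(f)[h]-\Phi_2(f)[h]$ with $$\begin{aligned} \Phi_0(f)[h](x)&:=\mathrm{PV}\!\int_{-\pi}^{\pi}\frac{\delta_{[x,\sigma]}h'}{t_{[\sigma]}}\frac{1}{1+(T_{[x,\sigma]}f/t_{[\sigma]})^2}\,d\sigma,\\ \Phi_1(f)[h](x)&:=h'(x)\,\mathrm{PV}\!\int_{-\pi}^{\pi}\Big[\frac{f'(x-\sigma)}{t_{[\sigma]}}\frac{T_{[x,\sigma]}f}{t_{[\sigma]}}+\frac{1}{t_{[\sigma]}}\Big]\frac{1}{1+(T_{[x,\sigma]}f/t_{[\sigma]})^2}\,d\sigma,\\ \Phi_2(f)[h](x)&:=h'(x)\int_{-\pi}^{\pi}f'(x-\sigma)\frac{T_{[x,\sigma]}f}{1+(T_{[x,\sigma]}f/t_{[\sigma]})^2}\,d\sigma-\int_{-\pi}^{\pi}h'(x-\sigma)\frac{(T_{[x,\sigma]}f/t_{[\sigma]})\,T_{[x,\sigma]}f}{1+(T_{[x,\sigma]}f/t_{[\sigma]})^2}\,d\sigma \end{aligned}$$ for $f\in H^s(\mathbb{S})$ and $h\in H^2(\mathbb{S})$.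
   Context: $\mathbb{S}:=\mathbb{R}/2\pi\mathbb{Z}$; functions on $\mathbb{S}$ are identified with $2\pi$-periodic functions on $\mathbb{R}$, and $H^r(\mathbb{S})$ are the periodic ($L_2$-based) Sobolev spaces. The prime denotes $\partial_x$; $\mathrm{PV}$ denotes the principal value taken at $\sigma=0$. Notation: $\delta_{[x,\sigma]}f:=f(x)-f(x-\sigma)$, $T_{[x,\sigma]}f:=\tanh\big(\delta_{[x,\sigma]}f/2\big)$, $t_{[\sigma]}:=\tan(\sigma/2)$. $\mathcal{L}(X,Y)$ is the Banach space of bounded linear operators from $X$ to $Y$, and $C^{1-}(X,Y)$ denotes the set of locally Lipschitz continuous maps from $X$ to $Y$. *)

theory Defs
  imports "HOL-Analysis.Analysis"
begin

section \<open>Periodic Sobolev spaces\<close>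

definition fourier_coeff :: "(real \<Rightarrow> real) \<Rightarrow> int \<Rightarrow> complex" where
  "fourier_coeff f k =
     complex_of_real (1 / (2 * pi)) *
       (LINT x:{-pi..pi}|lborel. complex_of_real (f x) * cis (- (of_int k * x)))"

definition sobolev_term :: "real \<Rightarrow> (real \<Rightarrow> real) \<Rightarrow> int \<Rightarrow> real" where
  "sobolev_term r f k = (1 + (real_of_int k)\<^sup>2) powr r * (cmod (fourier_coeff f k))\<^sup>2"

text \<open>The real-valued space \<open>H\<^sup>r(\<real>/2\<pi>\<int>)\<close> for \<open>r \<ge> 0\<close>.  Elements are honest functions, not classes
  modulo null sets: for \<open>r > 1/2\<close> every class has exactly one continuous representative (Sobolev
  embedding), and this is the one that is taken.  In particular, for \<open>r > 3/2\<close> the elements are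
  continuously differentiable, and \<open>deriv\<close> is their (weak and classical) derivative.\<close>

definition sobolev :: "real \<Rightarrow> (real \<Rightarrow> real) set" where
  "sobolev r = {f. (\<forall>x. f (x + 2 * pi) = f x) \<and>
                   f \<in> borel_measurable borel \<and>
                   set_integrable lborel {-pi..pi} (\<lambda>x. (f x)\<^sup>2) \<and>
                   sobolev_term r f summable_on UNIV \<and>
                   (1 / 2 < r \<longrightarrow> continuous_on UNIV f)}"

definition sobolev_norm :: "real \<Rightarrow> (real \<Rightarrow> real) \<Rightarrow> real" where
  "sobolev_norm r f = sqrt (\<Sum>\<^sub>\<infinity>k\<in>UNIV. sobolev_term r f k)"


section \<open>Bounded operators and locally Lipschitz maps\<close>

text \<open>The exponents are real parameters, so the spaces are carrier sets rather than types.  An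
  operator on \<open>sobolev r\<close> is a function on all of \<open>real \<Rightarrow> real\<close> of which only the restriction to
  \<open>sobolev r\<close> matters.\<close>

definition bounded_ops :: "real \<Rightarrow> real \<Rightarrow> ((real \<Rightarrow> real) \<Rightarrow> (real \<Rightarrow> real)) set" where
  "bounded_ops r q = {L.
     (\<forall>h\<in>sobolev r. L h \<in> sobolev q) \<and>
     (\<forall>h\<in>sobolev r. \<forall>k\<in>sobolev r. L (\<lambda>x. h x + k x) = (\<lambda>x. L h x + L k x)) \<and>
     (\<forall>c. \<forall>h\<in>sobolev r. L (\<lambda>x. c * h x) = (\<lambda>x. c * L h x)) \<and>
     (\<exists>C. \<forall>h\<in>sobolev r. sobolev_norm q (L h) \<le> C * sobolev_norm r h)}"

definition op_norm :: "real \<Rightarrow> real \<Rightarrow> ((real \<Rightarrow> real) \<Rightarrow> (real \<Rightarrow> real)) \<Rightarrow> real" where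
  "op_norm r q L = (SUP h\<in>{h \<in> sobolev r. sobolev_norm r h \<le> 1}. sobolev_norm q (L h))"

text \<open>\<open>C\<^sup>1\<^sup>-(H\<^sup>s, \<L>(H\<^sup>r, H\<^sup>q))\<close>\<close>

definition locally_Lipschitz_ops ::
    "real \<Rightarrow> real \<Rightarrow> real \<Rightarrow> ((real \<Rightarrow> real) \<Rightarrow> (real \<Rightarrow> real) \<Rightarrow> (real \<Rightarrow> real)) set" where
  "locally_Lipschitz_ops s r q = {F.
     (\<forall>f\<in>sobolev s. F f \<in> bounded_ops r q) \<and>
     (\<forall>f\<^sub>0\<in>sobolev s. \<exists>\<epsilon>>0. \<exists>K. \<forall>f\<in>sobolev s. \<forall>g\<in>sobolev s.
        sobolev_norm s (\<lambda>x. f x - f\<^sub>0 x) < \<epsilon> \<longrightarrow> sobolev_norm s (\<lambda>x. g x - f\<^sub>0 x) < \<epsilon> \<longrightarrow>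
        op_norm r q (\<lambda>h x. F f h x - F g h x) \<le> K * sobolev_norm s (\<lambda>x. f x - g x))}"


section \<open>Principal values\<close>

definition has_PV :: "(real \<Rightarrow> real) \<Rightarrow> real \<Rightarrow> bool" where
  "has_PV G I \<longleftrightarrow>
     (\<forall>\<epsilon>\<in>{0<..<pi}. set_integrable lborel {\<sigma>. \<epsilon> < \<bar>\<sigma>\<bar> \<and> \<bar>\<sigma>\<bar> < pi} G) \<and>
     ((\<lambda>\<epsilon>. LINT \<sigma>:{\<sigma>. \<epsilon> < \<bar>\<sigma>\<bar> \<and> \<bar>\<sigma>\<bar> < pi}|lborel. G \<sigma>) \<longlongrightarrow> I) (at_right 0)"

definition PV :: "(real \<Rightarrow> real) \<Rightarrow> real" where
  "PV G = (THE I. has_PV G I)"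


section \<open>The operator\<close>

definition delta :: "(real \<Rightarrow> real) \<Rightarrow> real \<Rightarrow> real \<Rightarrow> real" where
  "delta f x \<sigma> = f x - f (x - \<sigma>)"

definition T :: "(real \<Rightarrow> real) \<Rightarrow> real \<Rightarrow> real \<Rightarrow> real" where
  "T f x \<sigma> = tanh (delta f x \<sigma> / 2)"

definition t :: "real \<Rightarrow> real" where
  "t \<sigma> = tan (\<sigma> / 2)"

text \<open>The integrands; the factors \<open>h'(x)\<close> in front of the integrals are not included.\<close>

definition G0 :: "(real \<Rightarrow> real) \<Rightarrow> (real \<Rightarrow> real) \<Rightarrow> real \<Rightarrow> real \<Rightarrow> real" where
  "G0 f h x \<sigma> = delta (deriv h) x \<sigma> / t \<sigma> * (1 / (1 + (T f x \<sigma> / t \<sigma>)\<^sup>2))"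

definition G1 :: "(real \<Rightarrow> real) \<Rightarrow> real \<Rightarrow> real \<Rightarrow> real" where
  "G1 f x \<sigma> = (deriv f (x - \<sigma>) / t \<sigma> * (T f x \<sigma> / t \<sigma>) + 1 / t \<sigma>)
               * (1 / (1 + (T f x \<sigma> / t \<sigma>)\<^sup>2))"

definition G2a :: "(real \<Rightarrow> real) \<Rightarrow> real \<Rightarrow> real \<Rightarrow> real" where
  "G2a f x \<sigma> = deriv f (x - \<sigma>) * (T f x \<sigma> / (1 + (T f x \<sigma> / t \<sigma>)\<^sup>2))"

definition G2b :: "(real \<Rightarrow> real) \<Rightarrow> (real \<Rightarrow> real) \<Rightarrow> real \<Rightarrow> real \<Rightarrow> real" where
  "G2b f h x \<sigma> = deriv h (x - \<sigma>) * ((T f x \<sigma> / t \<sigma>) * T f x \<sigma> / (1 + (T f x \<sigma> / t \<sigma>)\<^sup>2))"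

definition Phi0 :: "(real \<Rightarrow> real) \<Rightarrow> (real \<Rightarrow> real) \<Rightarrow> real \<Rightarrow> real" where
  "Phi0 f h x = PV (G0 f h x)"

definition Phi1 :: "(real \<Rightarrow> real) \<Rightarrow> (real \<Rightarrow> real) \<Rightarrow> real \<Rightarrow> real" where
  "Phi1 f h x = deriv h x * PV (G1 f x)"

definition Phi2 :: "(real \<Rightarrow> real) \<Rightarrow> (real \<Rightarrow> real) \<Rightarrow> real \<Rightarrow> real" where
  "Phi2 f h x = deriv h x * (LINT \<sigma>:{-pi..pi}|lborel. G2a f x \<sigma>)
                - (LINT \<sigma>:{-pi..pi}|lborel. G2b f h x \<sigma>)"

definition Phi :: "(real \<Rightarrow> real) \<Rightarrow> (real \<Rightarrow> real) \<Rightarrow> real \<Rightarrow> real" where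
  "Phi f h x = Phi0 f h x - Phi1 f h x - Phi2 f h x"

text \<open>\<open>PV\<close> and the Lebesgue integral are total functions; this says that all integrals in \<open>Phi f h x\<close>
  genuinely exist.\<close>

definition Phi_exists :: "(real \<Rightarrow> real) \<Rightarrow> (real \<Rightarrow> real) \<Rightarrow> real \<Rightarrow> bool" where
  "Phi_exists f h x \<longleftrightarrow>
     (\<exists>I. has_PV (G0 f h x) I) \<and> (\<exists>I. has_PV (G1 f x) I) \<and>
     set_integrable lborel {-pi..pi} (G2a f x) \<and> set_integrable lborel {-pi..pi} (G2b f h x)"

end

theory Submission
  imports Defs
begin

text \<open>
  Write \<open>\<delta>f = f(x) - f(x - \<sigma>)\<close>.  The integrand of \<open>\<Phi>\<^sub>1\<close> is the logarithmic derivative in \<open>\<sigma>\<close> of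
  \<open>sin\<^sup>2(\<sigma>/2) + sinh\<^sup>2(\<delta>f/2)\<close>, whose principal value vanishes, plus bounded terms that also occur in
  \<open>\<Phi>\<^sub>2\<close>.  Everything combines to
    \<open>\<Phi>(f)[h](x) = \<integral> (h'(x) - h'(x - \<sigma>)) k(x, \<sigma>) d\<sigma>\<close>,
    \<open>k(x, \<sigma>) = cot(\<sigma>/2) / (1 + (sinh(\<delta>f/2) / sin(\<sigma>/2))\<^sup>2)\<close>,
  so no regularity of \<open>f\<close> beyond \<open>f' \<in> C\<^sup>a\<close>, \<open>0 < a < s - 3/2\<close>, is needed.  Then
  \<open>k = cot(\<sigma>/2) / (1 + f'(x)\<^sup>2) + O(\<bar>\<sigma>\<bar>\<^bsup>a-1\<^esup>)\<close> and \<open>k\<close> is Lipschitz in \<open>x\<close> with constant \<open>O(\<bar>\<sigma>\<bar>\<^bsup>a-2\<^esup>)\<close>;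
  both bounds depend Lipschitz continuously on \<open>f\<close>.  For such kernels the difference quotients of the
  integral are bounded in \<open>L\<^sub>2\<close> by \<open>h''\<close>: the leading part is the Hilbert transform, the rest is
  handled by a Schur test with weight \<open>\<bar>\<sigma>\<bar>\<^bsup>a-1\<^esup>\<close>, using \<open>\<parallel>\<delta>h'\<parallel> \<le> \<bar>\<sigma>\<bar> \<parallel>h''\<parallel>\<close>.  Bessel's inequality turns
  this into the \<open>H\<^sup>1\<close> bound.
\<close>

section \<open>Fourier series on the circle\<close>

text \<open>Lipschitz dependence on \<open>f\<close> has to be measured in operator norm, so
  estimates for each single kernel are not enough. The conditions on a kernel are collected in
  \<open>singular_kernel a A\<close>, where every bound is proportional to \<open>A\<close>. One
  operator bound, linear in \<open>A\<close>, then serves twice: for the kernel of \<open>f\<close>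
  it gives boundedness; for the difference of the kernels of \<open>f\<close> and \<open>g\<close>,
  with \<open>A\<close> proportional to the distance of \<open>f\<close> and \<open>g\<close>, it
  gives the Lipschitz estimate. The second use needs increments of increments, and this is why mixed
  second differences run through the kernel estimates. The Lipschitz constant
  \<open>|\<sigma>|^(a-2)\<close> of the kernel is not integrable. The factor
  \<open>h'(x) - h'(x-\<sigma>)\<close> gains the missing power of \<open>|\<sigma>|\<close> only in
  \<open>L_2\<close>, not pointwise; hence a Schur test instead of a supremum bound. The coefficient
  of the cotangent enters by its size only, because it stands outside the Hilbert transform of the
  increment of \<open>h'\<close>.\<close>

definition circ :: "real measure" where "circ = restrict_space lborel {-pi..pi}"

lemma space_circ [simp]: "space circ = {-pi..pi}"
  by (simp add: circ_def space_restrict_space)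

lemma finite_measure_circ: "finite_measure circ"
  by (rule finite_measureI) (simp add: circ_def emeasure_restrict_space space_restrict_space)

interpretation circ: finite_measure circ
  by (rule finite_measure_circ)

lemma measure_circ [simp]: "measure circ {-pi..pi} = 2 * pi"
  by (simp add: circ_def measure_restrict_space)

lemma borel_measurable_circ: "f \<in> borel_measurable borel \<Longrightarrow> f \<in> borel_measurable circ"
  unfolding circ_def by (intro measurable_restrict_space1) simp

lemma ident_measurable_circ: "(\<lambda>x. x) \<in> circ \<rightarrow>\<^sub>M borel"
  unfolding circ_def by (intro measurable_restrict_space1) simp

lemma set_integral_circ: "(LINT x:{-pi..pi}|lborel. f x) = (LINT x|circ. (f x :: 'a :: {banach, second_countable_topology}))"
  unfolding circ_def set_lebesgue_integral_def by (subst integral_restrict_space) auto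

lemma set_integrable_circ:
  "set_integrable lborel {-pi..pi} f \<longleftrightarrow> integrable circ (f :: real \<Rightarrow> 'a :: {banach, second_countable_topology})"
  unfolding circ_def set_integrable_def by (subst integrable_restrict_space) auto

lemma continuous_borel_circ:
  "continuous_on UNIV f \<Longrightarrow> (f :: real \<Rightarrow> 'a :: {banach, second_countable_topology}) \<in> borel_measurable circ"
  by (intro borel_measurable_circ borel_measurable_continuous_onI)

lemma integrable_circ_continuous:
  fixes f :: "real \<Rightarrow> 'a :: {banach, second_countable_topology}"
  assumes "continuous_on UNIV f"
  shows "integrable circ f"
  unfolding set_integrable_circ[symmetric]
  by (rule borel_integrable_atLeastAtMost') (rule continuous_on_subset[OF assms], simp)

section \<open>Characters of the circle and Bessel's inequality\<close>

definition mode :: "int \<Rightarrow> real \<Rightarrow> complex" where "mode k x = cis (of_int k * x)"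

lemma norm_mode [simp]: "cmod (mode k x) = 1"
  by (simp add: mode_def)

lemma mode_0 [simp]: "mode 0 x = 1"
  by (simp add: mode_def)

lemma mode_at_0 [simp]: "mode k 0 = 1"
  by (simp add: mode_def)

lemma mode_add: "mode (j + k) x = mode j x * mode k x"
  by (simp add: mode_def cis_mult algebra_simps)

lemma cnj_mode: "cnj (mode k x) = mode (- k) x"
  by (simp add: mode_def cis_cnj)

lemma mode_shift: "mode k (x + y) = mode k x * mode k y"
  by (simp add: mode_def cis_mult algebra_simps)

lemma continuous_mode [continuous_intros]:
  "continuous_on A f \<Longrightarrow> continuous_on A (\<lambda>x. mode k (f x))"
  unfolding mode_def cis_conv_exp by (intro continuous_intros)

lemma mode_measurable [measurable]: "mode k \<in> borel_measurable borel"
  by (intro borel_measurable_continuous_onI continuous_intros)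

lemma cis_int_pi: "cis (of_int k * pi) = cis (- (of_int k * pi))"
proof -
  have "cis (of_int k * pi) = cis (- (of_int k * pi)) * cis (2 * pi * of_int k)"
    by (simp only: cis_mult) (simp add: algebra_simps)
  then show ?thesis by (simp add: cis_multiple_2pi)
qed

lemma mode_periodic: "mode k (x + 2 * pi) = mode k x"
proof -
  have "mode k (2 * pi) = 1"
    using cis_multiple_2pi[of "of_int k"] by (simp add: mode_def mult_ac)
  then show ?thesis by (simp add: mode_shift)
qed

lemma has_vector_derivative_mode:
  "(mode k has_vector_derivative \<i> * of_int k * mode k x) (at x within A)"
proof -
  have "((\<lambda>z. exp (\<i> * of_int k * z)) has_field_derivative \<i> * of_int k * exp (\<i> * of_int k * of_real x))
      (at (of_real x))"
    by (auto intro!: derivative_eq_intros)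
  moreover have "mode k = (\<lambda>x. exp (\<i> * of_int k * of_real x))"
    by (simp add: mode_def cis_conv_exp fun_eq_iff mult.assoc)
  ultimately show ?thesis
    using has_vector_derivative_real_field[of "\<lambda>z. exp (\<i> * of_int k * z)"] by (simp add: o_def)
qed

lemma integral_mode: "(LINT x|circ. mode k x) = (if k = 0 then 2 * pi else 0)"
proof (cases "k = 0")
  case True
  then show ?thesis by (simp add: scaleR_conv_of_real)
next
  case False
  have "(LINT x:{-pi..pi}|lborel. \<i> * of_int k * mode k x) = mode k pi - mode k (- pi)"
    unfolding set_lebesgue_integral_def
    by (rule integral_FTC_Icc)
       (auto intro!: has_vector_derivative_mode continuous_intros)
  also have "\<dots> = 0" using cis_int_pi[of k] by (simp add: mode_def)
  finally show ?thesis using False by (simp add: set_integral_circ)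
qed

text \<open>The complex-valued counterpart of \<open>fourier_coeff\<close>: uniqueness, inversion
  and Bessel's inequality are proved for complex functions and then applied to
  \<open>of_real (f x)\<close>.\<close>

definition fourier :: "(real \<Rightarrow> complex) \<Rightarrow> int \<Rightarrow> complex" where
  "fourier u k = of_real (1 / (2 * pi)) * (LINT x|circ. u x * mode (- k) x)"

lemma fourier_coeff_fourier: "fourier_coeff f k = fourier (\<lambda>x. of_real (f x)) k"
  unfolding fourier_coeff_def fourier_def set_integral_circ mode_def by simp

lemma integral_fourier: "(LINT x|circ. u x * mode (- k) x) = of_real (2 * pi) * fourier u k"
  by (simp add: fourier_def)

text \<open>Orthogonality: in the double sum for the squared modulus only the diagonal
  \<open>i = j\<close> has a nonzero integral.\<close>

lemma finite_parseval:
  assumes "finite F"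
  shows "(LINT x|circ. (cmod (\<Sum>j\<in>F. b j * mode j x))\<^sup>2) = 2 * pi * (\<Sum>j\<in>F. (cmod (b j))\<^sup>2)"
proof -
  have *: "of_real ((cmod (\<Sum>j\<in>F. b j * mode j x))\<^sup>2) = (\<Sum>i\<in>F. \<Sum>j\<in>F. b i * cnj (b j) * mode (i - j) x)" for x
  proof -
    have "of_real ((cmod (\<Sum>j\<in>F. b j * mode j x))\<^sup>2) = (\<Sum>j\<in>F. b j * mode j x) * cnj (\<Sum>j\<in>F. b j * mode j x)"
      by (simp only: complex_norm_square)
    also have "\<dots> = (\<Sum>i\<in>F. \<Sum>j\<in>F. b i * mode i x * (cnj (b j) * mode (- j) x))"
      by (simp add: sum_product cnj_mode)
    finally show ?thesis
      using mode_add[of _ "- _" x] by (simp add: mult_ac)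
  qed
  have "complex_of_real (LINT x|circ. (cmod (\<Sum>j\<in>F. b j * mode j x))\<^sup>2)
      = (LINT x|circ. of_real ((cmod (\<Sum>j\<in>F. b j * mode j x))\<^sup>2))"
    by (rule integral_complex_of_real[symmetric])
  also have "\<dots> = (\<Sum>i\<in>F. \<Sum>j\<in>F. b i * cnj (b j) * (LINT x|circ. mode (i - j) x))"
    unfolding *
    by (subst Bochner_Integration.integral_sum Bochner_Integration.integral_mult_right_zero
       | intro integrable_circ_continuous continuous_intros sum.cong refl)+
  also have "\<dots> = (\<Sum>i\<in>F. \<Sum>j\<in>F. if i = j then b i * cnj (b j) * of_real (2 * pi) else 0)"
    by (intro sum.cong refl) (simp add: integral_mode)
  also have "\<dots> = of_real (2 * pi * (\<Sum>j\<in>F. (cmod (b j))\<^sup>2))"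
    using assms by (simp add: sum.delta' complex_norm_square sum_distrib_left mult_ac del: of_real_power)
  finally show ?thesis by (simp only: of_real_eq_iff)
qed

text \<open>With \<open>p\<close> the partial sum over \<open>F\<close>, expand
  \<open>0 \<le> \<integral> |u - p|^2\<close>: the integrals of \<open>Re (u * cnj p)\<close> and
  of \<open>|p|^2\<close> both equal \<open>2 pi\<close> times the coefficient sum, and they enter
  with factors \<open>-2\<close> and \<open>1\<close>.\<close>

lemma bessel:
  assumes u: "continuous_on UNIV u" and F: "finite F"
  shows "2 * pi * (\<Sum>j\<in>F. (cmod (fourier u j))\<^sup>2) \<le> (LINT x|circ. (cmod (u x))\<^sup>2)"
proof -
  define p where "p x = (\<Sum>j\<in>F. fourier u j * mode j x)" for x
  have p: "continuous_on UNIV p" unfolding p_def by (intro continuous_intros)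
  have up: "continuous_on UNIV (\<lambda>x. u x * cnj (p x))" using u p by (intro continuous_intros)
  have eq: "(cmod (u x - p x))\<^sup>2 = (cmod (u x))\<^sup>2 - 2 * Re (u x * cnj (p x)) + (cmod (p x))\<^sup>2" for x
    unfolding cmod_power2 by (simp add: power2_eq_square algebra_simps)
  have "(LINT x|circ. u x * cnj (p x)) = (LINT x|circ. (\<Sum>j\<in>F. cnj (fourier u j) * (u x * mode (- j) x)))"
    by (simp add: p_def cnj_mode sum_distrib_left mult_ac)
  also have "\<dots> = (\<Sum>j\<in>F. cnj (fourier u j) * (LINT x|circ. u x * mode (- j) x))"
    by (subst Bochner_Integration.integral_sum)
       (use u in \<open>auto intro!: integrable_circ_continuous continuous_intros\<close>)
  also have "\<dots> = of_real (2 * pi * (\<Sum>j\<in>F. (cmod (fourier u j))\<^sup>2))"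
    by (simp add: integral_fourier complex_norm_square sum_distrib_left mult_ac del: of_real_power)
  finally have 1: "(LINT x|circ. Re (u x * cnj (p x))) = 2 * pi * (\<Sum>j\<in>F. (cmod (fourier u j))\<^sup>2)"
    by (subst integral_Re) (auto intro!: integrable_circ_continuous up)
  have "0 \<le> (LINT x|circ. (cmod (u x - p x))\<^sup>2)" by simp
  also have "\<dots> = (LINT x|circ. (cmod (u x))\<^sup>2) - 2 * (LINT x|circ. Re (u x * cnj (p x))) + (LINT x|circ. (cmod (p x))\<^sup>2)"
  proof -
    have "integrable circ (\<lambda>x. (cmod (u x))\<^sup>2)" "integrable circ (\<lambda>x. Re (u x * cnj (p x)))"
      "integrable circ (\<lambda>x. (cmod (p x))\<^sup>2)"
      by (rule integrable_circ_continuous, intro continuous_intros u p)+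
    then show ?thesis unfolding eq by (simp del: Re_complex_of_real times_complex.sel)
  qed
  also have "(LINT x|circ. (cmod (p x))\<^sup>2) = 2 * pi * (\<Sum>j\<in>F. (cmod (fourier u j))\<^sup>2)"
    unfolding p_def by (rule finite_parseval[OF F])
  finally show ?thesis unfolding 1 by simp
qed

text \<open>Absolute summability is built in: the series then converges uniformly and
  unconditionally, can be integrated term by term, and the class is closed under differences,
  translations and bounded multipliers.\<close>

definition fourier_series :: "(int \<Rightarrow> complex) \<Rightarrow> (real \<Rightarrow> complex) \<Rightarrow> bool" where
  "fourier_series b g \<longleftrightarrow> (\<lambda>j. cmod (b j)) summable_on UNIV \<and> (\<forall>x. ((\<lambda>j. b j * mode j x) has_sum g x) UNIV)"

lemma fourier_series_summable: "fourier_series b g \<Longrightarrow> (\<lambda>j. cmod (b j)) summable_on UNIV"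
  and fourier_series_has_sum: "fourier_series b g \<Longrightarrow> ((\<lambda>j. b j * mode j x) has_sum g x) UNIV"
  by (auto simp: fourier_series_def)

text \<open>Unordered sums over the integers become limits of symmetric partial sums, the sequential
  form that dominated convergence needs.\<close>

lemma filterlim_symmetric_int_intervals:
  "filterlim (\<lambda>n. {- int n..int n}) (finite_subsets_at_top UNIV) sequentially"
  unfolding filterlim_finite_subsets_at_top
proof (intro allI impI)
  fix X :: "int set" assume "finite X \<and> X \<subseteq> UNIV"
  then obtain B where B: "\<And>x. x \<in> X \<Longrightarrow> \<bar>x\<bar> \<le> B"
    by (metis bdd_above_def bdd_above_finite finite_imageI imageI)
  show "\<forall>\<^sub>F n in sequentially. finite {- int n..int n} \<and> X \<subseteq> {- int n..int n} \<and> {- int n..int n} \<subseteq> UNIV"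
    using eventually_ge_at_top[of "nat B"] by eventually_elim (auto dest!: B)
qed

lemma fourier_series_LIMSEQ:
  assumes "fourier_series b g"
  shows "(\<lambda>n. \<Sum>j\<in>{- int n..int n}. b j * mode j x) \<longlonglongrightarrow> g x"
  using filterlim_compose[OF fourier_series_has_sum[OF assms, of x, unfolded has_sum_def] filterlim_symmetric_int_intervals] .

lemma fourier_series_exists:
  assumes "(\<lambda>j. cmod (b j)) summable_on UNIV"
  shows "fourier_series b (\<lambda>x. \<Sum>\<^sub>\<infinity>j. b j * mode j x)"
proof -
  have "(\<lambda>j. b j * mode j x) summable_on UNIV" for x
    by (rule abs_summable_summable) (simp add: norm_mult assms)
  then show ?thesis using assms by (auto simp: fourier_series_def)
qed

lemma fourier_series_partial_sum_le:
  assumes "fourier_series b g"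
  shows "cmod (\<Sum>j\<in>{- int n..int n}. b j * mode j x) \<le> (\<Sum>\<^sub>\<infinity>j. cmod (b j))"
proof -
  have "cmod (\<Sum>j\<in>{- int n..int n}. b j * mode j x) \<le> (\<Sum>j\<in>{- int n..int n}. cmod (b j))"
    by (rule order_trans[OF norm_sum]) (simp add: norm_mult)
  also have "\<dots> \<le> (\<Sum>\<^sub>\<infinity>j. cmod (b j))"
    by (rule finite_sum_le_infsum) (use fourier_series_summable[OF assms] in auto)
  finally show ?thesis .
qed

lemma fourier_series_continuous:
  assumes "fourier_series b g"
  shows "continuous_on UNIV g"
proof -
  have "uniform_limit UNIV (\<lambda>X y. \<Sum>x\<in>X. b x * mode x y) g (finite_subsets_at_top UNIV)"
    by (rule Weierstrass_m_test_general'[where M = "\<lambda>j. cmod (b j)"])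
       (use assms in \<open>auto simp: fourier_series_def norm_mult\<close>)
  then show ?thesis
    by (rule uniform_limit_theorem[rotated]) (auto intro!: continuous_intros always_eventually)
qed

lemma fourier_series_diff:
  assumes "fourier_series b g" "fourier_series c h"
  shows "fourier_series (\<lambda>j. b j - c j) (\<lambda>x. g x - h x)"
  unfolding fourier_series_def
proof (intro conjI allI)
  show "(\<lambda>j. cmod (b j - c j)) summable_on UNIV"
    by (rule summable_on_comparison_test[OF summable_on_add[OF fourier_series_summable[OF assms(1)] fourier_series_summable[OF assms(2)]]])
       (auto intro: norm_triangle_ineq4)
  show "((\<lambda>j. (b j - c j) * mode j x) has_sum (g x - h x)) UNIV" for x
    using has_sum_add[OF fourier_series_has_sum[OF assms(1), of x] has_sum_uminusI[OF fourier_series_has_sum[OF assms(2), of x]]]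
    by (simp add: left_diff_distrib)
qed

lemma fourier_series_mult_bounded:
  assumes "(\<lambda>j. cmod (b j)) summable_on UNIV" "\<And>j. cmod (d j) \<le> D"
  shows "(\<lambda>j. cmod (b j * d j)) summable_on UNIV"
proof (rule summable_on_comparison_test[OF summable_on_cmult_left[OF assms(1)]])
  show "cmod (b j * d j) \<le> cmod (b j) * D" for j
    by (simp add: norm_mult mult_left_mono assms)
qed auto

lemma fourier_series_shift:
  assumes "fourier_series b g"
  shows "fourier_series (\<lambda>j. b j * mode j y) (\<lambda>x. g (x + y))"
  unfolding fourier_series_def
  using fourier_series_mult_bounded[OF fourier_series_summable[OF assms], of "\<lambda>j. mode j y" 1] fourier_series_has_sum[OF assms, of "_ + y"]
  by (simp add: mode_shift mult_ac)

text \<open>The partial sums satisfy the bound by orthogonality and are dominated by the constant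
  \<open>S\<close>, so their squared norms converge. Stating the hypothesis for finite sums avoids a
  separate summability argument for the squares.\<close>

lemma parseval_fourier_series:
  assumes g: "fourier_series b g" and Q: "\<And>F. finite F \<Longrightarrow> (\<Sum>j\<in>F. (cmod (b j))\<^sup>2) \<le> Q"
  shows "(LINT x|circ. (cmod (g x))\<^sup>2) \<le> 2 * pi * Q"
proof -
  define S where "S = (\<Sum>\<^sub>\<infinity>j. cmod (b j))"
  define p where "p n x = (\<Sum>j\<in>{- int n..int n}. b j * mode j x)" for n x
  have p: "continuous_on UNIV (p n)" for n
    unfolding p_def by (intro continuous_intros)
  have pS: "cmod (p n x) \<le> S" for n x
    unfolding p_def S_def by (rule fourier_series_partial_sum_le[OF g])
  have "(\<lambda>n. LINT x|circ. (cmod (p n x))\<^sup>2) \<longlonglongrightarrow> (LINT x|circ. (cmod (g x))\<^sup>2)"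
  proof (rule integral_dominated_convergence)
    show "integrable circ (\<lambda>x. S\<^sup>2)" by simp
    show "AE x in circ. (\<lambda>n. (cmod (p n x))\<^sup>2) \<longlonglongrightarrow> (cmod (g x))\<^sup>2"
      using fourier_series_LIMSEQ[OF g] unfolding p_def by (intro AE_I2 tendsto_intros)
    show "AE x in circ. norm ((cmod (p n x))\<^sup>2) \<le> S\<^sup>2" for n
      using pS by (auto intro!: AE_I2 power_mono)
    show "(\<lambda>x. (cmod (g x))\<^sup>2) \<in> borel_measurable circ"
      using fourier_series_continuous[OF g] by (intro continuous_borel_circ continuous_intros)
    show "(\<lambda>x. (cmod (p n x))\<^sup>2) \<in> borel_measurable circ" for n
      using p by (intro continuous_borel_circ continuous_intros)
  qed
  moreover have "(LINT x|circ. (cmod (p n x))\<^sup>2) \<le> 2 * pi * Q" for n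
    unfolding p_def using Q by (subst finite_parseval) auto
  ultimately show ?thesis by (intro LIMSEQ_le_const2) auto
qed

text \<open>Tested against one character, the symmetric partial sums have integrals that are
  constant from \<open>n = |k|\<close> on, so the limit can be read off.\<close>

lemma fourier_fourier_series:
  assumes g: "fourier_series b g"
  shows "fourier g k = b k"
proof -
  define S where "S = (\<Sum>\<^sub>\<infinity>j. cmod (b j))"
  define p where "p n x = (\<Sum>j\<in>{- int n..int n}. b j * mode j x)" for n x
  have p: "continuous_on UNIV (p n)" for n
    unfolding p_def by (intro continuous_intros)
  have pS: "cmod (p n x) \<le> S" for n x
    unfolding p_def S_def by (rule fourier_series_partial_sum_le[OF g])
  have "(\<lambda>n. LINT x|circ. p n x * mode (- k) x) \<longlonglongrightarrow> (LINT x|circ. g x * mode (- k) x)"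
  proof (rule integral_dominated_convergence)
    show "integrable circ (\<lambda>x. S)" by simp
    show "AE x in circ. (\<lambda>n. p n x * mode (- k) x) \<longlonglongrightarrow> g x * mode (- k) x"
      using fourier_series_LIMSEQ[OF g] unfolding p_def by (intro AE_I2 tendsto_intros)
    show "AE x in circ. norm (p n x * mode (- k) x) \<le> S" for n
      using pS by (auto simp: norm_mult)
  qed (use p fourier_series_continuous[OF g] in \<open>intro continuous_borel_circ continuous_intros; simp\<close>)+
  moreover have "\<forall>\<^sub>F n in sequentially. (LINT x|circ. p n x * mode (- k) x) = of_real (2 * pi) * b k"
  proof -
    have "\<forall>\<^sub>F n in sequentially. n \<ge> nat \<bar>k\<bar>" by (rule eventually_ge_at_top)
    then show ?thesis
    proof eventually_elim
      case (elim n)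
      have "(LINT x|circ. p n x * mode (- k) x) = (LINT x|circ. (\<Sum>j\<in>{- int n..int n}. b j * mode (j - k) x))"
        using mode_add[of _ "- k"] by (simp add: p_def sum_distrib_right mult.assoc)
      also have "\<dots> = (\<Sum>j\<in>{- int n..int n}. b j * (LINT x|circ. mode (j - k) x))"
        by (subst Bochner_Integration.integral_sum)
           (auto intro!: integrable_circ_continuous continuous_intros)
      also have "\<dots> = (\<Sum>j\<in>{- int n..int n}. if j = k then b j * of_real (2 * pi) else 0)"
        by (intro sum.cong refl) (simp add: integral_mode)
      also have "\<dots> = of_real (2 * pi) * b k"
        using elim by (subst sum.delta) auto
      finally show ?case .
    qed
  qed
  ultimately have "(LINT x|circ. g x * mode (- k) x) = of_real (2 * pi) * b k"
    using tendsto_unique[OF sequentially_bot _ tendsto_eventually] by blast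
  then show ?thesis by (simp add: fourier_def)
qed

text \<open>Completeness of the trigonometric system, by the Stone--Weierstrass theorem on the unit circle.\<close>

inductive trig_poly :: "(real \<Rightarrow> complex) \<Rightarrow> bool" where
  monom: "trig_poly (\<lambda>x. c * mode k x)"
| add: "trig_poly p \<Longrightarrow> trig_poly q \<Longrightarrow> trig_poly (\<lambda>x. p x + q x)"

lemma trig_poly_monom_mult: "trig_poly q \<Longrightarrow> trig_poly (\<lambda>x. c * mode k x * q x)"
proof (induction rule: trig_poly.induct)
  case (monom d j)
  have "(\<lambda>x. c * mode k x * (d * mode j x)) = (\<lambda>x. (c * d) * mode (k + j) x)"
    by (simp add: mode_add mult_ac)
  then show ?case by (simp only: trig_poly.monom)
next
  case (add p q)
  then show ?case by (simp add: distrib_left trig_poly.add)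
qed

lemma trig_poly_mult: "trig_poly p \<Longrightarrow> trig_poly q \<Longrightarrow> trig_poly (\<lambda>x. p x * q x)"
proof (induction rule: trig_poly.induct)
  case (monom c k)
  then show ?case by (rule trig_poly_monom_mult)
next
  case (add p q)
  then show ?case by (simp add: distrib_right trig_poly.add)
qed

lemma trig_poly_continuous: "trig_poly p \<Longrightarrow> continuous_on UNIV p"
  by (induction rule: trig_poly.induct) (auto intro!: continuous_intros)

text \<open>A real-linear functional of \<open>cis x\<close> is a combination of
  \<open>cos x\<close> and \<open>sin x\<close>, hence of \<open>mode 1\<close> and
  \<open>mode (- 1)\<close>; the closure properties do the rest.\<close>

lemma trig_poly_real_polynomial:
  "real_polynomial_function p \<Longrightarrow> trig_poly (\<lambda>x. of_real (p (cis x)))"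
proof (induction rule: real_polynomial_function.induct)
  case (linear f)
  then interpret bounded_linear f .
  have "complex_of_real (f (cis x)) = (of_real (f 1) - \<i> * of_real (f \<i>)) / 2 * mode 1 x + (of_real (f 1) + \<i> * of_real (f \<i>)) / 2 * mode (- 1) x" for x
  proof -
    have "cis x = cos x *\<^sub>R 1 + sin x *\<^sub>R \<i>" by (simp add: complex_eq_iff)
    then have "f (cis x) = cos x * f 1 + sin x * f \<i>" by (simp add: add scale)
    then show ?thesis by (simp add: mode_def complex_eq_iff field_simps)
  qed
  then show ?case by (simp only: trig_poly.intros)
next
  case (const c)
  show ?case using trig_poly.monom[of "of_real c" 0] by simp
qed (auto intro: trig_poly.add trig_poly_mult)

text \<open>Stone--Weierstrass needs a compact space, so the periodic function is transported to the
  unit circle by composition with the argument.\<close>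

lemma periodic_factors_through_circle:
  fixes F :: "real \<Rightarrow> 'a::euclidean_space"
  assumes F: "continuous_on UNIV F" and per: "\<And>x. F (x + 2 * pi) = F x"
  obtains G where "continuous_on (sphere 0 1) G" "\<And>x. G (cis x) = F x"
proof -
  have per_int: "F (x + 2 * pi * of_int k) = F x" for x k
  proof (induction k rule: int_induct[where k = 0])
    case (step1 i)
    then show ?case using per[of "x + 2 * pi * of_int i"] by (simp add: algebra_simps)
  next
    case (step2 i)
    then show ?case using per[of "x + 2 * pi * of_int (i - 1)"] by (simp add: algebra_simps)
  qed simp
  have eq: "F x = F y" if "cis x = cis y" for x y
  proof -
    have "sin x = sin y \<and> cos x = cos y" using that by (simp add: complex_eq_iff)
    then obtain n :: int where "x = y + 2 * pi * of_int n"
      unfolding sin_cos_eq_iff by (auto simp: mult_ac)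
    then show ?thesis using per_int by simp
  qed
  define G where "G z = F (Arg z)" for z
  have G: "G (cis x) = F x" for x
    unfolding G_def by (rule eq) (simp add: cis_Arg)
  have "continuous_on (sphere 0 1) G"
  proof (intro continuous_at_imp_continuous_on ballI)
    fix z :: complex assume z: "z \<in> sphere 0 1"
    have F': "isCont F x" for x using F by (simp add: continuous_on_eq_continuous_at)
    show "isCont G z"
    proof (cases "z \<in> \<real>\<^sub>\<le>\<^sub>0")
      case False
      then show ?thesis unfolding G_def
        by (intro continuous_at_compose[of z Arg F, unfolded o_def] continuous_at_Arg F')
    next
      case True
      \<comment> \<open>On the negative axis, where \<open>Arg\<close> jumps,
        \<open>Arg (- w) + pi\<close> is a continuous choice of angle for \<open>w\<close>. It
        differs from \<open>Arg w\<close> by a multiple of \<open>2 pi\<close>, which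
        \<open>F\<close> does not see.\<close>
      then have "- z \<notin> \<real>\<^sub>\<le>\<^sub>0" using z by (auto simp: complex_nonpos_Reals_iff cmod_def)
      then have "isCont (\<lambda>w. Arg (- w) + pi) z"
        by (intro continuous_intros continuous_at_compose[of z uminus Arg, unfolded o_def] continuous_at_Arg)
      then have "isCont (\<lambda>w. F (Arg (- w) + pi)) z"
        by (intro continuous_at_compose[of z "\<lambda>w. Arg (- w) + pi" F, unfolded o_def] F')
      moreover have "\<forall>\<^sub>F w in nhds z. F (Arg (- w) + pi) = G w"
      proof -
        have "\<forall>\<^sub>F w in nhds z. w \<noteq> 0" using z by (intro t1_space_nhds) auto
        then show ?thesis
        proof eventually_elim
          case (elim w)
          have "cis (Arg (- w) + pi) = cis (Arg w)"
            using elim cis_Arg[of w] cis_Arg[of "- w"] by (simp add: cis_mult[symmetric] sgn_minus)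
          then show ?case unfolding G_def by (rule eq)
        qed
      qed
      ultimately show ?thesis using isCont_cong[of "\<lambda>w. F (Arg (- w) + pi)" G z] by simp
    qed
  qed
  with G show ?thesis using that by blast
qed

text \<open>If all coefficients vanish, every trigonometric polynomial \<open>P\<close> satisfies
  \<open>\<integral> F P = 0\<close>. Hence
  \<open>\<integral> |F|^2 = \<integral> F (cnj F - P)\<close>, which is small when \<open>P\<close>
  approximates \<open>cnj F\<close> uniformly.\<close>

lemma fourier_unique:
  assumes F: "continuous_on UNIV F" and per: "\<And>x. F (x + 2 * pi) = F x" and 0: "\<And>k. fourier F k = 0"
  shows "F x = 0"
proof -
  from periodic_factors_through_circle[OF F per]
  obtain G where G: "continuous_on (sphere 0 1) G" "\<And>x. G (cis x) = F x" by metis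
  have trig0: "(LINT x|circ. F x * p x) = 0" if "trig_poly p" for p
    using that
  proof (induction rule: trig_poly.induct)
    case (monom c k)
    have "(LINT x|circ. F x * (c * mode k x)) = c * (LINT x|circ. F x * mode (- (- k)) x)"
      by (subst integral_mult_right_zero[symmetric]) (simp add: mult_ac)
    also have "\<dots> = 0" unfolding integral_fourier 0 by simp
    finally show ?case .
  next
    case (add p q)
    have "integrable circ (\<lambda>x. F x * p x)" "integrable circ (\<lambda>x. F x * q x)"
      using add(1,2)[THEN trig_poly_continuous] F by (auto intro!: integrable_circ_continuous continuous_intros)
    then show ?case using add by (simp add: distrib_left)
  qed
  have "compact (G ` sphere 0 1)" using G(1) by (intro compact_continuous_image) auto
  then obtain B where B: "\<And>z. z \<in> sphere 0 1 \<Longrightarrow> cmod (G z) \<le> B"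
    by (meson bounded_iff compact_imp_bounded imageI)
  have FB: "cmod (F x) \<le> B" for x using B[of "cis x"] G(2)[of x] by simp
  then have B0: "B \<ge> 0" using norm_ge_zero order_trans by blast
  have small: "(LINT x|circ. (cmod (F x))\<^sup>2) \<le> 2 * pi * B * e" if e: "e > 0" for e
  proof -
    have "continuous_on (sphere 0 1) (\<lambda>z. cnj (G z))" using G(1) by (intro continuous_intros)
    from Stone_Weierstrass_polynomial_function[OF _ this e]
    obtain P where P: "polynomial_function P" "\<And>z. z \<in> sphere 0 1 \<Longrightarrow> cmod (cnj (G z) - P z) < e"
      by auto
    have RI: "real_polynomial_function (\<lambda>z. Re (P z))" "real_polynomial_function (\<lambda>z. Im (P z))"
      using P(1) bounded_linear_Re bounded_linear_Im by (auto simp: polynomial_function_def o_def)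
    have "trig_poly (\<lambda>x. of_real (Re (P (cis x))) + \<i> * mode 0 x * of_real (Im (P (cis x))))"
      using RI by (intro trig_poly.add trig_poly_monom_mult trig_poly_real_polynomial)
    then have p: "trig_poly (\<lambda>x. P (cis x))"
      by (simp add: complex_eq[symmetric])
    have int: "integrable circ (\<lambda>x. F x * cnj (F x))" "integrable circ (\<lambda>x. F x * P (cis x))"
      using F trig_poly_continuous[OF p] by (auto intro!: integrable_circ_continuous continuous_intros)
    have "complex_of_real (LINT x|circ. (cmod (F x))\<^sup>2) = (LINT x|circ. F x * cnj (F x)) - (LINT x|circ. F x * P (cis x))"
      unfolding trig0[OF p] integral_complex_of_real[symmetric] complex_norm_square by simp
    also have "\<dots> = (LINT x|circ. F x * (cnj (F x) - P (cis x)))"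
      using int by (simp add: right_diff_distrib)
    finally have "complex_of_real (LINT x|circ. (cmod (F x))\<^sup>2) = (LINT x|circ. F x * (cnj (F x) - P (cis x)))" .
    then have "(LINT x|circ. (cmod (F x))\<^sup>2) \<le> cmod (LINT x|circ. F x * (cnj (F x) - P (cis x)))"
      by (metis complex_Re_le_cmod Re_complex_of_real)
    also have "\<dots> \<le> (LINT x|circ. B * e)"
    proof (rule Bochner_Integration.integral_norm_bound_integral)
      show "integrable circ (\<lambda>x. F x * (cnj (F x) - P (cis x)))"
        using F trig_poly_continuous[OF p] by (auto intro!: integrable_circ_continuous continuous_intros)
      show "cmod (F x * (cnj (F x) - P (cis x))) \<le> B * e" for x
        using FB[of x] P(2)[of "cis x"] G(2)[of x] B0 by (auto simp: norm_mult intro!: mult_mono)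
    qed simp
    finally show ?thesis by (simp add: mult_ac)
  qed
  have "(LINT x|circ. (cmod (F x))\<^sup>2) \<le> 0"
  proof (rule field_le_epsilon)
    fix e :: real assume "e > 0"
    \<comment> \<open>The summand \<open>1\<close> in the denominator covers the case
      \<open>B = 0\<close>.\<close>
    have "2 * pi * B * (e / (2 * pi * B + 1)) \<le> e"
      using \<open>e > 0\<close> B0 by (simp add: field_simps add_pos_nonneg)
    moreover have "e / (2 * pi * B + 1) > 0"
      using \<open>e > 0\<close> B0 by (simp add: add_nonneg_pos)
    ultimately show "(LINT x|circ. (cmod (F x))\<^sup>2) \<le> 0 + e"
      using small[of "e / (2 * pi * B + 1)"] by simp
  qed
  then have "(LINT x|circ. (cmod (F x))\<^sup>2) = 0" by (simp add: antisym)
  moreover have "set_integrable lborel {-pi..pi} (\<lambda>x. (cmod (F x))\<^sup>2)"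
    unfolding set_integrable_circ using F by (auto intro!: integrable_circ_continuous continuous_intros)
  ultimately have "((\<lambda>x. (cmod (F x))\<^sup>2) has_integral 0) {-pi..pi}"
    using has_integral_set_lebesgue[of "{-pi..pi}" "\<lambda>x. (cmod (F x))\<^sup>2"]
    by (metis set_borel_integral_eq_integral has_integral_integral set_integral_circ)
  then have "((\<lambda>x. (cmod (F x))\<^sup>2) has_integral 0) (cbox (-pi) pi)" by simp
  moreover have "continuous_on (cbox (-pi) pi) (\<lambda>x. (cmod (F x))\<^sup>2)"
    by (intro continuous_intros continuous_on_subset[OF F]) auto
  ultimately have 1: "F y = 0" if "y \<in> {-pi..pi}" for y
    using has_integral_0_cbox_imp_0[of "-pi" pi "\<lambda>x. (cmod (F x))\<^sup>2" y] that pi_gt_zero by (auto simp: not_le)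
  \<comment> \<open>Passage from one period to the whole line: \<open>Arg (cis x)\<close> is the
    representative of \<open>x\<close> in \<open>(-pi, pi]\<close>.\<close>
  have "F x = F (Arg (cis x))"
    using G(2)[of x] G(2)[of "Arg (cis x)"] by (simp add: cis_Arg)
  also have "\<dots> = 0" by (rule 1) (use mpi_less_Arg[of "cis x"] Arg_le_pi[of "cis x"] in auto)
  finally show ?thesis .
qed

text \<open>The sum of the Fourier series of \<open>F\<close> has the same coefficients as
  \<open>F\<close>, so uniqueness applies to the difference.\<close>

lemma fourier_inversion:
  assumes F: "continuous_on UNIV F" and per: "\<And>x. F (x + 2 * pi) = F x"
    and sm: "(\<lambda>k. cmod (fourier F k)) summable_on UNIV"
  shows "fourier_series (fourier F) F"
proof -
  define G where "G x = (\<Sum>\<^sub>\<infinity>j. fourier F j * mode j x)" for x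
  have G: "fourier_series (fourier F) G" unfolding G_def by (rule fourier_series_exists[OF sm])
  have "F x - G x = 0" for x
  proof (rule fourier_unique[where F = "\<lambda>x. F x - G x"])
    show "continuous_on UNIV (\<lambda>x. F x - G x)"
      using F fourier_series_continuous[OF G] by (intro continuous_intros)
    show "F (x + 2 * pi) - G (x + 2 * pi) = F x - G x" for x
      by (simp add: per G_def mode_periodic)
    have "integrable circ (\<lambda>x. F x * mode k x)" "integrable circ (\<lambda>x. G x * mode k x)" for k
      using F fourier_series_continuous[OF G] by (auto intro!: integrable_circ_continuous continuous_intros)
    then have "fourier (\<lambda>x. F x - G x) k = fourier F k - fourier G k" for k
      by (simp add: fourier_def left_diff_distrib right_diff_distrib)
    then show "fourier (\<lambda>x. F x - G x) k = 0" for k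
      by (simp add: fourier_fourier_series[OF G])
  qed
  then have "G = F" by (simp add: fun_eq_iff)
  with G show ?thesis by simp
qed

section \<open>Sobolev embedding\<close>

text \<open>The square of the usual bracket \<open>(1 + j^2)^(1/2)\<close>; a weight of order
  \<open>b\<close> on the coefficients is therefore \<open>bracket j powr (b / 2)\<close>.\<close>

definition bracket :: "int \<Rightarrow> real" where "bracket j = 1 + (real_of_int j)\<^sup>2"

lemma bracket_ge_1: "bracket j \<ge> 1"
  by (simp add: bracket_def)

lemma bracket_pos [simp]: "bracket j > 0"
  using bracket_ge_1[of j] by linarith

lemma bracket_nonzero [simp]: "bracket j \<noteq> 0"
  using bracket_pos[of j] by linarith

lemma abs_le_bracket: "\<bar>real_of_int j\<bar> powr b \<le> bracket j powr (b / 2)" if "b \<ge> 0"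
proof (cases "j = 0")
  case False
  have "\<bar>real_of_int j\<bar> powr b = (\<bar>real_of_int j\<bar> powr 2) powr (b / 2)"
    by (simp only: powr_powr) simp
  also have "\<dots> \<le> bracket j powr (b / 2)"
    using that False by (intro powr_mono2) (auto simp: bracket_def)
  finally show ?thesis .
qed (use that in auto)

text \<open>Comparison with \<open>n^(-2c)\<close>, where \<open>2c > 1\<close>, on the nonnegative
  integers; the negative ones follow by reflection.\<close>

lemma summable_on_bracket_powr:
  assumes "c > 1 / 2"
  shows "(\<lambda>j. bracket j powr (- c)) summable_on UNIV"
proof -
  have nat: "(\<lambda>n. bracket (int n) powr (- c)) summable_on UNIV"
  proof -
    have "summable (\<lambda>n. bracket (int n) powr (- c))"
    proof (rule summable_comparison_test_ev)
      show "summable (\<lambda>n. real n powr (- 2 * c))"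
        using assms by (simp add: summable_real_powr_iff)
      show "\<forall>\<^sub>F n in sequentially. norm (bracket (int n) powr (- c)) \<le> real n powr (- 2 * c)"
        using eventually_gt_at_top[of 0]
      proof eventually_elim
        case (elim n)
        have "bracket (int n) powr (- c) \<le> (real n powr 2) powr (- c)"
          using assms elim by (intro powr_mono2') (auto simp: bracket_def)
        also have "\<dots> = real n powr (- 2 * c)" by (simp only: powr_powr) simp
        finally show ?case by simp
      qed
    qed
    then show ?thesis by (simp add: summable_on_UNIV_nonneg_real_iff)
  qed
  have pos: "(\<lambda>j. bracket j powr (- c)) summable_on range int"
    by (subst summable_on_reindex) (use nat in \<open>auto simp: o_def\<close>)
  have "(\<lambda>j. bracket j powr (- c)) summable_on range (\<lambda>n. - int n)"
    by (subst summable_on_reindex) (use nat in \<open>auto simp: o_def inj_def bracket_def\<close>)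
  then have "(\<lambda>j. bracket j powr (- c)) summable_on {..<0}"
  proof (rule summable_on_subset_banach)
    show "{..<0} \<subseteq> range (\<lambda>n. - int n)"
    proof
      fix x :: int assume "x \<in> {..<0}"
      then show "x \<in> range (\<lambda>n. - int n)" by (intro range_eqI[of _ _ "nat (- x)"]) auto
    qed
  qed
  with pos have "(\<lambda>j. bracket j powr (- c)) summable_on (range int \<union> {..<0})"
    by (rule summable_on_Un_disjoint) auto
  moreover have "range int \<union> {..<0} = UNIV"
    by (metis UnI1 UnI2 UNIV_eq_I lessThan_iff not_le rangeI zero_le_imp_eq_int)
  ultimately show ?thesis by simp
qed

lemma sobolev_term_nonneg: "sobolev_term r f j \<ge> 0"
  by (simp add: sobolev_term_def)

lemma sobolev_norm_nonneg: "sobolev_norm r f \<ge> 0"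
  unfolding sobolev_norm_def by (intro real_sqrt_ge_zero infsum_nonneg sobolev_term_nonneg)

lemma sobolev_term_sum_le:
  assumes "f \<in> sobolev r" "finite F"
  shows "(\<Sum>j\<in>F. sobolev_term r f j) \<le> (sobolev_norm r f)\<^sup>2"
proof -
  have "(\<Sum>j\<in>F. sobolev_term r f j) \<le> (\<Sum>\<^sub>\<infinity>j. sobolev_term r f j)"
    using assms by (intro finite_sum_le_infsum) (auto simp: sobolev_def sobolev_term_nonneg)
  then show ?thesis
    unfolding sobolev_norm_def by (simp add: infsum_nonneg sobolev_term_nonneg)
qed

text \<open>For \<open>c > 1/2\<close>, the \<open>l_2\<close> norm of
  \<open>bracket j powr (- c / 2)\<close>: the factor that Cauchy--Schwarz leaves in the
  embedding.\<close>

definition embed_const :: "real \<Rightarrow> real" where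
  "embed_const c = sqrt (\<Sum>\<^sub>\<infinity>j. bracket j powr (- c))"

lemma embed_const_nonneg: "embed_const c \<ge> 0"
  unfolding embed_const_def by (intro real_sqrt_ge_zero infsum_nonneg) auto

text \<open>Cauchy--Schwarz after splitting the weight as
  \<open>bracket^(b/2) = bracket^((b-r)/2) * bracket^(r/2)\<close>; the first factor is square
  summable because \<open>r - b > 1/2\<close>.\<close>

lemma sobolev_embedding_sum:
  assumes f: "f \<in> sobolev r" and r: "r > b + 1 / 2"
  shows "(\<lambda>j. bracket j powr (b / 2) * cmod (fourier_coeff f j)) summable_on UNIV"
    and "(\<Sum>\<^sub>\<infinity>j. bracket j powr (b / 2) * cmod (fourier_coeff f j)) \<le> embed_const (r - b) * sobolev_norm r f"
proof -
  define w where "w j = bracket j powr (b / 2) * cmod (fourier_coeff f j)" for j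
  have w0: "w j \<ge> 0" for j by (simp add: w_def)
  have le: "sum w F \<le> embed_const (r - b) * sobolev_norm r f" if F: "finite F" for F
  proof -
    define p where "p j = bracket j powr ((b - r) / 2)" for j
    define q where "q j = bracket j powr (r / 2) * cmod (fourier_coeff f j)" for j
    have "w j = \<bar>p j\<bar> * \<bar>q j\<bar>" for j
      by (simp add: w_def p_def q_def abs_mult powr_add[symmetric] diff_divide_distrib)
    then have "sum w F = (\<Sum>j\<in>F. \<bar>p j\<bar> * \<bar>q j\<bar>)" by simp
    also have "\<dots> \<le> L2_set p F * L2_set q F" by (rule L2_set_mult_ineq)
    also have "L2_set p F \<le> embed_const (r - b)"
    proof -
      have "(\<Sum>j\<in>F. (p j)\<^sup>2) = (\<Sum>j\<in>F. bracket j powr (- (r - b)))"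
        by (simp add: p_def power2_eq_square powr_add[symmetric])
      also have "\<dots> \<le> (\<Sum>\<^sub>\<infinity>j. bracket j powr (- (r - b)))"
        using r by (intro finite_sum_le_infsum summable_on_bracket_powr F) auto
      finally show ?thesis unfolding L2_set_def embed_const_def by simp
    qed
    also have "L2_set q F \<le> sobolev_norm r f"
    proof -
      have "(q j)\<^sup>2 = sobolev_term r f j" for j
      proof -
        have "(bracket j powr (r / 2))\<^sup>2 = bracket j powr r"
          by (simp add: power2_eq_square powr_add[symmetric])
        then show ?thesis by (simp add: q_def sobolev_term_def power_mult_distrib bracket_def)
      qed
      then show ?thesis unfolding L2_set_def
        using sobolev_term_sum_le[OF f F] by (intro real_le_lsqrt sobolev_norm_nonneg) auto
    qed
    finally show ?thesis
      by (simp add: mult_left_mono mult_right_mono L2_set_nonneg embed_const_nonneg)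
  qed
  have sm: "w summable_on UNIV"
    by (rule nonneg_bounded_partial_sums_imp_summable_on[where C = "embed_const (r - b) * sobolev_norm r f"])
       (auto simp: w0 eventually_finite_subsets_at_top_weakI intro!: eventually_finite_subsets_at_top_weakI le)
  then show "(\<lambda>j. bracket j powr (b / 2) * cmod (fourier_coeff f j)) summable_on UNIV"
    by (simp add: w_def[abs_def])
  have "infsum w UNIV \<le> embed_const (r - b) * sobolev_norm r f"
    by (rule infsum_le_finite_sums[OF sm le])
  then show "(\<Sum>\<^sub>\<infinity>j. bracket j powr (b / 2) * cmod (fourier_coeff f j)) \<le> embed_const (r - b) * sobolev_norm r f"
    by (simp add: w_def[abs_def])
qed

lemma has_sum_norm_le:
  fixes u :: "'a \<Rightarrow> 'b::banach"
  assumes "(u has_sum a) A" "w summable_on A" "\<And>j. j \<in> A \<Longrightarrow> norm (u j) \<le> M * w j"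
  shows "norm a \<le> M * infsum w A"
proof -
  have Mw: "(\<lambda>j. M * w j) summable_on A" by (rule summable_on_cmult_right[OF assms(2)])
  then have nm: "(\<lambda>j. norm (u j)) summable_on A"
    by (rule summable_on_comparison_test) (use assms in auto)
  have "norm a = norm (infsum u A)" using infsumI[OF assms(1)] by simp
  also have "\<dots> \<le> (\<Sum>\<^sub>\<infinity>j\<in>A. norm (u j))" by (rule norm_infsum_bound[OF nm])
  also have "\<dots> \<le> (\<Sum>\<^sub>\<infinity>j\<in>A. M * w j)" by (rule infsum_mono[OF nm Mw assms(3)])
  also have "\<dots> = M * infsum w A" by (rule infsum_cmult_right') 
  finally show ?thesis .
qed

lemma cmod_cis_diff_le: "cmod (cis a - cis b) \<le> \<bar>a - b\<bar>"
proof -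
  have "(cmod (cis a - cis b))\<^sup>2 = 2 - 2 * cos (a - b)"
    using sin_cos_squared_add3[of a] sin_cos_squared_add3[of b] unfolding cmod_power2
    by (simp add: power2_eq_square cos_diff algebra_simps)
  also have "\<dots> = (2 * sin ((a - b) / 2))\<^sup>2"
  proof -
    have "2 * ((a - b) / 2) = a - b" by simp
    then show ?thesis using cos_double_sin[of "(a - b) / 2"] by (simp only: power_mult_distrib) simp
  qed
  also have "\<dots> \<le> \<bar>a - b\<bar>\<^sup>2"
    using abs_sin_x_le_abs_x[of "(a - b) / 2"] by (intro abs_le_square_iff[THEN iffD1]) (simp add: abs_mult)
  finally show ?thesis by (rule power2_le_imp_le) simp
qed

lemma mode_diff_le: "cmod (mode k x - mode k y) \<le> \<bar>real_of_int k\<bar> * \<bar>x - y\<bar>"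
  using cmod_cis_diff_le[of "k * x" "k * y"] by (simp add: mode_def right_diff_distrib[symmetric] abs_mult)

text \<open>Interpolation between the bounds \<open>2\<close> and \<open>z = |k| |x - y|\<close>:
  for \<open>z \<le> 1\<close> one has \<open>z \<le> z^a\<close>, and for \<open>z > 1\<close>
  already \<open>2 \<le> 2 z^a\<close>. Only a fractional power of \<open>|k|\<close> can be paid
  for by the summability of the coefficients.\<close>

lemma mode_diff_le_powr:
  assumes "0 \<le> a" "a \<le> 1"
  shows "cmod (mode k x - mode k y) \<le> 2 * (\<bar>real_of_int k\<bar> * \<bar>x - y\<bar>) powr a"
proof (cases "\<bar>real_of_int k\<bar> * \<bar>x - y\<bar> \<le> 1")
  case True
  define z where "z = \<bar>real_of_int k\<bar> * \<bar>x - y\<bar>"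
  have "z \<le> z powr a"
  proof (cases "z = 0")
    case False
    then have "z powr 1 \<le> z powr a" using assms True by (intro powr_mono') (auto simp: z_def)
    then show ?thesis using False by (simp add: z_def)
  qed simp
  moreover have "z powr a \<ge> 0" by simp
  ultimately show ?thesis using mode_diff_le[of k x y] unfolding z_def by linarith
next
  case False
  have "cmod (mode k x - mode k y) \<le> 2"
    using norm_triangle_ineq4[of "mode k x" "mode k y"] by simp
  moreover have "(\<bar>real_of_int k\<bar> * \<bar>x - y\<bar>) powr a \<ge> 1"
    using False assms by (intro ge_one_powr_ge_zero) auto
  ultimately show ?thesis by linarith
qed

text \<open>Mean value inequality for \<open>mode k\<close> minus its linear part at
  \<open>x\<close>: the derivative of this difference is \<open>|k|\<close> times an increment of
  \<open>mode k\<close> in modulus, to which the interpolated bound applies on the whole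
  segment.\<close>

lemma mode_taylor:
  assumes "0 \<le> a" "a \<le> 1"
  shows "cmod (mode k y - mode k x - of_real (y - x) * (\<i> * of_int k * mode k x))
    \<le> 2 * (bracket k powr ((1 + a) / 2)) * \<bar>y - x\<bar> powr (1 + a)"
proof -
  define g where "g z = mode k z - z *\<^sub>R (\<i> * of_int k * mode k x)" for z
  have g': "(g has_vector_derivative \<i> * of_int k * mode k z - \<i> * of_int k * mode k x) (at z within A)" for z A
    unfolding g_def by (auto intro!: derivative_eq_intros has_vector_derivative_mode)
  have bd: "cmod (\<i> * of_int k * mode k z - \<i> * of_int k * mode k x) \<le> 2 * (\<bar>real_of_int k\<bar> powr (1 + a)) * \<bar>y - x\<bar> powr a"
    if "z \<in> closed_segment x y" for z
  proof -
    have zx: "\<bar>z - x\<bar> \<le> \<bar>y - x\<bar>" using that by (auto simp: closed_segment_eq_real_ivl split: if_splits)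
    have "cmod (\<i> * of_int k * mode k z - \<i> * of_int k * mode k x) = \<bar>real_of_int k\<bar> * cmod (mode k z - mode k x)"
      by (simp add: right_diff_distrib[symmetric] norm_mult)
    also have "\<dots> \<le> \<bar>real_of_int k\<bar> * (2 * (\<bar>real_of_int k\<bar> * \<bar>z - x\<bar>) powr a)"
      by (intro mult_left_mono mode_diff_le_powr assms) auto
    also have "\<dots> = 2 * (\<bar>real_of_int k\<bar> powr (1 + a)) * \<bar>z - x\<bar> powr a"
      by (simp add: powr_mult powr_add)
    also have "\<dots> \<le> 2 * (\<bar>real_of_int k\<bar> powr (1 + a)) * \<bar>y - x\<bar> powr a"
      using zx assms by (intro mult_left_mono powr_mono2) auto
    finally show ?thesis .
  qed
  have "cmod (g y - g x) \<le> 2 * (\<bar>real_of_int k\<bar> powr (1 + a)) * \<bar>y - x\<bar> powr a * norm (y - x)"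
  proof (rule differentiable_bound[where S = "closed_segment x y"])
    show "(g has_derivative (\<lambda>t. t *\<^sub>R (\<i> * of_int k * mode k z - \<i> * of_int k * mode k x))) (at z within closed_segment x y)" for z
      using g' by (simp add: has_vector_derivative_def)
    show "onorm (\<lambda>t. t *\<^sub>R (\<i> * of_int k * mode k z - \<i> * of_int k * mode k x)) \<le> 2 * (\<bar>real_of_int k\<bar> powr (1 + a)) * \<bar>y - x\<bar> powr a"
      if "z \<in> closed_segment x y" for z
      using bd[OF that] by (subst onorm_scaleR_left) (auto simp: onorm_id)
  qed auto
  also have "g y - g x = mode k y - mode k x - of_real (y - x) * (\<i> * of_int k * mode k x)"
    by (simp add: g_def scaleR_conv_of_real algebra_simps)
  also have "2 * (\<bar>real_of_int k\<bar> powr (1 + a)) * \<bar>y - x\<bar> powr a * norm (y - x)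
     = 2 * (\<bar>real_of_int k\<bar> powr (1 + a)) * \<bar>y - x\<bar> powr (1 + a)"
    by (simp add: powr_add)
  also have "\<dots> \<le> 2 * (bracket k powr ((1 + a) / 2)) * \<bar>y - x\<bar> powr (1 + a)"
    using assms by (intro mult_right_mono mult_left_mono abs_le_bracket) auto
  finally show ?thesis .
qed

text \<open>One constant serves for the size and for the Hoelder seminorm of the derivative. The
  size of \<open>f\<close> itself is left free, since the kernel sees only increments of
  \<open>f\<close>.\<close>

definition C1_hol :: "real \<Rightarrow> real \<Rightarrow> (real \<Rightarrow> real) \<Rightarrow> bool" where
  "C1_hol a M f \<longleftrightarrow> (\<forall>x. (f has_real_derivative deriv f x) (at x)) \<and> (\<forall>x. \<bar>deriv f x\<bar> \<le> M) \<and>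
     (\<forall>x y. \<bar>deriv f x - deriv f y\<bar> \<le> M * \<bar>x - y\<bar> powr a)"

lemma sobolev_per: "f \<in> sobolev r \<Longrightarrow> f (x + 2 * pi) = f x"
  and sobolev_cont: "f \<in> sobolev r \<Longrightarrow> r > 1 / 2 \<Longrightarrow> continuous_on UNIV f"
  by (auto simp: sobolev_def)

lemma sobolev_fourier_series:
  assumes f: "f \<in> sobolev r" and r: "r > 1 / 2"
  shows "fourier_series (fourier_coeff f) (\<lambda>x. of_real (f x))"
proof -
  have "(\<lambda>j. bracket j powr (0 / 2) * cmod (fourier_coeff f j)) summable_on UNIV"
    using r by (intro sobolev_embedding_sum(1)[OF f]) simp
  then have "(\<lambda>j. cmod (fourier (\<lambda>x. of_real (f x)) j)) summable_on UNIV"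
    by (simp add: fourier_coeff_fourier)
  then have "fourier_series (fourier (\<lambda>x. of_real (f x))) (\<lambda>x. of_real (f x))"
    using f r by (intro fourier_inversion) (auto simp: sobolev_per intro!: continuous_intros sobolev_cont)
  then show ?thesis by (simp add: fourier_coeff_fourier[abs_def])
qed

text \<open>Every estimate is a bound for single characters summed against the weight
  \<open>w\<close>. The summed Taylor bound has a remainder of order \<open>|y - x|^(1+a)\<close>,
  which proves differentiability directly and identifies the derivative with the series
  \<open>\<phi>\<close>.\<close>

proposition sobolev_embedding:
  assumes f: "f \<in> sobolev r" and a: "0 < a" "a \<le> 1" and r: "r > 3 / 2 + a"
  shows "fourier_series (\<lambda>j. \<i> * of_int j * fourier_coeff f j) (\<lambda>x. of_real (deriv f x))"
    and "C1_hol a (2 * embed_const (r - (1 + a)) * sobolev_norm r f) f"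
proof -
  define c where "c = fourier_coeff f"
  define w where "w j = bracket j powr ((1 + a) / 2) * cmod (c j)" for j
  have w: "w summable_on UNIV" "infsum w UNIV \<le> embed_const (r - (1 + a)) * sobolev_norm r f"
    using sobolev_embedding_sum[OF f, of "1 + a"] r unfolding w_def[abs_def] c_def by auto
  have w0: "infsum w UNIV \<ge> 0" by (rule infsum_nonneg) (simp add: w_def)
  have jw: "cmod (\<i> * of_int j * c j) \<le> w j" for j
  proof -
    have "\<bar>real_of_int j\<bar> powr 1 \<le> bracket j powr (1 / 2)" by (rule abs_le_bracket) simp
    also have "\<dots> \<le> bracket j powr ((1 + a) / 2)"
      using a bracket_ge_1 by (intro powr_mono) auto
    finally show ?thesis by (simp add: w_def norm_mult mult_right_mono)
  qed
  have fs: "fourier_series c (\<lambda>x. of_real (f x))" unfolding c_def using sobolev_fourier_series[OF f] r a by simp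
  define \<phi> where "\<phi> x = (\<Sum>\<^sub>\<infinity>j. \<i> * of_int j * c j * mode j x)" for x
  have \<phi>: "fourier_series (\<lambda>j. \<i> * of_int j * c j) \<phi>"
    unfolding \<phi>_def by (intro fourier_series_exists summable_on_comparison_test[OF w(1) jw]) auto
  have taylor: "cmod (of_real (f y) - of_real (f x) - of_real (y - x) * \<phi> x) \<le> (2 * \<bar>y - x\<bar> powr (1 + a)) * infsum w UNIV" for x y
  proof (rule has_sum_norm_le[OF _ w(1)])
    show "((\<lambda>j. c j * (mode j y - mode j x - of_real (y - x) * (\<i> * of_int j * mode j x))) has_sum
       (of_real (f y) - of_real (f x) - of_real (y - x) * \<phi> x)) UNIV"
      using has_sum_add[OF has_sum_add[OF fourier_series_has_sum[OF fs, of y] has_sum_uminusI[OF fourier_series_has_sum[OF fs, of x]]]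
        has_sum_uminusI[OF has_sum_cmult_right[OF fourier_series_has_sum[OF \<phi>, of x], of "of_real (y - x)"]]]
      by (simp add: algebra_simps)
    show "cmod (c j * (mode j y - mode j x - of_real (y - x) * (\<i> * of_int j * mode j x))) \<le> 2 * \<bar>y - x\<bar> powr (1 + a) * w j" for j
      using mult_left_mono[OF mode_taylor[of a j y x], of "cmod (c j)"] a by (simp add: norm_mult w_def mult_ac)
  qed
  have vd: "((\<lambda>x. complex_of_real (f x)) has_vector_derivative \<phi> x) (at x)" for x
    unfolding has_vector_derivative_def has_derivative_at_alt
  proof (intro conjI allI impI)
    show "bounded_linear (\<lambda>t. t *\<^sub>R \<phi> x)" by (rule bounded_linear_scaleR_left)
    fix e :: real assume e: "e > 0"
    \<comment> \<open>Adding \<open>1\<close> keeps \<open>W\<close> positive when all coefficients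
      vanish; the radius \<open>d\<close> below solves \<open>2 d^a W = e\<close>.\<close>
    define W where "W = infsum w UNIV + 1"
    have W: "W > 0" using w0 by (simp add: W_def)
    define d where "d = (e / (2 * W)) powr (1 / a)"
    have d: "d > 0" using e W by (simp add: d_def)
    have "norm (complex_of_real (f y) - of_real (f x) - (y - x) *\<^sub>R \<phi> x) \<le> e * norm (y - x)" if "norm (y - x) < d" for y
    proof -
      have "\<bar>y - x\<bar> powr a \<le> d powr a" using that a by (intro powr_mono2) auto
      also have "\<dots> = e / (2 * W)" using a e W by (simp add: d_def powr_powr)
      finally have *: "2 * \<bar>y - x\<bar> powr a * W \<le> e" using W by (simp add: field_simps)
      have "norm (complex_of_real (f y) - of_real (f x) - (y - x) *\<^sub>R \<phi> x) \<le> (2 * \<bar>y - x\<bar> powr (1 + a)) * infsum w UNIV"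
        using taylor by (simp add: scaleR_conv_of_real)
      also have "\<dots> \<le> (2 * \<bar>y - x\<bar> powr (1 + a)) * W" by (intro mult_left_mono) (auto simp: W_def)
      also have "\<dots> = (2 * \<bar>y - x\<bar> powr a * W) * \<bar>y - x\<bar>" by (simp add: powr_add)
      also have "\<dots> \<le> e * \<bar>y - x\<bar>" using * by (intro mult_right_mono) auto
      finally show ?thesis by simp
    qed
    then show "\<exists>d>0. \<forall>y. norm (y - x) < d \<longrightarrow> norm (complex_of_real (f y) - of_real (f x) - (y - x) *\<^sub>R \<phi> x) \<le> e * norm (y - x)"
      using d by blast
  qed
  have Re: "(f has_real_derivative Re (\<phi> x)) (at x)" for x
    using bounded_linear.has_vector_derivative[OF bounded_linear_Re vd[of x]]
    by (simp add: has_real_derivative_iff_has_vector_derivative)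
  \<comment> \<open>The imaginary part of \<open>of_real (f x)\<close> is the zero function, and
    \<open>Im (\<phi> x)\<close> is its derivative.\<close>
  have Im: "Im (\<phi> x) = 0" for x
    using bounded_linear.has_vector_derivative[OF bounded_linear_Im vd[of x]]
    by (simp add: vector_derivative_at) (metis has_vector_derivative_const vector_derivative_at)
  have deriv: "deriv f x = Re (\<phi> x)" for x using Re by (rule DERIV_imp_deriv)
  have \<phi>_eq: "\<phi> = (\<lambda>x. of_real (deriv f x))"
    by (simp add: fun_eq_iff deriv complex_eq_iff Im)
  show "fourier_series (\<lambda>j. \<i> * of_int j * fourier_coeff f j) (\<lambda>x. of_real (deriv f x))"
    using \<phi> unfolding \<phi>_eq c_def .
  have M: "2 * infsum w UNIV \<le> 2 * embed_const (r - (1 + a)) * sobolev_norm r f"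
    using w(2) by simp
  have 1: "\<bar>deriv f x\<bar> \<le> 2 * infsum w UNIV" for x
  proof -
    have "cmod (\<phi> x) \<le> 1 * infsum w UNIV"
      by (rule has_sum_norm_le[OF fourier_series_has_sum[OF \<phi>] w(1)]) (use jw in \<open>simp add: norm_mult\<close>)
    then show ?thesis using w0 by (simp add: \<phi>_eq)
  qed
  have 2: "\<bar>deriv f x - deriv f y\<bar> \<le> 2 * infsum w UNIV * \<bar>x - y\<bar> powr a" for x y
  proof -
    have "cmod (\<phi> x - \<phi> y) \<le> (2 * \<bar>x - y\<bar> powr a) * infsum w UNIV"
    proof (rule has_sum_norm_le[OF _ w(1)])
      show "((\<lambda>j. \<i> * of_int j * c j * (mode j x - mode j y)) has_sum (\<phi> x - \<phi> y)) UNIV"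
        using has_sum_add[OF fourier_series_has_sum[OF \<phi>, of x] has_sum_uminusI[OF fourier_series_has_sum[OF \<phi>, of y]]]
        by (simp add: algebra_simps)
      show "cmod (\<i> * of_int j * c j * (mode j x - mode j y)) \<le> 2 * \<bar>x - y\<bar> powr a * w j" for j
      proof -
        have "cmod (\<i> * of_int j * c j * (mode j x - mode j y)) \<le> \<bar>real_of_int j\<bar> * cmod (c j) * (2 * (\<bar>real_of_int j\<bar> * \<bar>x - y\<bar>) powr a)"
          using a by (simp add: norm_mult mult_left_mono mode_diff_le_powr)
        also have "\<dots> = \<bar>real_of_int j\<bar> powr (1 + a) * (2 * \<bar>x - y\<bar> powr a * cmod (c j))"
          by (simp add: powr_add powr_mult)
        also have "\<dots> \<le> bracket j powr ((1 + a) / 2) * (2 * \<bar>x - y\<bar> powr a * cmod (c j))"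
          using a by (intro mult_right_mono abs_le_bracket) auto
        finally show ?thesis by (simp add: w_def mult_ac)
      qed
    qed
    moreover have "cmod (\<phi> x - \<phi> y) = \<bar>deriv f x - deriv f y\<bar>"
      unfolding \<phi>_eq by (metis norm_of_real of_real_diff real_norm_def)
    ultimately show ?thesis by (simp add: mult_ac)
  qed
  show "C1_hol a (2 * embed_const (r - (1 + a)) * sobolev_norm r f) f"
    unfolding C1_hol_def
  proof (intro conjI allI)
    show "(f has_real_derivative deriv f x) (at x)" for x using Re deriv by simp
    show "\<bar>deriv f x\<bar> \<le> 2 * embed_const (r - (1 + a)) * sobolev_norm r f" for x
      using 1[of x] M by linarith
    show "\<bar>deriv f x - deriv f y\<bar> \<le> 2 * embed_const (r - (1 + a)) * sobolev_norm r f * \<bar>x - y\<bar> powr a" for x y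
      by (rule order_trans[OF 2[of x y] mult_right_mono[OF M]]) simp
  qed
qed

section \<open>The Schur test and the Hilbert transform\<close>

interpretation circ2: pair_sigma_finite circ circ
  by unfold_locales

lemma borel_measurable_circ2:
  assumes "f \<in> borel_measurable (borel \<Otimes>\<^sub>M borel)"
  shows "f \<in> borel_measurable (circ \<Otimes>\<^sub>M circ)"
proof -
  have "(\<lambda>p. (fst p, snd p)) \<in> circ \<Otimes>\<^sub>M circ \<rightarrow>\<^sub>M borel \<Otimes>\<^sub>M borel"
    by (intro measurable_Pair measurable_compose[OF measurable_fst ident_measurable_circ]
        measurable_compose[OF measurable_snd ident_measurable_circ])
  from measurable_compose[OF this assms] show ?thesis by simp
qed

text \<open>The exponent \<open>a\<close> is the gain over the critical singularity
  \<open>1 / |s|\<close> and makes the weight integrable. At \<open>s = 0\<close> the value is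
  \<open>0\<close>, by the convention for \<open>powr\<close>.\<close>

definition weight :: "real \<Rightarrow> real \<Rightarrow> real" where "weight a s = \<bar>s\<bar> powr (a - 1)"

lemma weight_nonneg [simp]: "weight a s \<ge> 0"
  by (simp add: weight_def)

lemma weight_measurable [measurable]: "weight a \<in> borel_measurable borel"
  unfolding weight_def[abs_def] by measurable

lemma integrable_weight:
  assumes "a > 0"
  shows "integrable circ (weight a)"
proof -
  have *: "(\<lambda>x. x powr (a - 1)) integrable_on {0..pi}"
    using assms by (intro integrable_on_powr_from_0) auto
  have 1: "weight a integrable_on {0..pi}"
    by (rule integrable_eq[OF *]) (auto simp: weight_def)
  have 2: "weight a integrable_on {-pi..0}"
    using 1 Henstock_Kurzweil_Integration.integrable_reflect_real[of "weight a" pi 0] by (simp add: weight_def[abs_def])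
  have "weight a integrable_on {-pi..pi}"
    by (rule Henstock_Kurzweil_Integration.integrable_combine[OF _ _ 2 1]) auto
  then have "weight a absolutely_integrable_on {-pi..pi}"
    by (intro nonnegative_absolutely_integrable_1) auto
  then have "set_integrable lborel {-pi..pi} (weight a)"
    unfolding set_integrable_def by (subst (asm) integrable_completion) measurable
  then show ?thesis by (simp add: set_integrable_circ)
qed

definition weight_mass :: "real \<Rightarrow> real" where "weight_mass a = (LINT s|circ. weight a s)"

text \<open>This is the Cauchy--Schwarz inequality for the measure \<open>w d\<sigma>\<close>, followed by Tonelli.\<close>

lemma schur_test:
  assumes \<phi> [measurable]: "(\<lambda>(x, s). \<phi> x s) \<in> borel_measurable (circ \<Otimes>\<^sub>M circ)"
    and w [measurable]: "w \<in> borel_measurable circ" "integrable circ w"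
    and v [measurable]: "v \<in> borel_measurable circ"
    and nn: "\<And>x s. 0 \<le> \<phi> x s" "\<And>s. 0 \<le> w s"
    and Q: "0 \<le> Q" "\<And>s. s \<in> {-pi..pi} \<Longrightarrow> (\<integral>\<^sup>+x. ennreal ((\<phi> x s)\<^sup>2) \<partial>circ) \<le> ennreal Q"
    and le: "\<And>x. x \<in> {-pi..pi} \<Longrightarrow> ennreal \<bar>v x\<bar> \<le> (\<integral>\<^sup>+s. ennreal (\<phi> x s * w s) \<partial>circ)"
  shows "(LINT x|circ. (v x)\<^sup>2) \<le> (LINT s|circ. w s)\<^sup>2 * Q"
proof -
  define W where "W = (LINT s|circ. w s)"
  have W: "W \<ge> 0" "(\<integral>\<^sup>+s. ennreal (w s) \<partial>circ) = ennreal W"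
    using w nn by (auto simp: W_def nn_integral_eq_integral)
  have pt: "ennreal ((v x)\<^sup>2) \<le> (\<integral>\<^sup>+s. ennreal ((\<phi> x s)\<^sup>2 * w s) \<partial>circ) * ennreal W" if x: "x \<in> {-pi..pi}" for x
  proof -
    have [measurable]: "(\<lambda>s. \<phi> x s) \<in> borel_measurable circ"
      using measurable_compose[OF measurable_Pair1' \<phi>, of x] x by simp
    have "ennreal ((v x)\<^sup>2) = (ennreal \<bar>v x\<bar>)\<^sup>2"
      by (simp add: ennreal_power)
    also have "\<dots> \<le> (\<integral>\<^sup>+s. ennreal (\<phi> x s * w s) \<partial>circ)\<^sup>2"
      by (intro power_mono le x) simp
    also have "\<dots> = (\<integral>\<^sup>+s. ennreal (\<phi> x s * sqrt (w s)) * ennreal (sqrt (w s)) \<partial>circ)\<^sup>2"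
      using nn by (simp add: ennreal_mult[symmetric] mult.assoc)
    also have "\<dots> \<le> (\<integral>\<^sup>+s. (ennreal (\<phi> x s * sqrt (w s)))\<^sup>2 \<partial>circ) * (\<integral>\<^sup>+s. (ennreal (sqrt (w s)))\<^sup>2 \<partial>circ)"
      by (rule Cauchy_Schwarz_nn_integral) measurable
    also have "\<dots> = (\<integral>\<^sup>+s. ennreal ((\<phi> x s)\<^sup>2 * w s) \<partial>circ) * ennreal W"
      using nn by (simp add: ennreal_power power_mult_distrib W)
    finally show ?thesis .
  qed
  have "(\<integral>\<^sup>+x. ennreal ((v x)\<^sup>2) \<partial>circ) \<le> (\<integral>\<^sup>+x. (\<integral>\<^sup>+s. ennreal ((\<phi> x s)\<^sup>2 * w s) \<partial>circ) * ennreal W \<partial>circ)"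
    by (intro nn_integral_mono pt) simp
  also have "\<dots> = (\<integral>\<^sup>+x. (\<integral>\<^sup>+s. ennreal ((\<phi> x s)\<^sup>2 * w s) \<partial>circ) \<partial>circ) * ennreal W"
    by (rule nn_integral_multc) measurable
  also have "(\<integral>\<^sup>+x. (\<integral>\<^sup>+s. ennreal ((\<phi> x s)\<^sup>2 * w s) \<partial>circ) \<partial>circ) = (\<integral>\<^sup>+s. (\<integral>\<^sup>+x. ennreal ((\<phi> x s)\<^sup>2 * w s) \<partial>circ) \<partial>circ)"
    by (rule circ2.Fubini'[symmetric]) measurable
  also have "\<dots> \<le> (\<integral>\<^sup>+s. ennreal Q * ennreal (w s) \<partial>circ)"
  proof (rule nn_integral_mono)
    fix s assume "s \<in> space circ"
    then have s: "s \<in> {-pi..pi}" by simp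
    have [measurable]: "(\<lambda>x. \<phi> x s) \<in> borel_measurable circ"
      using measurable_compose[OF measurable_Pair2' \<phi>, of s] s by simp
    have "(\<integral>\<^sup>+x. ennreal ((\<phi> x s)\<^sup>2 * w s) \<partial>circ) = (\<integral>\<^sup>+x. ennreal ((\<phi> x s)\<^sup>2) * ennreal (w s) \<partial>circ)"
      using nn by (simp add: ennreal_mult)
    also have "\<dots> = (\<integral>\<^sup>+x. ennreal ((\<phi> x s)\<^sup>2) \<partial>circ) * ennreal (w s)"
      by (rule nn_integral_multc) measurable
    also have "\<dots> \<le> ennreal Q * ennreal (w s)"
      by (intro mult_right_mono Q s) simp
    finally show "(\<integral>\<^sup>+x. ennreal ((\<phi> x s)\<^sup>2 * w s) \<partial>circ) \<le> ennreal Q * ennreal (w s)" .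
  qed
  also have "(\<integral>\<^sup>+s. ennreal Q * ennreal (w s) \<partial>circ) = ennreal Q * ennreal W"
    by (subst nn_integral_cmult) (auto simp: W)
  finally have "(\<integral>\<^sup>+x. ennreal ((v x)\<^sup>2) \<partial>circ) \<le> ennreal Q * ennreal W * ennreal W"
    by (simp add: mult_right_mono)
  also have "\<dots> = ennreal (W\<^sup>2 * Q)"
    using W(1) Q(1) by (simp add: ennreal_mult[symmetric] power2_eq_square mult_ac)
  finally have "(\<integral>\<^sup>+x. ennreal ((v x)\<^sup>2) \<partial>circ) \<le> ennreal (W\<^sup>2 * Q)" .
  then show ?thesis unfolding W_def[symmetric]
    using W(1) Q(1) by (subst integral_eq_nn_integral) (auto intro!: enn2real_leI)
qed

text \<open>\<open>sin (s/2) = 2 sin (s/4) cos (s/4)\<close>, and the cosine is at least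
  \<open>sqrt 2 / 2\<close> on \<open>[0, pi/4]\<close>. This bounds the second factor directly and
  the first through the mean value theorem.\<close>

lemma sin_half_ge: "\<bar>sin (s / 2)\<bar> \<ge> \<bar>s\<bar> / 4" if "\<bar>s\<bar> \<le> pi"
proof -
  have pos: "sin (s / 2) \<ge> s / 4" if s: "0 < s" "s \<le> pi" for s
  proof -
    have cosge: "cos z \<ge> sqrt 2 / 2" if "0 \<le> z" "z \<le> pi / 4" for z
      using cos_monotone_0_pi_le[of z "pi / 4"] that by (simp add: cos_45)
    obtain z where z: "0 < z" "z < s / 4" "sin (s / 4) - sin 0 = (s / 4 - 0) * cos z"
      using MVT2[of 0 "s / 4" sin cos] s by auto
    have "sin (s / 4) = s / 4 * cos z" using z by simp
    also have "\<dots> \<ge> s / 4 * (sqrt 2 / 2)" using z s by (intro mult_left_mono cosge) auto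
    finally have 1: "s / 4 * (sqrt 2 / 2) \<le> sin (s / 4)" .
    have "s / 4 = 2 * (s / 4 * (sqrt 2 / 2)) * (sqrt 2 / 2)" by simp
    also have "\<dots> \<le> 2 * sin (s / 4) * cos (s / 4)"
      using s 1 by (intro mult_mono cosge) (auto intro!: sin_ge_zero)
    also have "\<dots> = sin (s / 2)" using sin_double[of "s / 4"] by simp
    finally show ?thesis .
  qed
  show ?thesis
    using pos[of s] pos[of "- s"] that by (cases "s > 0"; cases "s = 0") auto
qed

lemma sin_half_nonzero: "sin (s / 2) \<noteq> 0" if "\<bar>s\<bar> \<le> pi" "s \<noteq> 0"
  using sin_half_ge[of s] that by auto

lemma cot_half_le: "\<bar>cot (s / 2)\<bar> \<le> 4 / \<bar>s\<bar>" if "\<bar>s\<bar> \<le> pi"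
proof (cases "s = 0")
  case False
  have "\<bar>cot (s / 2)\<bar> = \<bar>cos (s / 2)\<bar> / \<bar>sin (s / 2)\<bar>" by (simp add: cot_def)
  also have "\<dots> \<le> 1 / (\<bar>s\<bar> / 4)"
    using sin_half_ge[OF that] False by (intro frac_le) auto
  finally show ?thesis by simp
qed (simp add: cot_def)

lemma cot_measurable [measurable]:
  "f \<in> borel_measurable M \<Longrightarrow> (\<lambda>x. cot (f x :: real)) \<in> borel_measurable M"
proof -
  have [measurable]: "(sin :: real \<Rightarrow> real) \<in> borel_measurable borel" "(cos :: real \<Rightarrow> real) \<in> borel_measurable borel"
    by (intro borel_measurable_continuous_onI continuous_intros)+
  assume [measurable]: "f \<in> borel_measurable M"
  have "(\<lambda>x. cos (f x) / sin (f x)) \<in> borel_measurable M" by measurable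
  then show ?thesis by (simp add: cot_def)
qed

text \<open>A Hoelder increment against the singularity of the cotangent. Both sides are
  \<open>0\<close> at \<open>s = 0\<close>, so the origin needs no exception in the bounds built on
  it.\<close>

lemma powr_div_abs: "\<bar>s\<bar> powr a * (c / \<bar>s\<bar>) = c * weight a s"
  by (cases "s = 0") (auto simp: weight_def powr_diff)

text \<open>With \<open>z = e^(-is)\<close> one has \<open>(1 - z) cot (s/2) = i (1 + z)\<close>.
  The geometric sum turns the integrand into a trigonometric polynomial with constant term
  \<open>i\<close>, so the multiplier of the Hilbert transform is \<open>2 pi i\<close> for every
  \<open>n > 0\<close>. Its boundedness in \<open>n\<close> is the \<open>L_2\<close> boundedness of
  the transform.\<close>

lemma cot_mode_integral_nat:
  fixes n :: nat
  shows "cmod (LINT s|circ. (1 - mode (- int n) s) * of_real (cot (s / 2))) \<le> 2 * pi"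
proof (cases "n = 0")
  case False
  have eq: "(1 - mode (- int n) s) * of_real (cot (s / 2)) = (\<Sum>l<n. \<i> * mode (- int l) s) + (\<Sum>l<n. \<i> * mode (- int (Suc l)) s)"
    if s: "s \<in> {-pi..pi}" "s \<noteq> 0" for s
  proof -
    define z where "z = mode (- 1) s"
    have pw: "mode (- int l) s = z ^ l" for l
      unfolding z_def mode_def Complex.DeMoivre by simp
    have s0: "sin (s / 2) \<noteq> 0" using s by (intro sin_half_nonzero) auto
    have z: "z = cis (- (s / 2)) * cis (- (s / 2))" by (simp add: z_def mode_def cis_mult)
    have cot: "(1 - z) * of_real (cot (s / 2)) = \<i> * (1 + z)"
      using s0 unfolding z
      by (simp add: complex_eq_iff cot_def field_simps) (metis distrib_left mult.right_neutral sin_cos_squared_add3)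
    have "(1 - z ^ n) * of_real (cot (s / 2)) = (1 - z) * (\<Sum>l<n. z ^ l) * of_real (cot (s / 2))"
      by (simp add: one_diff_power_eq)
    also have "\<dots> = \<i> * (1 + z) * (\<Sum>l<n. z ^ l)"
      unfolding cot[symmetric] by (simp add: mult_ac)
    also have "\<dots> = (\<Sum>l<n. \<i> * z ^ l) + (\<Sum>l<n. \<i> * z ^ Suc l)"
      by (simp add: algebra_simps sum_distrib_left sum.distrib)
    finally show ?thesis unfolding pw .
  qed
  have "(LINT s|circ. (1 - mode (- int n) s) * of_real (cot (s / 2))) = (LINT s|circ. (\<Sum>l<n. \<i> * mode (- int l) s) + (\<Sum>l<n. \<i> * mode (- int (Suc l)) s))"
  proof (rule integral_cong_AE)
    have "AE s in lborel. s \<noteq> (0::real)" by (rule AE_lborel_singleton)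
    then have "AE s in circ. s \<noteq> 0" unfolding circ_def by (subst AE_restrict_space_iff) auto
    then show "AE s in circ. (1 - mode (- int n) s) * of_real (cot (s / 2)) = (\<Sum>l<n. \<i> * mode (- int l) s) + (\<Sum>l<n. \<i> * mode (- int (Suc l)) s)"
      by (rule AE_mp) (use eq in \<open>auto intro!: AE_I2 simp del: of_nat_Suc\<close>)
  qed (auto intro!: borel_measurable_circ)
  also have "\<dots> = (\<Sum>l<n. \<i> * (LINT s|circ. mode (- int l) s)) + (\<Sum>l<n. \<i> * (LINT s|circ. mode (- int (Suc l)) s))"
    by (subst Bochner_Integration.integral_add Bochner_Integration.integral_sum integral_mult_right_zero
        | intro integrable_circ_continuous continuous_intros)+ simp
  also have "(\<Sum>l<n. \<i> * (LINT s|circ. mode (- int (Suc l)) s)) = 0"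
    by (intro sum.neutral ballI) (simp only: integral_mode, simp)
  also have "(\<Sum>l<n. \<i> * (LINT s|circ. mode (- int l) s)) = (\<Sum>l<n. if l = 0 then \<i> * of_real (2 * pi) else 0)"
    by (intro sum.cong refl) (simp only: integral_mode, simp)
  also have "\<dots> = \<i> * of_real (2 * pi)" using False by (subst sum.delta) auto
  finally show ?thesis by (simp add: norm_mult)
qed simp

lemma cot_mode_integral: "cmod (LINT s|circ. (1 - mode (- j) s) * of_real (cot (s / 2))) \<le> 2 * pi"
proof (cases "j \<ge> 0")
  case True
  then show ?thesis using cot_mode_integral_nat[of "nat j"] by simp
next
  case False
  have "(LINT s|circ. (1 - mode (- j) s) * of_real (cot (s / 2)))
      = (LINT s|circ. cnj ((1 - mode j s) * of_real (cot (s / 2))))"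
    by (simp add: cnj_mode)
  also have "cmod \<dots> = cmod (LINT s|circ. (1 - mode j s) * of_real (cot (s / 2)))"
    by (subst Bochner_Integration.integral_cnj) simp
  also have "\<dots> \<le> 2 * pi" using cot_mode_integral_nat[of "nat (- j)"] False by simp
  finally show ?thesis .
qed

text \<open>Up to a constant factor, this is the periodic Hilbert transform.\<close>

definition hilbert :: "(real \<Rightarrow> complex) \<Rightarrow> real \<Rightarrow> complex" where
  "hilbert g x = (LINT s|circ. (g x - g (x - s)) * of_real (cot (s / 2)))"

text \<open>Termwise integration. The weighted summability gives
  \<open>|p n s| \<le> 2 S |s|^a\<close> uniformly in \<open>n\<close>, so after multiplication by
  the cotangent a multiple of \<open>weight a\<close> dominates.\<close>

lemma hilbert_fourier_series:
  assumes g: "fourier_series b g" and a: "0 < a" "a \<le> 1"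
    and sm: "(\<lambda>j. bracket j powr (a / 2) * cmod (b j)) summable_on UNIV"
  shows "fourier_series (\<lambda>j. b j * (LINT s|circ. (1 - mode (- j) s) * of_real (cot (s / 2)))) (hilbert g)"
proof -
  define d where "d j = (LINT s|circ. (1 - mode (- j) s) * of_real (cot (s / 2)))" for j
  define w where "w j = bracket j powr (a / 2) * cmod (b j)" for j
  define S where "S = infsum w UNIV"
  define G where "G x = (\<Sum>\<^sub>\<infinity>j. b j * d j * mode j x)" for x
  have G: "fourier_series (\<lambda>j. b j * d j) G"
    unfolding G_def
    by (intro fourier_series_exists fourier_series_mult_bounded[OF fourier_series_summable[OF g]])
       (use cot_mode_integral in \<open>auto simp: d_def\<close>)
  have "G x = hilbert g x" for x
  proof -
    define p where "p n s = (\<Sum>j\<in>{- int n..int n}. b j * (mode j x - mode j (x - s)))" for n s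
    have tb: "cmod (b j * (mode j x - mode j (x - s))) \<le> 2 * \<bar>s\<bar> powr a * w j" for s j
    proof -
      have "cmod (b j * (mode j x - mode j (x - s))) \<le> cmod (b j) * (2 * (\<bar>real_of_int j\<bar> * \<bar>x - (x - s)\<bar>) powr a)"
        using a unfolding norm_mult by (intro mult_left_mono mode_diff_le_powr) auto
      also have "\<dots> = 2 * \<bar>s\<bar> powr a * (\<bar>real_of_int j\<bar> powr a * cmod (b j))"
        by (simp add: powr_mult)
      also have "\<dots> \<le> 2 * \<bar>s\<bar> powr a * w j"
        unfolding w_def using a by (intro mult_left_mono mult_right_mono abs_le_bracket) auto
      finally show ?thesis .
    qed
    have pb: "cmod (p n s) \<le> 2 * S * \<bar>s\<bar> powr a" for n s
    proof -
      have "cmod (p n s) \<le> (\<Sum>j\<in>{- int n..int n}. 2 * \<bar>s\<bar> powr a * w j)"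
        unfolding p_def
        by (rule order_trans[OF norm_sum sum_mono[OF tb]])
      also have "\<dots> = 2 * \<bar>s\<bar> powr a * sum w {- int n..int n}" by (simp add: sum_distrib_left)
      also have "\<dots> \<le> 2 * \<bar>s\<bar> powr a * S"
        unfolding S_def using sm by (intro mult_left_mono finite_sum_le_infsum) (auto simp: w_def[abs_def])
      finally show ?thesis by (simp add: mult_ac)
    qed
    have dom: "cmod (b j * (mode j x - mode j (x - s)) * of_real (cot (s / 2))) \<le> (2 * w j * 4) * weight a s" if "s \<in> {-pi..pi}" for s j
    proof -
      have "cmod (b j * (mode j x - mode j (x - s)) * of_real (cot (s / 2))) \<le> 2 * \<bar>s\<bar> powr a * w j * (4 / \<bar>s\<bar>)"
        unfolding norm_mult[of "b j * _"] using cot_half_le[of s] that tb[of j s]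
        by (intro mult_mono) (auto simp: w_def)
      also have "\<dots> = 2 * w j * (\<bar>s\<bar> powr a * (4 / \<bar>s\<bar>))" by simp
      also have "\<dots> = (2 * w j * 4) * weight a s" unfolding powr_div_abs by simp
      finally show ?thesis .
    qed
    have mp [measurable]: "p n \<in> borel_measurable borel" for n
      unfolding p_def[abs_def] by (intro borel_measurable_continuous_onI continuous_intros)
    have lim: "(\<lambda>n. LINT s|circ. p n s * of_real (cot (s / 2))) \<longlonglongrightarrow> hilbert g x"
      unfolding hilbert_def
    proof (rule integral_dominated_convergence)
      show "integrable circ (\<lambda>s. 8 * S * weight a s)"
        using integrable_weight[OF a(1)] by simp
      have [measurable]: "g \<in> borel_measurable borel"
        using fourier_series_continuous[OF g] by (rule borel_measurable_continuous_onI)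
      show "(\<lambda>s. (g x - g (x - s)) * of_real (cot (s / 2))) \<in> borel_measurable circ"
        by (intro borel_measurable_circ) measurable
      show "(\<lambda>s. p n s * of_real (cot (s / 2))) \<in> borel_measurable circ" for n
        by (intro borel_measurable_circ) measurable
      have "(\<lambda>n. p n s) \<longlonglongrightarrow> g x - g (x - s)" for s
        using tendsto_diff[OF fourier_series_LIMSEQ[OF g, of x] fourier_series_LIMSEQ[OF g, of "x - s"]]
        unfolding p_def by (simp add: right_diff_distrib sum_subtractf)
      then show "AE s in circ. (\<lambda>n. p n s * of_real (cot (s / 2))) \<longlonglongrightarrow> (g x - g (x - s)) * of_real (cot (s / 2))"
        by (intro AE_I2 tendsto_intros)
      show "AE s in circ. norm (p n s * of_real (cot (s / 2))) \<le> 8 * S * weight a s" for n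
      proof (rule AE_I2)
        fix s assume "s \<in> space circ"
        then have "norm (p n s * of_real (cot (s / 2))) \<le> 2 * S * \<bar>s\<bar> powr a * (4 / \<bar>s\<bar>)"
          unfolding norm_mult using cot_half_le[of s] pb[of n s] order_trans[OF norm_ge_zero pb[of n s]]
          by (intro mult_mono) auto
        also have "\<dots> = 2 * S * (\<bar>s\<bar> powr a * (4 / \<bar>s\<bar>))" by simp
        also have "\<dots> = 8 * S * weight a s" unfolding powr_div_abs by simp
        finally show "norm (p n s * of_real (cot (s / 2))) \<le> 8 * S * weight a s" .
      qed
    qed
    have "(LINT s|circ. p n s * of_real (cot (s / 2))) = (\<Sum>j\<in>{- int n..int n}. b j * d j * mode j x)" for n
    proof -
      have int: "integrable circ (\<lambda>s. b j * (mode j x - mode j (x - s)) * of_real (cot (s / 2)))" for j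
      proof (rule Bochner_Integration.integrable_bound)
        show "integrable circ (\<lambda>s. (2 * w j * 4) * weight a s)"
          using integrable_weight[OF a(1)] by simp
        show "AE s in circ. norm (b j * (mode j x - mode j (x - s)) * of_real (cot (s / 2))) \<le> norm ((2 * w j * 4) * weight a s)"
          by (intro AE_I2 order_trans[OF dom]) auto
        show "(\<lambda>s. b j * (mode j x - mode j (x - s)) * of_real (cot (s / 2))) \<in> borel_measurable circ"
          by (intro borel_measurable_circ) measurable
      qed
      have "(LINT s|circ. p n s * of_real (cot (s / 2))) = (\<Sum>j\<in>{- int n..int n}. (LINT s|circ. b j * (mode j x - mode j (x - s)) * of_real (cot (s / 2))))"
        unfolding p_def sum_distrib_right by (rule Bochner_Integration.integral_sum) (rule int)
      also have "\<dots> = (\<Sum>j\<in>{- int n..int n}. (LINT s|circ. b j * mode j x * ((1 - mode (- j) s) * of_real (cot (s / 2)))))"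
        using mode_shift[of _ x "- _"] by (simp add: mode_def right_diff_distrib left_diff_distrib mult.assoc)
      finally show ?thesis by (simp add: d_def mult_ac)
    qed
    with lim have "(\<lambda>n. \<Sum>j\<in>{- int n..int n}. b j * d j * mode j x) \<longlonglongrightarrow> hilbert g x" by simp
    then show ?thesis using LIMSEQ_unique fourier_series_LIMSEQ[OF G] by blast
  qed
  then have "G = hilbert g" by (simp add: fun_eq_iff)
  with G show ?thesis by (simp add: d_def)
qed

section \<open>Operators with a Hilbert type kernel\<close>

text \<open>A kernel whose singular part at \<open>s = 0\<close> is a multiple of the cotangent. The
  coefficient \<open>c\<close> carries a bound on its size but no regularity, not even
  measurability. The factor \<open>weight a s / |s|\<close> is \<open>|s|^(a-2)\<close>.\<close>

definition singular_kernel :: "real \<Rightarrow> real \<Rightarrow> (real \<Rightarrow> real \<Rightarrow> real) \<Rightarrow> bool" where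
  "singular_kernel a A k \<longleftrightarrow>
     (\<lambda>(x, s). k x s) \<in> borel_measurable (borel \<Otimes>\<^sub>M borel) \<and>
     (\<forall>x s. k (x + 2 * pi) s = k x s) \<and>
     (\<exists>c. \<forall>x. \<bar>c x\<bar> \<le> A \<and> (\<forall>s. 0 < \<bar>s\<bar> \<longrightarrow> \<bar>s\<bar> \<le> pi \<longrightarrow> \<bar>k x s - c x * cot (s / 2)\<bar> \<le> A * weight a s)) \<and>
     (\<forall>x \<tau> s. 0 < \<bar>s\<bar> \<longrightarrow> \<bar>s\<bar> \<le> pi \<longrightarrow> \<bar>k (x + \<tau>) s - k x s\<bar> \<le> A * \<bar>\<tau>\<bar> * (weight a s / \<bar>s\<bar>))"

text \<open>The increment of a Hoelder continuous \<open>g\<close> makes this integral absolutely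
  convergent, so no principal value is involved.\<close>

definition kernel_op :: "(real \<Rightarrow> real \<Rightarrow> real) \<Rightarrow> (real \<Rightarrow> real) \<Rightarrow> real \<Rightarrow> real" where
  "kernel_op k g x = (LINT s|circ. (g x - g (x - s)) * k x s)"

section \<open>Bessel's inequality for difference quotients\<close>

lemma periodic_shift_integral:
  fixes v :: "real \<Rightarrow> complex"
  assumes v: "continuous_on UNIV v" and per: "\<And>x. v (x + 2 * pi) = v x" and y: "0 \<le> y" "y \<le> 2 * pi"
  shows "(LINT x|circ. v (x + y)) = (LINT x|circ. v x)"
proof -
  have int: "v integrable_on {a..b}" for a b
    by (intro integrable_continuous_real continuous_on_subset[OF v]) simp
  have L: "(LINT x|circ. u x) = integral {-pi..pi} u" if "continuous_on UNIV u" for u :: "real \<Rightarrow> complex"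
    unfolding set_integral_circ[symmetric]
    using integrable_circ_continuous[OF that] by (intro set_borel_integral_eq_integral) (simp add: set_integrable_circ)
  have "(LINT x|circ. v (x + y)) = integral {-pi..pi} (\<lambda>x. v (x + y))"
    by (rule L) (intro continuous_intros continuous_on_compose2[OF v]; simp)
  also have "\<dots> = integral {-pi + y..pi + y} v"
    using integral_shift[of "-pi" y pi v] continuous_on_subset[OF v] by (simp add: o_def add.commute)
  also have "\<dots> = integral {-pi + y..pi} v + integral {pi..pi + y} v"
    using y by (intro Henstock_Kurzweil_Integration.integral_combine[symmetric] int) auto
  also have "integral {pi..pi + y} v = integral {-pi..-pi + y} (\<lambda>x. v (x + 2 * pi))"
    using integral_shift[of "-pi" "2 * pi" "-pi + y" v] continuous_on_subset[OF v] by (simp add: o_def add.commute)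
  also have "\<dots> = integral {-pi..-pi + y} v" by (simp add: per)
  also have "integral {-pi + y..pi} v + integral {-pi..-pi + y} v = integral {-pi..pi} v"
    using y Henstock_Kurzweil_Integration.integral_combine[OF _ _ int, of "-pi" "-pi + y" pi] by (simp add: add.commute)
  also have "\<dots> = (LINT x|circ. v x)" by (rule L[OF v, symmetric])
  finally show ?thesis .
qed

lemma fourier_difference:
  assumes v: "continuous_on UNIV v" and per: "\<And>x. v (x + 2 * pi) = v x" and y: "0 \<le> y" "y \<le> 2 * pi"
  shows "fourier (\<lambda>x. v (x + y) - v x) k = (mode k y - 1) * fourier v k"
proof -
  have c: "continuous_on UNIV (\<lambda>x. v (x + y))"
    by (intro continuous_on_compose2[OF v] continuous_intros) auto
  have "(LINT x|circ. v (x + y) * mode (- k) x) = (LINT x|circ. mode k y * (v (x + y) * mode (- k) (x + y)))"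
  proof (rule Bochner_Integration.integral_cong)
    have "mode k y * (v (x + y) * mode (- k) (x + y)) = (mode k y * mode (- k) y) * (v (x + y) * mode (- k) x)" for x
      by (simp add: mode_shift mult_ac)
    then show "v (x + y) * mode (- k) x = mode k y * (v (x + y) * mode (- k) (x + y))" for x
      using mode_add[of k "- k" y] by (simp only: add.right_inverse mode_0 mult_1)
  qed simp
  also have "\<dots> = mode k y * (LINT x|circ. v (x + y) * mode (- k) (x + y))" by simp
  also have "(LINT x|circ. v (x + y) * mode (- k) (x + y)) = (LINT x|circ. v x * mode (- k) x)"
    by (rule periodic_shift_integral[OF _ _ y]) (auto intro!: continuous_intros v simp: per mode_periodic)
  finally have "(LINT x|circ. v (x + y) * mode (- k) x) = mode k y * (LINT x|circ. v x * mode (- k) x)" .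
  moreover have "integrable circ (\<lambda>x. v (x + y) * mode (- k) x)" "integrable circ (\<lambda>x. v x * mode (- k) x)"
    by (intro integrable_circ_continuous continuous_intros c v)+
  ultimately show ?thesis by (simp add: fourier_def left_diff_distrib right_diff_distrib diff_divide_distrib)
qed

text \<open>\<open>|e^(ikt) - 1| = 2 |sin (kt/2)|\<close>, so the limit is the squared derivative of
  a sine at \<open>0\<close>.\<close>

lemma mode_quotient_tendsto:
  "((\<lambda>t. (cmod (mode k t - 1))\<^sup>2 / t\<^sup>2) \<longlongrightarrow> (real_of_int k)\<^sup>2) (at_right 0)"
proof -
  have eq: "(cmod (mode k t - 1))\<^sup>2 = 4 * (sin (k * t / 2))\<^sup>2" for t :: real
  proof -
    have "(cmod (mode k t - 1))\<^sup>2 = 2 - 2 * cos (k * t)"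
      using sin_cos_squared_add3[of "k * t"] unfolding cmod_power2
      by (simp add: mode_def power2_eq_square algebra_simps)
    then show ?thesis using cos_double_sin[of "k * t / 2"] by simp
  qed
  have "((\<lambda>t::real. sin (k * t / 2)) has_real_derivative k / 2) (at 0)"
    by (auto intro!: derivative_eq_intros)
  then have "((\<lambda>t::real. sin (k * t / 2) / t) \<longlongrightarrow> k / 2) (at 0)"
    by (simp add: DERIV_def)
  then have "((\<lambda>t::real. sin (k * t / 2) / t) \<longlongrightarrow> k / 2) (at_right 0)"
    by (rule filterlim_mono) (auto intro: at_le)
  from tendsto_mult_left[OF tendsto_power[OF this, of 2], of 4]
  have "((\<lambda>t::real. 4 * (sin (k * t / 2) / t)\<^sup>2) \<longlongrightarrow> 4 * (k / 2)\<^sup>2) (at_right 0)" .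
  then show ?thesis by (simp add: eq power_divide)
qed

text \<open>Bessel's inequality for \<open>v (x + t) - v x\<close>, divided by \<open>t^2\<close>:
  as \<open>t\<close> tends to \<open>0\<close> the multiplier becomes \<open>j^2\<close>. The sum
  is finite, so the limit passes inside, and the weak derivative of \<open>v\<close> is never
  formed.\<close>

lemma bessel_derivative:
  assumes v: "continuous_on UNIV v" and per: "\<And>x. v (x + 2 * pi) = v x"
    and dq: "\<And>y. 0 < y \<Longrightarrow> y \<le> 1 \<Longrightarrow> (LINT x|circ. (cmod (v (x + y) - v x))\<^sup>2) \<le> 2 * pi * K * y\<^sup>2"
    and F: "finite F"
  shows "(\<Sum>j\<in>F. (real_of_int j)\<^sup>2 * (cmod (fourier v j))\<^sup>2) \<le> K"
proof (rule tendsto_upperbound)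
  show "((\<lambda>t. \<Sum>j\<in>F. (cmod (mode j t - 1))\<^sup>2 / t\<^sup>2 * (cmod (fourier v j))\<^sup>2) \<longlongrightarrow> (\<Sum>j\<in>F. (real_of_int j)\<^sup>2 * (cmod (fourier v j))\<^sup>2)) (at_right 0)"
    by (intro tendsto_intros mode_quotient_tendsto)
  have "\<forall>\<^sub>F t in at_right (0::real). 0 < t \<and> t < 1"
    by (auto simp: eventually_at_right_field intro: exI[of _ 1])
  then show "\<forall>\<^sub>F t in at_right 0. (\<Sum>j\<in>F. (cmod (mode j t - 1))\<^sup>2 / t\<^sup>2 * (cmod (fourier v j))\<^sup>2) \<le> K"
  proof eventually_elim
    case (elim t)
    have t2: "t \<le> 2 * pi" using elim pi_gt3 by linarith
    have "continuous_on UNIV (\<lambda>x. v (x + t) - v x)"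
      by (intro continuous_intros continuous_on_compose2[OF v] v) auto
    from bessel[OF this F] have "2 * pi * (\<Sum>j\<in>F. (cmod (fourier (\<lambda>x. v (x + t) - v x) j))\<^sup>2) \<le> 2 * pi * K * t\<^sup>2"
      using dq[of t] elim by linarith
    then have "(\<Sum>j\<in>F. (cmod (fourier (\<lambda>x. v (x + t) - v x) j))\<^sup>2) \<le> K * t\<^sup>2"
      by (simp add: mult.assoc)
    then have "(\<Sum>j\<in>F. (cmod (mode j t - 1))\<^sup>2 * (cmod (fourier v j))\<^sup>2) \<le> K * t\<^sup>2"
      using elim t2 by (simp add: fourier_difference[OF v per] norm_mult power_mult_distrib)
    then have "(\<Sum>j\<in>F. (cmod (mode j t - 1))\<^sup>2 * (cmod (fourier v j))\<^sup>2) / t\<^sup>2 \<le> K"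
      using elim by (simp add: divide_le_eq)
    then show ?case by (simp add: sum_divide_distrib)
  qed
qed simp

text \<open>The properties of \<open>g = h'\<close>, \<open>h \<in> H\<^sup>2\<close>, that enter the estimates; \<open>Q\<close> bounds the square of the
  norm of \<open>h''\<close> in \<open>L\<^sub>2\<close>.\<close>

locale kernel_data =
  fixes a A M Q :: real and k :: "real \<Rightarrow> real \<Rightarrow> real" and g :: "real \<Rightarrow> real" and b :: "int \<Rightarrow> complex"
  assumes a: "0 < a" "a \<le> 1"
    and singular_kernel: "singular_kernel a A k"
    and g_series: "fourier_series b (\<lambda>x. of_real (g x))"
    and g_per: "\<And>x. g (x + 2 * pi) = g x"
    and g_hoelder: "\<And>x y. \<bar>g x - g y\<bar> \<le> M * \<bar>x - y\<bar> powr a"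
    and b_summable: "(\<lambda>j. bracket j powr (a / 2) * cmod (b j)) summable_on UNIV"
    and b_bound: "\<And>F. finite F \<Longrightarrow> (\<Sum>j\<in>F. (\<bar>real_of_int j\<bar> * cmod (b j))\<^sup>2) \<le> Q"
begin

lemma k_measurable: "(\<lambda>(x, s). k x s) \<in> borel_measurable (borel \<Otimes>\<^sub>M borel)"
  and k_per: "k (x + 2 * pi) s = k x s"
  and k_diff: "0 < \<bar>s\<bar> \<Longrightarrow> \<bar>s\<bar> \<le> pi \<Longrightarrow> \<bar>k (x + \<tau>) s - k x s\<bar> \<le> A * \<bar>\<tau>\<bar> * (weight a s / \<bar>s\<bar>)"
  using singular_kernel unfolding singular_kernel_def by auto

lemma A_nonneg: "A \<ge> 0"
  using singular_kernel unfolding singular_kernel_def by (meson abs_ge_zero order_trans)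

lemma M_nonneg: "M \<ge> 0"
  using g_hoelder[of 0 1] by simp

lemma Q_nonneg: "Q \<ge> 0"
  using b_bound[of "{}"] by simp

lemma g_cont: "continuous_on UNIV g"
proof -
  have "continuous_on UNIV (\<lambda>x. Re (of_real (g x)))"
    by (rule continuous_on_Re[OF fourier_series_continuous[OF g_series]])
  then show ?thesis by simp
qed

lemma g_measurable [measurable]: "g \<in> borel_measurable borel"
  by (rule borel_measurable_continuous_onI[OF g_cont])

lemma k_measurable' [measurable]: "k x \<in> borel_measurable borel"
  using measurable_compose[OF measurable_Pair1' k_measurable, of x] by simp

text \<open>The leading part contributes \<open>4 A / |s|\<close> by the bound for the cotangent.
  The remainder contributes the same, because \<open>|s|^a \<le> 4\<close> for
  \<open>|s| \<le> pi < 4\<close>.\<close>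

lemma k_bound:
  assumes s: "0 < \<bar>s\<bar>" "\<bar>s\<bar> \<le> pi"
  shows "\<bar>k x s\<bar> \<le> 8 * A / \<bar>s\<bar>"
proof -
  obtain c where c: "\<bar>c x\<bar> \<le> A" "\<bar>k x s - c x * cot (s / 2)\<bar> \<le> A * weight a s"
    using singular_kernel s unfolding singular_kernel_def by blast
  have "\<bar>c x * cot (s / 2)\<bar> \<le> A * (4 / \<bar>s\<bar>)"
    unfolding abs_mult using c cot_half_le[OF s(2)] A_nonneg by (intro mult_mono) auto
  moreover have "weight a s \<le> 4 / \<bar>s\<bar>"
  proof -
    have "\<bar>s\<bar> powr a \<le> 4"
    proof (cases "\<bar>s\<bar> \<le> 1")
      case True
      have "\<bar>s\<bar> powr a \<le> 1 powr a" using True a by (intro powr_mono2) auto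
      then show ?thesis by simp
    next
      case False
      then have "\<bar>s\<bar> powr a \<le> \<bar>s\<bar> powr 1" using a by (intro powr_mono) auto
      then show ?thesis using s pi_less_4 by simp
    qed
    then show ?thesis using s by (simp add: weight_def powr_diff divide_right_mono)
  qed
  then have "A * weight a s \<le> A * (4 / \<bar>s\<bar>)" using A_nonneg by (rule mult_left_mono)
  ultimately show ?thesis using c(2) by simp
qed

lemma integrand_bound:
  assumes "\<bar>s\<bar> \<le> pi"
  shows "\<bar>(g x - g (x - s)) * k y s\<bar> \<le> 8 * A * M * weight a s"
proof (cases "s = 0")
  case False
  have "\<bar>(g x - g (x - s)) * k y s\<bar> \<le> (M * \<bar>s\<bar> powr a) * (8 * A / \<bar>s\<bar>)"
    unfolding abs_mult using g_hoelder[of x "x - s"] k_bound[of s y] False assms M_nonneg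
    by (intro mult_mono) auto
  also have "\<dots> = M * (\<bar>s\<bar> powr a * (8 * A / \<bar>s\<bar>))" by simp
  also have "\<dots> = 8 * A * M * weight a s" unfolding powr_div_abs by simp
  finally show ?thesis .
qed (use A_nonneg M_nonneg in simp)

lemma integrand_integrable: "integrable circ (\<lambda>s. (g x - g (x - s)) * k y s)"
proof (rule Bochner_Integration.integrable_bound)
  show "integrable circ (\<lambda>s. 8 * A * M * weight a s)" using integrable_weight[OF a(1)] by simp
  show "AE s in circ. norm ((g x - g (x - s)) * k y s) \<le> norm (8 * A * M * weight a s)"
    using integrand_bound A_nonneg M_nonneg by (intro AE_I2) (auto simp: abs_le_iff)
  show "(\<lambda>s. (g x - g (x - s)) * k y s) \<in> borel_measurable circ"
    by (rule borel_measurable_circ) measurable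
qed

abbreviation "u \<equiv> kernel_op k g"

lemma u_per: "u (x + 2 * pi) = u x"
proof -
  have "g (x + 2 * pi - s) = g (x - s)" for s using g_per[of "x - s"] by (simp add: algebra_simps)
  then show ?thesis by (simp add: kernel_op_def g_per k_per)
qed

lemma u_bound: "\<bar>u x\<bar> \<le> 8 * A * M * weight_mass a"
proof -
  have "norm (u x) \<le> (LINT s|circ. 8 * A * M * weight a s)"
    unfolding kernel_op_def
    by (rule Bochner_Integration.integral_norm_bound_integral[OF integrand_integrable])
       (use integrable_weight[OF a(1)] integrand_bound in auto)
  then show ?thesis by (simp add: weight_mass_def)
qed

lemma k_cont: "0 < \<bar>s\<bar> \<Longrightarrow> \<bar>s\<bar> \<le> pi \<Longrightarrow> X \<longlonglongrightarrow> x \<Longrightarrow> (\<lambda>n. k (X n) s) \<longlonglongrightarrow> k x s"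
proof -
  assume s: "0 < \<bar>s\<bar>" "\<bar>s\<bar> \<le> pi" and X: "X \<longlonglongrightarrow> x"
  have "(\<lambda>n. A * \<bar>X n - x\<bar> * (weight a s / \<bar>s\<bar>)) \<longlonglongrightarrow> A * \<bar>x - x\<bar> * (weight a s / \<bar>s\<bar>)"
    using X by (intro tendsto_intros)
  then have 0: "(\<lambda>n. A * \<bar>X n - x\<bar> * (weight a s / \<bar>s\<bar>)) \<longlonglongrightarrow> 0" by simp
  have "(\<lambda>n. k (X n) s - k x s) \<longlonglongrightarrow> 0"
    by (rule Lim_null_comparison[OF _ 0]) (use k_diff[OF s, of x "X _ - x"] in auto)
  then show ?thesis by (simp add: LIM_zero_iff)
qed

text \<open>The dominating function \<open>8 A M weight a\<close> does not depend on
  \<open>x\<close>, and for each fixed \<open>s\<close> other than \<open>0\<close> the kernel is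
  Lipschitz in \<open>x\<close>.\<close>

lemma u_cont: "continuous_on UNIV u"
proof (subst continuous_on_sequentially, intro allI ballI impI)
  fix X :: "nat \<Rightarrow> real" and x assume "(\<forall>n. X n \<in> UNIV) \<and> X \<longlonglongrightarrow> x"
  then have X: "X \<longlonglongrightarrow> x" by simp
  have g': "(\<lambda>n. g (f n)) \<longlonglongrightarrow> g y" if "f \<longlonglongrightarrow> y" for f :: "nat \<Rightarrow> real" and y
    using continuous_on_tendsto_compose[OF g_cont that] by simp
  have "(\<lambda>n. u (X n)) \<longlonglongrightarrow> u x"
    unfolding kernel_op_def
  proof (rule integral_dominated_convergence)
    show "integrable circ (\<lambda>s. 8 * A * M * weight a s)" using integrable_weight[OF a(1)] by simp
    show "AE s in circ. (\<lambda>n. (g (X n) - g (X n - s)) * k (X n) s) \<longlonglongrightarrow> (g x - g (x - s)) * k x s"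
    proof (rule AE_I2)
      fix s assume "s \<in> space circ"
      then show "(\<lambda>n. (g (X n) - g (X n - s)) * k (X n) s) \<longlonglongrightarrow> (g x - g (x - s)) * k x s"
        using X k_cont[of s X x] by (cases "s = 0") (auto intro!: tendsto_intros g')
    qed
    show "AE s in circ. norm ((g (X n) - g (X n - s)) * k (X n) s) \<le> 8 * A * M * weight a s" for n
      using integrand_bound by (intro AE_I2) (auto simp: abs_le_iff)
  qed (intro borel_measurable_circ; measurable)+
  then show "(u \<circ> X) \<longlonglongrightarrow> u x" by (simp add: o_def)
qed

text \<open>Translation multiplies the coefficients, and
  \<open>|1 - mode j (- s)| \<le> |j| |s|\<close>. The full power of \<open>|s|\<close> comes out
  because \<open>j * b j\<close> is square summable; the pointwise Hoelder bound of \<open>g\<close>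
  gives only \<open>|s|^a\<close>.\<close>

lemma diff_g_L2: "(LINT x|circ. (g x - g (x - s))\<^sup>2) \<le> 2 * pi * (s\<^sup>2 * Q)"
proof -
  have "fourier_series (\<lambda>j. b j - b j * mode j (- s)) (\<lambda>x. of_real (g x) - of_real (g (x + - s)))"
    by (intro fourier_series_diff g_series fourier_series_shift)
  then have "(LINT x|circ. (cmod (of_real (g x) - of_real (g (x + - s))))\<^sup>2) \<le> 2 * pi * (s\<^sup>2 * Q)"
  proof (rule parseval_fourier_series)
    fix F :: "int set" assume F: "finite F"
    have "(cmod (b j - b j * mode j (- s)))\<^sup>2 \<le> s\<^sup>2 * (\<bar>real_of_int j\<bar> * cmod (b j))\<^sup>2" for j
    proof -
      have "cmod (b j - b j * mode j (- s)) = cmod (b j) * cmod (mode j 0 - mode j (- s))"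
        unfolding norm_mult[symmetric] by (simp add: right_diff_distrib)
      also have "\<dots> \<le> cmod (b j) * (\<bar>real_of_int j\<bar> * \<bar>s\<bar>)"
        using mode_diff_le[of j 0 "- s"] by (intro mult_left_mono) auto
      finally have "(cmod (b j - b j * mode j (- s)))\<^sup>2 \<le> (cmod (b j) * (\<bar>real_of_int j\<bar> * \<bar>s\<bar>))\<^sup>2"
        by (intro power_mono) auto
      then show ?thesis by (simp add: power_mult_distrib mult_ac)
    qed
    then have "(\<Sum>j\<in>F. (cmod (b j - b j * mode j (- s)))\<^sup>2) \<le> (\<Sum>j\<in>F. s\<^sup>2 * (\<bar>real_of_int j\<bar> * cmod (b j))\<^sup>2)"
      by (rule sum_mono)
    also have "\<dots> = s\<^sup>2 * (\<Sum>j\<in>F. (\<bar>real_of_int j\<bar> * cmod (b j))\<^sup>2)" by (simp add: sum_distrib_left)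
    also have "\<dots> \<le> s\<^sup>2 * Q" by (intro mult_left_mono b_bound F) simp
    finally show "(\<Sum>j\<in>F. (cmod (b j - b j * mode j (- s)))\<^sup>2) \<le> s\<^sup>2 * Q" .
  qed
  then show ?thesis unfolding of_real_diff[symmetric] norm_of_real by simp
qed

section \<open>Increment of the operator under a translation by \<open>\<tau>\<close>\<close>

context
  fixes \<tau> :: real assumes \<tau>: "0 < \<tau>" "\<tau> \<le> 1"
begin

definition "dg x = g (x + \<tau>) - g x"
definition "db j = b j * mode j \<tau> - b j"

lemma dg_series: "fourier_series db (\<lambda>x. of_real (dg x))"
  unfolding db_def dg_def of_real_diff by (intro fourier_series_diff g_series fourier_series_shift)

lemma db_le: "cmod (db j) \<le> \<tau> * (\<bar>real_of_int j\<bar> * cmod (b j))"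
proof -
  have "cmod (db j) = cmod (b j) * cmod (mode j \<tau> - mode j 0)"
    unfolding norm_mult[symmetric] by (simp add: db_def right_diff_distrib)
  also have "\<dots> \<le> cmod (b j) * (\<bar>real_of_int j\<bar> * \<bar>\<tau>\<bar>)"
    using mode_diff_le[of j \<tau> 0] by (intro mult_left_mono) auto
  finally show ?thesis using \<tau> by (simp add: mult_ac)
qed

lemma db_bound:
  assumes "finite F" "\<And>j. cmod (e j) \<le> C"
  shows "(\<Sum>j\<in>F. (cmod (db j * e j))\<^sup>2) \<le> C\<^sup>2 * \<tau>\<^sup>2 * Q"
proof -
  have C: "C \<ge> 0" using assms(2) norm_ge_zero order_trans by blast
  have "(cmod (db j * e j))\<^sup>2 \<le> C\<^sup>2 * \<tau>\<^sup>2 * (\<bar>real_of_int j\<bar> * cmod (b j))\<^sup>2" for j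
  proof -
    have "cmod (db j * e j) \<le> (\<tau> * (\<bar>real_of_int j\<bar> * cmod (b j))) * C"
      unfolding norm_mult using \<tau> by (intro mult_mono db_le assms) auto
    then have "(cmod (db j * e j))\<^sup>2 \<le> ((\<tau> * (\<bar>real_of_int j\<bar> * cmod (b j))) * C)\<^sup>2"
      by (intro power_mono) auto
    then show ?thesis by (simp add: power_mult_distrib mult_ac)
  qed
  then have "(\<Sum>j\<in>F. (cmod (db j * e j))\<^sup>2) \<le> (\<Sum>j\<in>F. C\<^sup>2 * \<tau>\<^sup>2 * (\<bar>real_of_int j\<bar> * cmod (b j))\<^sup>2)"
    by (rule sum_mono)
  also have "\<dots> = C\<^sup>2 * \<tau>\<^sup>2 * (\<Sum>j\<in>F. (\<bar>real_of_int j\<bar> * cmod (b j))\<^sup>2)" by (simp add: sum_distrib_left)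
  also have "\<dots> \<le> C\<^sup>2 * \<tau>\<^sup>2 * Q" by (intro mult_left_mono b_bound assms) simp
  finally show ?thesis .
qed

text \<open>The derivative of \<open>g\<close> is already spent on the factor \<open>\<tau>\<close>,
  so the second increment has only the trivial multiplier bound \<open>2\<close> and gains no power
  of \<open>|s|\<close>. The kernel remainder is integrable without one.\<close>

lemma diff_dg_L2: "(LINT x|circ. (dg x - dg (x - s))\<^sup>2) \<le> 2 * pi * (4 * \<tau>\<^sup>2 * Q)"
proof -
  have "fourier_series (\<lambda>j. db j - db j * mode j (- s)) (\<lambda>x. of_real (dg x) - of_real (dg (x + - s)))"
    by (intro fourier_series_diff dg_series fourier_series_shift)
  then have "(LINT x|circ. (cmod (of_real (dg x) - of_real (dg (x + - s))))\<^sup>2) \<le> 2 * pi * (2\<^sup>2 * \<tau>\<^sup>2 * Q)"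
  proof (rule parseval_fourier_series)
    fix F :: "int set" assume F: "finite F"
    have "cmod (1 - mode j (- s)) \<le> 2" for j
      using norm_triangle_ineq4[of 1 "mode j (- s)"] by simp
    from db_bound[OF F this] show "(\<Sum>j\<in>F. (cmod (db j - db j * mode j (- s)))\<^sup>2) \<le> 2\<^sup>2 * \<tau>\<^sup>2 * Q"
      by (simp add: right_diff_distrib)
  qed
  then show ?thesis unfolding of_real_diff[symmetric] norm_of_real by simp
qed

definition "H x = hilbert (\<lambda>x. of_real (dg x)) x"

lemma H_series: "fourier_series (\<lambda>j. db j * (LINT s|circ. (1 - mode (- j) s) * of_real (cot (s / 2)))) H"
  unfolding H_def
proof (rule hilbert_fourier_series[OF dg_series a])
  show "(\<lambda>j. bracket j powr (a / 2) * cmod (db j)) summable_on UNIV"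
  proof (rule summable_on_comparison_test[OF summable_on_cmult_right[OF b_summable, of 2]])
    fix j
    have "cmod (db j) \<le> cmod (b j) + cmod (b j)"
      using norm_triangle_ineq4[of "b j * mode j \<tau>" "b j"] by (simp add: db_def norm_mult)
    then have "bracket j powr (a / 2) * cmod (db j) \<le> bracket j powr (a / 2) * (2 * cmod (b j))"
      by (intro mult_left_mono) auto
    then show "bracket j powr (a / 2) * cmod (db j) \<le> 2 * (bracket j powr (a / 2) * cmod (b j))" by simp
  qed auto
qed

lemma H_L2: "(LINT x|circ. (cmod (H x))\<^sup>2) \<le> 2 * pi * ((2 * pi)\<^sup>2 * \<tau>\<^sup>2 * Q)"
  by (rule parseval_fourier_series[OF H_series]) (intro db_bound cot_mode_integral)

text \<open>The two products left after removal of the leading part: the kernel remainder against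
  the increment of \<open>g\<close>, and the increment of the kernel against \<open>g\<close>, with
  \<open>weight a s\<close> taken out of both.\<close>

definition "\<phi> x s = A * (\<bar>dg x - dg (x - s)\<bar> + \<tau> * (\<bar>g x - g (x - s)\<bar> / \<bar>s\<bar>))"
text \<open>The coefficient \<open>c\<close> of the kernel may fail to be measurable, so only the
  bound \<open>A |H|\<close> of the leading term is subtracted, not the term itself. The truncated
  difference is continuous and nonnegative and can go through the Schur test.\<close>

definition "rest x = max 0 (\<bar>u (x + \<tau>) - u x\<bar> - A * cmod (H x))"

lemma dg_cont: "continuous_on UNIV dg"
  unfolding dg_def[abs_def] by (intro continuous_intros continuous_on_compose2[OF g_cont] g_cont) auto

lemma dg_measurable [measurable]: "dg \<in> borel_measurable borel"
  by (rule borel_measurable_continuous_onI[OF dg_cont])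

lemma H_real: "H x = of_real (LINT s|circ. (dg x - dg (x - s)) * cot (s / 2))"
  unfolding H_def hilbert_def by (simp flip: of_real_diff of_real_mult)

lemma u_diff_le:
  "ennreal (rest x) \<le> (\<integral>\<^sup>+s. ennreal (\<phi> x s * weight a s) \<partial>circ)"
proof -
  obtain c where c: "\<And>x. \<bar>c x\<bar> \<le> A"
      "\<And>x s. 0 < \<bar>s\<bar> \<Longrightarrow> \<bar>s\<bar> \<le> pi \<Longrightarrow> \<bar>k x s - c x * cot (s / 2)\<bar> \<le> A * weight a s"
    using singular_kernel unfolding singular_kernel_def by blast
  define y where "y = x + \<tau>"
  have dgM: "\<bar>dg x - dg (x - s)\<bar> \<le> 2 * M * \<bar>s\<bar> powr a" for s
    using g_hoelder[of "x + \<tau>" "x - s + \<tau>"] g_hoelder[of x "x - s"] by (simp add: dg_def algebra_simps)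
  have intH: "integrable circ (\<lambda>s. (dg x - dg (x - s)) * cot (s / 2))"
  proof (rule Bochner_Integration.integrable_bound)
    show "integrable circ (\<lambda>s. 8 * M * weight a s)" using integrable_weight[OF a(1)] by simp
    show "AE s in circ. norm ((dg x - dg (x - s)) * cot (s / 2)) \<le> norm (8 * M * weight a s)"
    proof (rule AE_I2)
      fix s assume "s \<in> space circ"
      then have "\<bar>(dg x - dg (x - s)) * cot (s / 2)\<bar> \<le> (2 * M * \<bar>s\<bar> powr a) * (4 / \<bar>s\<bar>)"
        unfolding abs_mult using dgM[of s] cot_half_le[of s] M_nonneg by (intro mult_mono) auto
      also have "\<dots> = 2 * M * (\<bar>s\<bar> powr a * (4 / \<bar>s\<bar>))" by simp
      also have "\<dots> = 8 * M * weight a s" unfolding powr_div_abs by simp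
      finally show "norm ((dg x - dg (x - s)) * cot (s / 2)) \<le> norm (8 * M * weight a s)" by simp
    qed
    show "(\<lambda>s. (dg x - dg (x - s)) * cot (s / 2)) \<in> borel_measurable circ"
      by (rule borel_measurable_circ) measurable
  qed
  \<comment> \<open>The coefficient is taken at the shifted point \<open>y\<close>, since it has to
    match the kernel that multiplies the increment of \<open>g\<close>.\<close>
  define D where "D s = (g y - g (y - s)) * k y s - (g x - g (x - s)) * k x s - c y * ((dg x - dg (x - s)) * cot (s / 2))" for s
  have intD: "integrable circ D"
    unfolding D_def by (intro Bochner_Integration.integrable_diff integrand_integrable integrable_mult_right intH)
  have D_eq: "(LINT s|circ. D s) = u y - u x - c y * Re (H x)"
    unfolding D_def kernel_op_def H_real
    by (subst Bochner_Integration.integral_diff Bochner_Integration.integral_mult_right_zero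
        | intro Bochner_Integration.integrable_diff integrand_integrable integrable_mult_right intH)+ simp
  have D_le: "\<bar>D s\<bar> \<le> \<phi> x s * weight a s" if "s \<in> {-pi..pi}" for s
  proof (cases "s = 0")
    case False
    have s: "0 < \<bar>s\<bar>" "\<bar>s\<bar> \<le> pi" using False that by auto
    \<comment> \<open>Discrete product rule: the increment falls on \<open>g\<close>, with the
      kernel at \<open>y\<close>, or on the kernel, with \<open>g\<close> at
      \<open>x\<close>.\<close>
    have "D s = (dg x - dg (x - s)) * (k y s - c y * cot (s / 2)) + (g x - g (x - s)) * (k y s - k x s)"
      unfolding D_def y_def dg_def by (simp add: algebra_simps)
    also have "\<bar>\<dots>\<bar> \<le> \<bar>dg x - dg (x - s)\<bar> * (A * weight a s) + \<bar>g x - g (x - s)\<bar> * (A * \<bar>\<tau>\<bar> * (weight a s / \<bar>s\<bar>))"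
      using c(2)[OF s, of y] k_diff[OF s, of x \<tau>] unfolding y_def
      by (intro order_trans[OF abs_triangle_ineq] add_mono) (auto simp only: abs_mult intro!: mult_left_mono abs_ge_zero)
    also have "\<dots> = \<phi> x s * weight a s" using \<tau> by (simp add: \<phi>_def algebra_simps)
    finally show ?thesis .
  qed (simp add: D_def \<phi>_def weight_def)
  have "\<bar>u y - u x\<bar> \<le> \<bar>LINT s|circ. D s\<bar> + \<bar>c y * Re (H x)\<bar>"
    unfolding D_eq by linarith
  also have "\<bar>c y * Re (H x)\<bar> \<le> A * cmod (H x)"
    unfolding abs_mult using c(1)[of y] A_nonneg by (intro mult_mono abs_Re_le_cmod) auto
  finally have "rest x \<le> \<bar>LINT s|circ. D s\<bar>" by (simp add: rest_def y_def)
  then have "ennreal (rest x) \<le> ennreal (norm (LINT s|circ. D s))" by (intro ennreal_leI) simp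
  also have "\<dots> \<le> (\<integral>\<^sup>+s. norm (D s) \<partial>circ)" by (rule integral_norm_bound_ennreal[OF intD])
  also have "\<dots> \<le> (\<integral>\<^sup>+s. ennreal (\<phi> x s * weight a s) \<partial>circ)"
    by (intro nn_integral_mono ennreal_leI) (use D_le in auto)
  finally show ?thesis .
qed

text \<open>The division by \<open>|s|\<close> in \<open>\<phi>\<close> is compensated by the factor
  \<open>s^2\<close> of \<open>diff_g_L2\<close>, so the bound is uniform in \<open>s\<close>. The
  two parts contribute \<open>16 pi\<close> and \<open>4 pi\<close>.\<close>

lemma phi_L2:
  assumes s: "s \<in> {-pi..pi}"
  shows "(\<integral>\<^sup>+x. ennreal ((\<phi> x s)\<^sup>2) \<partial>circ) \<le> ennreal (20 * pi * A\<^sup>2 * \<tau>\<^sup>2 * Q)"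
proof -
  define p where "p x = 2 * A\<^sup>2 * (dg x - dg (x - s))\<^sup>2 + 2 * A\<^sup>2 * \<tau>\<^sup>2 / s\<^sup>2 * (g x - g (x - s))\<^sup>2" for x
  have cont: "continuous_on UNIV (\<lambda>x. (dg x - dg (x - s))\<^sup>2)" "continuous_on UNIV (\<lambda>x. (g x - g (x - s))\<^sup>2)"
    by (intro continuous_intros dg_cont g_cont continuous_on_compose2[OF dg_cont] continuous_on_compose2[OF g_cont]; simp)+
  note int = this[THEN integrable_circ_continuous]
  have intp: "integrable circ p" unfolding p_def using int by (intro Bochner_Integration.integrable_add integrable_mult_right)
  have "(LINT x|circ. p x) = 2 * A\<^sup>2 * (LINT x|circ. (dg x - dg (x - s))\<^sup>2) + 2 * A\<^sup>2 * \<tau>\<^sup>2 / s\<^sup>2 * (LINT x|circ. (g x - g (x - s))\<^sup>2)"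
    unfolding p_def using int by simp
  also have "\<dots> \<le> 2 * A\<^sup>2 * (2 * pi * (4 * \<tau>\<^sup>2 * Q)) + 2 * A\<^sup>2 * \<tau>\<^sup>2 / s\<^sup>2 * (2 * pi * (s\<^sup>2 * Q))"
    by (intro add_mono mult_left_mono diff_dg_L2 diff_g_L2) auto
  also have "\<dots> \<le> 20 * pi * A\<^sup>2 * \<tau>\<^sup>2 * Q"
    using Q_nonneg by (cases "s = 0") (auto simp: field_simps)
  finally have le: "(LINT x|circ. p x) \<le> 20 * pi * A\<^sup>2 * \<tau>\<^sup>2 * Q" .
  have "(\<phi> x s)\<^sup>2 \<le> p x" for x
  proof -
    have sq: "(m + n)\<^sup>2 \<le> 2 * m\<^sup>2 + 2 * n\<^sup>2" for m n :: real
      using zero_le_power2[of "m - n"] by (simp add: power2_eq_square algebra_simps)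
    have "(\<phi> x s)\<^sup>2 \<le> A\<^sup>2 * (2 * \<bar>dg x - dg (x - s)\<bar>\<^sup>2 + 2 * (\<tau> * (\<bar>g x - g (x - s)\<bar> / \<bar>s\<bar>))\<^sup>2)"
      unfolding \<phi>_def power_mult_distrib[of A] by (intro mult_left_mono sq) simp
    also have "\<dots> = p x" by (simp add: p_def power_mult_distrib power_divide algebra_simps)
    finally show ?thesis .
  qed
  then have "(\<integral>\<^sup>+x. ennreal ((\<phi> x s)\<^sup>2) \<partial>circ) \<le> (\<integral>\<^sup>+x. ennreal (p x) \<partial>circ)"
    by (intro nn_integral_mono ennreal_leI)
  also have "\<dots> = ennreal (LINT x|circ. p x)"
    by (rule nn_integral_eq_integral[OF intp]) (auto simp: p_def)
  also have "\<dots> \<le> ennreal (20 * pi * A\<^sup>2 * \<tau>\<^sup>2 * Q)" using le by (rule ennreal_leI)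
  finally show ?thesis .
qed

lemma u_shift_cont: "continuous_on UNIV (\<lambda>x. u (x + \<tau>))"
  by (intro continuous_on_compose2[OF u_cont] continuous_intros) auto

lemma rest_cont: "continuous_on UNIV rest"
  unfolding rest_def[abs_def] using fourier_series_continuous[OF H_series]
  by (intro continuous_intros u_cont u_shift_cont)

lemma rest_L2: "(LINT x|circ. (rest x)\<^sup>2) \<le> (weight_mass a)\<^sup>2 * (20 * pi * A\<^sup>2 * \<tau>\<^sup>2 * Q)"
  unfolding weight_mass_def
proof (rule schur_test)
  show "(\<lambda>(x, s). \<phi> x s) \<in> borel_measurable (circ \<Otimes>\<^sub>M circ)"
    unfolding \<phi>_def by (rule borel_measurable_circ2) measurable
  show "weight a \<in> borel_measurable circ" by (rule borel_measurable_circ) measurable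
  show "integrable circ (weight a)" by (rule integrable_weight[OF a(1)])
  show "rest \<in> borel_measurable circ" by (rule continuous_borel_circ[OF rest_cont])
  show "0 \<le> \<phi> x s" for x s using A_nonneg \<tau> by (simp add: \<phi>_def)
  show "ennreal \<bar>rest x\<bar> \<le> (\<integral>\<^sup>+s. ennreal (\<phi> x s * weight a s) \<partial>circ)" for x
    using u_diff_le[of x] by (simp add: rest_def)
qed (use Q_nonneg in \<open>auto intro!: phi_L2\<close>)

text \<open>By the choice of \<open>rest\<close>, the increment is at most
  \<open>A |H| + rest\<close>, and both summands are of order \<open>\<tau>\<close> in
  \<open>L_2\<close>. This is the input of \<open>bessel_derivative\<close>.\<close>

lemma u_diff_L2:
  "(LINT x|circ. (u (x + \<tau>) - u x)\<^sup>2) \<le> 2 * pi * (A\<^sup>2 * Q * (8 * pi\<^sup>2 + 20 * (weight_mass a)\<^sup>2)) * \<tau>\<^sup>2"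
proof -
  have H: "continuous_on UNIV (\<lambda>x. (cmod (H x))\<^sup>2)"
    using fourier_series_continuous[OF H_series] by (intro continuous_intros)
  have R: "continuous_on UNIV (\<lambda>x. (rest x)\<^sup>2)" using rest_cont by (intro continuous_intros)
  note int = H[THEN integrable_circ_continuous] R[THEN integrable_circ_continuous]
  have "(LINT x|circ. (u (x + \<tau>) - u x)\<^sup>2) \<le> (LINT x|circ. 2 * A\<^sup>2 * (cmod (H x))\<^sup>2 + 2 * (rest x)\<^sup>2)"
  proof (rule integral_mono)
    show "integrable circ (\<lambda>x. (u (x + \<tau>) - u x)\<^sup>2)"
      by (intro integrable_circ_continuous continuous_intros u_shift_cont u_cont)
    show "integrable circ (\<lambda>x. 2 * A\<^sup>2 * (cmod (H x))\<^sup>2 + 2 * (rest x)\<^sup>2)" using int by simp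
    fix x
    have "\<bar>u (x + \<tau>) - u x\<bar> \<le> A * cmod (H x) + rest x" by (simp add: rest_def)
    then have "(u (x + \<tau>) - u x)\<^sup>2 \<le> (A * cmod (H x) + rest x)\<^sup>2"
      by (metis abs_ge_zero power2_abs power_mono)
    also have "\<dots> \<le> 2 * A\<^sup>2 * (cmod (H x))\<^sup>2 + 2 * (rest x)\<^sup>2"
      using zero_le_power2[of "A * cmod (H x) - rest x"] by (simp add: power2_eq_square algebra_simps)
    finally show "(u (x + \<tau>) - u x)\<^sup>2 \<le> 2 * A\<^sup>2 * (cmod (H x))\<^sup>2 + 2 * (rest x)\<^sup>2" .
  qed
  also have "\<dots> = 2 * A\<^sup>2 * (LINT x|circ. (cmod (H x))\<^sup>2) + 2 * (LINT x|circ. (rest x)\<^sup>2)"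
    using int by simp
  also have "\<dots> \<le> 2 * A\<^sup>2 * (2 * pi * ((2 * pi)\<^sup>2 * \<tau>\<^sup>2 * Q)) + 2 * ((weight_mass a)\<^sup>2 * (20 * pi * A\<^sup>2 * \<tau>\<^sup>2 * Q))"
    by (intro add_mono mult_left_mono H_L2 rest_L2) auto
  also have "\<dots> = 2 * pi * (A\<^sup>2 * Q * (8 * pi\<^sup>2 + 20 * (weight_mass a)\<^sup>2)) * \<tau>\<^sup>2"
    by (simp add: algebra_simps power2_eq_square)
  finally show ?thesis .
qed

end

text \<open>The weight \<open>1 + j^2\<close> splits: the part \<open>1\<close> is Bessel's
  inequality with the supremum bound of \<open>u\<close>, the part \<open>j^2\<close> comes from the
  difference quotients.\<close>

lemma u_fourier_sum:
  assumes F: "finite F"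
  shows "(\<Sum>j\<in>F. sobolev_term 1 u j) \<le> A\<^sup>2 * (64 * M\<^sup>2 * (weight_mass a)\<^sup>2 + Q * (8 * pi\<^sup>2 + 20 * (weight_mass a)\<^sup>2))"
proof -
  have c: "continuous_on UNIV (\<lambda>x. complex_of_real (u x))" by (intro continuous_intros u_cont)
  have "(\<Sum>j\<in>F. (real_of_int j)\<^sup>2 * (cmod (fourier (\<lambda>x. of_real (u x)) j))\<^sup>2) \<le> A\<^sup>2 * Q * (8 * pi\<^sup>2 + 20 * (weight_mass a)\<^sup>2)"
  proof (rule bessel_derivative[OF c _ _ F])
    show "complex_of_real (u (x + 2 * pi)) = of_real (u x)" for x by (simp add: u_per)
    show "(LINT x|circ. (cmod (of_real (u (x + y)) - of_real (u x)))\<^sup>2) \<le> 2 * pi * (A\<^sup>2 * Q * (8 * pi\<^sup>2 + 20 * (weight_mass a)\<^sup>2)) * y\<^sup>2"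
      if "0 < y" "y \<le> 1" for y
      using u_diff_L2[OF that] by (simp flip: of_real_diff)
  qed
  moreover have "(\<Sum>j\<in>F. (cmod (fourier (\<lambda>x. of_real (u x)) j))\<^sup>2) \<le> (8 * A * M * weight_mass a)\<^sup>2"
  proof -
    have "2 * pi * (\<Sum>j\<in>F. (cmod (fourier (\<lambda>x. of_real (u x)) j))\<^sup>2) \<le> (LINT x|circ. (cmod (of_real (u x)))\<^sup>2)"
      by (rule bessel[OF c F])
    also have "\<dots> \<le> (LINT x|circ. (8 * A * M * weight_mass a)\<^sup>2)"
    proof (rule integral_mono)
      show "integrable circ (\<lambda>x. (cmod (of_real (u x)))\<^sup>2)" by (intro integrable_circ_continuous continuous_intros u_cont)
      show "(cmod (of_real (u x)))\<^sup>2 \<le> (8 * A * M * weight_mass a)\<^sup>2" for x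
        using u_bound[of x] by (intro power_mono) auto
    qed simp
    also have "\<dots> = 2 * pi * (8 * A * M * weight_mass a)\<^sup>2" by simp
    finally show ?thesis by simp
  qed
  ultimately have "(\<Sum>j\<in>F. (cmod (fourier (\<lambda>x. of_real (u x)) j))\<^sup>2 + (real_of_int j)\<^sup>2 * (cmod (fourier (\<lambda>x. of_real (u x)) j))\<^sup>2)
     \<le> (8 * A * M * weight_mass a)\<^sup>2 + A\<^sup>2 * Q * (8 * pi\<^sup>2 + 20 * (weight_mass a)\<^sup>2)"
    by (simp add: sum.distrib)
  then show ?thesis
    by (simp add: sobolev_term_def fourier_coeff_fourier algebra_simps power_mult_distrib)
qed

lemma u_sobolev: "u \<in> sobolev 1"
  unfolding sobolev_def
proof (intro CollectI conjI allI impI)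
  show "u \<in> borel_measurable borel" by (rule borel_measurable_continuous_onI[OF u_cont])
  show "set_integrable lborel {-pi..pi} (\<lambda>x. (u x)\<^sup>2)"
    unfolding set_integrable_circ by (intro integrable_circ_continuous continuous_intros u_cont)
  show "sobolev_term 1 u summable_on UNIV"
    by (rule nonneg_bounded_partial_sums_imp_summable_on
        [where C = "A\<^sup>2 * (64 * M\<^sup>2 * (weight_mass a)\<^sup>2 + Q * (8 * pi\<^sup>2 + 20 * (weight_mass a)\<^sup>2))"])
       (auto simp: sobolev_term_nonneg intro!: eventually_finite_subsets_at_top_weakI u_fourier_sum)
qed (auto simp: u_per u_cont)

lemma u_sobolev_norm:
  "sobolev_norm 1 u \<le> A * sqrt (64 * M\<^sup>2 * (weight_mass a)\<^sup>2 + Q * (8 * pi\<^sup>2 + 20 * (weight_mass a)\<^sup>2))"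
proof -
  have "(\<Sum>\<^sub>\<infinity>j. sobolev_term 1 u j) \<le> A\<^sup>2 * (64 * M\<^sup>2 * (weight_mass a)\<^sup>2 + Q * (8 * pi\<^sup>2 + 20 * (weight_mass a)\<^sup>2))"
    using u_sobolev by (intro infsum_le_finite_sums u_fourier_sum) (auto simp: sobolev_def)
  then have "sobolev_norm 1 u \<le> sqrt (A\<^sup>2 * (64 * M\<^sup>2 * (weight_mass a)\<^sup>2 + Q * (8 * pi\<^sup>2 + 20 * (weight_mass a)\<^sup>2)))"
    unfolding sobolev_norm_def by (rule real_sqrt_le_mono)
  then show ?thesis using A_nonneg by (simp add: real_sqrt_mult)
qed

end

section \<open>Kernel estimates\<close>

text \<open>Compared with the integrand of \<open>Phi0\<close>, \<open>tanh\<close> and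
  \<open>tan\<close> are replaced by \<open>sinh\<close> and \<open>sin\<close>; the bounded kernel
  \<open>K2\<close> introduced below is the exact difference.\<close>

definition Phi_ker :: "(real \<Rightarrow> real) \<Rightarrow> real \<Rightarrow> real \<Rightarrow> real" where
  "Phi_ker f x s = cot (s / 2) / (1 + (sinh ((f x - f (x - s)) / 2) / sin (s / 2))\<^sup>2)"

text \<open>The mean value theorem is applied to \<open>E (P \<theta>) - E (R \<theta>)\<close>,
  with \<open>P\<close> running from \<open>p0\<close> to \<open>p\<close> and \<open>R\<close> from
  \<open>q0\<close> to \<open>q\<close>. Treating the two increments separately would give unrelated
  intermediate points and lose the small distance between \<open>P \<theta>\<close> and
  \<open>R \<theta>\<close>.\<close>

lemma double_difference_bound:
  fixes E :: "real \<Rightarrow> real"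
  assumes S: "convex S" and mem: "p \<in> S" "p0 \<in> S" "q \<in> S" "q0 \<in> S"
    and E: "\<And>z. z \<in> S \<Longrightarrow> (E has_real_derivative E' z) (at z)"
    and L1: "\<And>z. z \<in> S \<Longrightarrow> \<bar>E' z\<bar> \<le> L1"
    and L2: "\<And>y z. y \<in> S \<Longrightarrow> z \<in> S \<Longrightarrow> \<bar>E' y - E' z\<bar> \<le> L2 * \<bar>y - z\<bar>" "L2 \<ge> 0"
  shows "\<bar>E p - E p0 - (E q - E q0)\<bar> \<le> L1 * \<bar>(p - p0) - (q - q0)\<bar> + L2 * (\<bar>p - q\<bar> + \<bar>p0 - q0\<bar>) * \<bar>q - q0\<bar>"
proof -
  define P where "P \<theta> = p0 + \<theta> * (p - p0)" for \<theta>
  define R where "R \<theta> = q0 + \<theta> * (q - q0)" for \<theta>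
  have PS: "P \<theta> \<in> S" "R \<theta> \<in> S" if "0 \<le> \<theta>" "\<theta> \<le> 1" for \<theta>
    using convexD_alt[OF S mem(2,1) that] convexD_alt[OF S mem(4,3) that]
    by (simp_all add: P_def R_def algebra_simps)
  have "\<exists>\<theta>>0. \<theta> < 1 \<and> (E (P 1) - E (R 1)) - (E (P 0) - E (R 0)) = (1 - 0) * (E' (P \<theta>) * (p - p0) - E' (R \<theta>) * (q - q0))"
  proof (rule MVT2)
    fix \<theta> :: real assume \<theta>: "0 \<le> \<theta>" "\<theta> \<le> 1"
    have "(P has_real_derivative (p - p0)) (at \<theta>)" "(R has_real_derivative (q - q0)) (at \<theta>)"
      unfolding P_def R_def by (auto intro!: derivative_eq_intros)
    then show "((\<lambda>\<theta>. E (P \<theta>) - E (R \<theta>)) has_real_derivative E' (P \<theta>) * (p - p0) - E' (R \<theta>) * (q - q0)) (at \<theta>)"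
      by (intro DERIV_diff DERIV_chain2[where f = E] E PS \<theta>)
  qed simp
  then obtain \<theta> where \<theta>: "0 < \<theta>" "\<theta> < 1"
    and eq: "(E (P 1) - E (R 1)) - (E (P 0) - E (R 0)) = E' (P \<theta>) * (p - p0) - E' (R \<theta>) * (q - q0)"
    by auto
  have PRS: "P \<theta> \<in> S" "R \<theta> \<in> S" using PS \<theta> by auto
  have "E p - E p0 - (E q - E q0) = E' (P \<theta>) * ((p - p0) - (q - q0)) + (E' (P \<theta>) - E' (R \<theta>)) * (q - q0)"
    using eq by (simp add: P_def R_def algebra_simps)
  also have "\<bar>\<dots>\<bar> \<le> \<bar>E' (P \<theta>)\<bar> * \<bar>(p - p0) - (q - q0)\<bar> + \<bar>E' (P \<theta>) - E' (R \<theta>)\<bar> * \<bar>q - q0\<bar>"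
    unfolding abs_mult[symmetric] by (rule abs_triangle_ineq)
  also have "\<dots> \<le> L1 * \<bar>(p - p0) - (q - q0)\<bar> + (L2 * (\<bar>p - q\<bar> + \<bar>p0 - q0\<bar>)) * \<bar>q - q0\<bar>"
  proof (intro add_mono mult_right_mono L1 PRS)
    have "P \<theta> - R \<theta> = (1 - \<theta>) * (p0 - q0) + \<theta> * (p - q)"
      by (simp add: P_def R_def algebra_simps)
    also have "\<bar>\<dots>\<bar> \<le> \<bar>1 - \<theta>\<bar> * \<bar>p0 - q0\<bar> + \<bar>\<theta>\<bar> * \<bar>p - q\<bar>"
      unfolding abs_mult[symmetric] by (rule abs_triangle_ineq)
    also have "\<dots> \<le> 1 * \<bar>p0 - q0\<bar> + 1 * \<bar>p - q\<bar>"
      using \<theta> by (intro add_mono mult_right_mono) auto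
    finally have "\<bar>P \<theta> - R \<theta>\<bar> \<le> \<bar>p - q\<bar> + \<bar>p0 - q0\<bar>" by simp
    then show "\<bar>E' (P \<theta>) - E' (R \<theta>)\<bar> \<le> L2 * (\<bar>p - q\<bar> + \<bar>p0 - q0\<bar>)"
      using L2(1)[OF PRS] mult_left_mono[OF _ L2(2)] by fastforce
  qed auto
  finally show ?thesis by simp
qed

lemma lipschitz_from_deriv:
  fixes E :: "real \<Rightarrow> real"
  assumes "convex S" "p \<in> S" "q \<in> S"
    and E: "\<And>z. z \<in> S \<Longrightarrow> (E has_real_derivative E' z) (at z)"
    and L: "\<And>z. z \<in> S \<Longrightarrow> \<bar>E' z\<bar> \<le> L"
  shows "\<bar>E p - E q\<bar> \<le> L * \<bar>p - q\<bar>"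
proof -
  have "norm (E p - E q) \<le> L * norm (p - q)"
    by (rule field_differentiable_bound[OF assms(1), where f' = E'])
       (use assms(2,3) L in \<open>auto intro: has_field_derivative_at_within E\<close>)
  then show ?thesis by simp
qed

section \<open>The profile \<open>1 / (1 + p^2)\<close> and the hyperbolic functions\<close>

definition psi :: "real \<Rightarrow> real" where "psi p = 1 / (1 + p\<^sup>2)"
definition psi' :: "real \<Rightarrow> real" where "psi' p = - (2 * p) / (1 + p\<^sup>2)\<^sup>2"

lemma one_plus_square_pos: "1 + p\<^sup>2 > (0::real)"
  by (simp add: add_pos_nonneg)

lemma psi_deriv: "(psi has_real_derivative psi' p) (at p)"
proof -
  have "1 + p\<^sup>2 \<noteq> 0" using one_plus_square_pos[of p] by linarith
  then show ?thesis unfolding psi_def[abs_def] psi'_def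
    by (auto intro!: derivative_eq_intros simp: power2_eq_square)
qed

lemma psi'_le: "\<bar>psi' p\<bar> \<le> 1"
proof -
  have "2 * \<bar>p\<bar> \<le> 1 + p\<^sup>2" using zero_le_power2[of "\<bar>p\<bar> - 1"] by (simp add: power2_eq_square algebra_simps)
  also have "\<dots> \<le> (1 + p\<^sup>2)\<^sup>2" using self_le_power[of "1 + p\<^sup>2" 2] by simp
  finally show ?thesis using one_plus_square_pos[of p] by (simp add: psi'_def abs_mult)
qed

text \<open>The function given for \<open>E'\<close> is the second derivative of \<open>psi\<close>;
  its numerator is at most \<open>6 (1 + p^2)\<close> in modulus.\<close>

lemma psi'_lipschitz: "\<bar>psi' p - psi' q\<bar> \<le> 6 * \<bar>p - q\<bar>"
proof (rule lipschitz_from_deriv[where S = UNIV and E' = "\<lambda>p. (6 * p\<^sup>2 - 2) / (1 + p\<^sup>2) ^ 3"])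
  fix z :: real
  have nz: "1 + z\<^sup>2 \<noteq> 0" using one_plus_square_pos[of z] by linarith
  have "- ((2 * (1 + z\<^sup>2)\<^sup>2 - 2 * z * (2 * (1 + z\<^sup>2) * (2 * z))) / ((1 + z\<^sup>2)\<^sup>2 * (1 + z\<^sup>2)\<^sup>2)) = (6 * z\<^sup>2 - 2) / (1 + z\<^sup>2) ^ 3"
    using nz by (simp add: divide_simps) algebra
  moreover have "(psi' has_real_derivative - ((2 * (1 + z\<^sup>2)\<^sup>2 - 2 * z * (2 * (1 + z\<^sup>2) * (2 * z))) / ((1 + z\<^sup>2)\<^sup>2 * (1 + z\<^sup>2)\<^sup>2))) (at z)"
    unfolding psi'_def[abs_def] using nz by (auto intro!: derivative_eq_intros)
  ultimately show "(psi' has_real_derivative (6 * z\<^sup>2 - 2) / (1 + z\<^sup>2) ^ 3) (at z)" by simp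
  have "\<bar>6 * z\<^sup>2 - 2\<bar> \<le> 6 * (1 + z\<^sup>2)" by (simp add: abs_le_iff)
  also have "\<dots> \<le> 6 * (1 + z\<^sup>2) ^ 3"
    using self_le_power[of "1 + z\<^sup>2" 3] by simp
  finally show "\<bar>(6 * z\<^sup>2 - 2) / (1 + z\<^sup>2) ^ 3\<bar> \<le> 6"
    using one_plus_square_pos[of z] by (simp add: divide_le_eq)
qed auto

lemma psi_double_difference:
  "\<bar>psi p - psi p0 - (psi q - psi q0)\<bar> \<le> \<bar>(p - p0) - (q - q0)\<bar> + 6 * (\<bar>p - q\<bar> + \<bar>p0 - q0\<bar>) * \<bar>q - q0\<bar>"
  using double_difference_bound[of UNIV p p0 q q0 psi psi' 1 6] psi_deriv psi'_le psi'_lipschitz by simp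

lemma sinh_le_cosh_mult: "\<bar>sinh z\<bar> \<le> cosh R" if "z \<in> {-R..R}" for z R :: real
proof -
  have "\<bar>sinh z\<bar> = sinh \<bar>z\<bar>" by simp
  also have "\<dots> \<le> sinh R" using that by (subst sinh_real_le_iff) auto
  also have "\<dots> \<le> cosh R" using sinh_less_cosh_real[of R] by simp
  finally show ?thesis .
qed

lemma cosh_le_cosh: "\<bar>cosh z\<bar> \<le> cosh R" if "z \<in> {-R..R}" for z R :: real
proof -
  have "\<bar>cosh z\<bar> = cosh \<bar>z\<bar>" by simp
  also have "\<dots> \<le> cosh R" using that by (subst cosh_real_nonneg_le_iff) auto
  finally show ?thesis .
qed

lemma cosh_lipschitz: "\<bar>cosh p - cosh q\<bar> \<le> cosh R * \<bar>p - q\<bar>" if "p \<in> {-R..R}" "q \<in> {-R..R}" for p q R :: real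
  by (rule lipschitz_from_deriv[where S = "{-R..R}" and E' = sinh])
     (use that sinh_le_cosh_mult in \<open>auto intro!: derivative_eq_intros\<close>)

lemma sinh_lipschitz: "\<bar>sinh p - sinh q\<bar> \<le> cosh R * \<bar>p - q\<bar>" if "p \<in> {-R..R}" "q \<in> {-R..R}" for p q R :: real
  by (rule lipschitz_from_deriv[where S = "{-R..R}" and E' = cosh])
     (use that cosh_le_cosh in \<open>auto intro!: derivative_eq_intros\<close>)

lemma sinh_double_difference:
  fixes R :: real
  assumes "p \<in> {-R..R}" "p0 \<in> {-R..R}" "q \<in> {-R..R}" "q0 \<in> {-R..R}"
  shows "\<bar>sinh p - sinh p0 - (sinh q - sinh q0)\<bar> \<le> cosh R * \<bar>(p - p0) - (q - q0)\<bar> + cosh R * (\<bar>p - q\<bar> + \<bar>p0 - q0\<bar>) * \<bar>q - q0\<bar>"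
  by (rule double_difference_bound[where S = "{-R..R}" and E' = cosh])
     (use assms cosh_le_cosh cosh_lipschitz in \<open>auto intro!: derivative_eq_intros\<close>)

text \<open>The derivative \<open>cosh z - 1\<close> vanishes at \<open>0\<close> and is at most
  \<open>cosh R * r\<close> on \<open>[-r, r]\<close>. The small factor \<open>r\<close> supplies a
  second power of \<open>|s|\<close> later.\<close>

lemma sinh_minus_id_lipschitz:
  fixes p q r R :: real
  assumes "\<bar>p\<bar> \<le> r" "\<bar>q\<bar> \<le> r" "r \<le> R"
  shows "\<bar>(sinh p - p) - (sinh q - q)\<bar> \<le> cosh R * r * \<bar>p - q\<bar>"
proof (rule lipschitz_from_deriv[where S = "{-r..r}" and E' = "\<lambda>z. cosh z - 1"])
  fix z assume z: "z \<in> {-r..r}"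
  have "\<bar>cosh z - cosh 0\<bar> \<le> cosh R * \<bar>z - 0\<bar>"
    using z assms by (intro cosh_lipschitz) auto
  also have "\<dots> \<le> cosh R * r" using z by (intro mult_left_mono) auto
  finally show "\<bar>cosh z - 1\<bar> \<le> cosh R * r" by simp
qed (use assms in \<open>auto intro!: derivative_eq_intros\<close>)

lemma sin_minus_id: "\<bar>y - sin y\<bar> \<le> y\<^sup>2" for y :: real
proof -
  have "\<bar>(y - sin y) - (0 - sin 0)\<bar> \<le> \<bar>y\<bar> * \<bar>y - 0\<bar>"
  proof (rule lipschitz_from_deriv[where S = "{-\<bar>y\<bar>..\<bar>y\<bar>}" and E' = "\<lambda>z. 1 - cos z"])
    fix z assume z: "z \<in> {-\<bar>y\<bar>..\<bar>y\<bar>}"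
    have "\<bar>cos 0 - cos z\<bar> \<le> 1 * \<bar>0 - z\<bar>"
      by (rule lipschitz_from_deriv[where S = UNIV and E' = "\<lambda>z. - sin z"]) (auto intro!: derivative_eq_intros)
    then show "\<bar>1 - cos z\<bar> \<le> \<bar>y\<bar>" using z by auto
  qed (auto intro!: derivative_eq_intros)
  then show ?thesis by (simp add: power2_eq_square flip: abs_mult)
qed

section \<open>Calculus of functions with Hoelder continuous derivative\<close>

lemma C1_hol_deriv: "C1_hol a M f \<Longrightarrow> (f has_real_derivative deriv f x) (at x)"
  and C1_hol_bound: "C1_hol a M f \<Longrightarrow> \<bar>deriv f x\<bar> \<le> M"
  and C1_hol_hoelder: "C1_hol a M f \<Longrightarrow> \<bar>deriv f x - deriv f y\<bar> \<le> M * \<bar>x - y\<bar> powr a"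
  by (auto simp: C1_hol_def)

lemma C1_hol_nonneg: "C1_hol a M f \<Longrightarrow> M \<ge> 0"
  using C1_hol_bound[of a M f 0] by linarith

lemma C1_hol_cont: "C1_hol a M f \<Longrightarrow> continuous_on UNIV f"
  by (intro continuous_at_imp_continuous_on ballI) (metis DERIV_isCont C1_hol_deriv)

lemma C1_hol_zero: "M \<ge> 0 \<Longrightarrow> C1_hol a M (\<lambda>_. 0)"
  by (simp add: C1_hol_def)

lemma C1_hol_mono: "C1_hol a M f \<Longrightarrow> M \<le> N \<Longrightarrow> C1_hol a N f"
  unfolding C1_hol_def by (meson mult_right_mono order_trans powr_ge_zero)

lemma C1_hol_add_deriv: "C1_hol a M f \<Longrightarrow> C1_hol a N g \<Longrightarrow> deriv (\<lambda>x. f x + g x) x = deriv f x + deriv g x"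
  by (intro DERIV_imp_deriv DERIV_add C1_hol_deriv)

lemma C1_hol_diff_deriv: "C1_hol a M f \<Longrightarrow> C1_hol a N g \<Longrightarrow> deriv (\<lambda>x. f x - g x) x = deriv f x - deriv g x"
  by (intro DERIV_imp_deriv DERIV_diff C1_hol_deriv)

lemma C1_hol_cmult_deriv: "C1_hol a M f \<Longrightarrow> deriv (\<lambda>x. c * f x) x = c * deriv f x"
  by (intro DERIV_imp_deriv DERIV_cmult C1_hol_deriv)

lemma C1_hol_add:
  assumes f: "C1_hol a M f" and g: "C1_hol a N g"
  shows "C1_hol a (M + N) (\<lambda>x. f x + g x)"
  unfolding C1_hol_def C1_hol_add_deriv[OF f g]
proof (intro conjI allI)
  show "((\<lambda>x. f x + g x) has_real_derivative deriv f x + deriv g x) (at x)" for x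
    by (intro DERIV_add C1_hol_deriv[OF f] C1_hol_deriv[OF g])
  show "\<bar>deriv f x + deriv g x\<bar> \<le> M + N" for x
    using C1_hol_bound[OF f, of x] C1_hol_bound[OF g, of x] by linarith
  show "\<bar>deriv f x + deriv g x - (deriv f y + deriv g y)\<bar> \<le> (M + N) * \<bar>x - y\<bar> powr a" for x y
    using C1_hol_hoelder[OF f, of x y] C1_hol_hoelder[OF g, of x y] unfolding distrib_right by linarith
qed

lemma C1_hol_cmult:
  assumes f: "C1_hol a M f"
  shows "C1_hol a (\<bar>c\<bar> * M) (\<lambda>x. c * f x)"
  unfolding C1_hol_def C1_hol_cmult_deriv[OF f]
proof (intro conjI allI)
  show "((\<lambda>x. c * f x) has_real_derivative c * deriv f x) (at x)" for x
    by (intro DERIV_cmult C1_hol_deriv[OF f])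
  show "\<bar>c * deriv f x\<bar> \<le> \<bar>c\<bar> * M" for x
    unfolding abs_mult by (intro mult_left_mono C1_hol_bound[OF f]) simp
  show "\<bar>c * deriv f x - c * deriv f y\<bar> \<le> \<bar>c\<bar> * M * \<bar>x - y\<bar> powr a" for x y
    unfolding right_diff_distrib[symmetric] abs_mult mult.assoc by (intro mult_left_mono C1_hol_hoelder[OF f]) simp
qed

lemma C1_hol_deriv_cont:
  assumes f: "C1_hol a M f" and a: "a > 0"
  shows "continuous_on UNIV (deriv f)"
proof (intro continuous_at_imp_continuous_on ballI)
  fix x
  have "((\<lambda>y. M * \<bar>y - x\<bar> powr a) \<longlongrightarrow> M * \<bar>x - x\<bar> powr a) (at x)"
    using a by (intro tendsto_intros) (auto simp: eventually_at intro!: exI[of _ 1])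
  then have "((\<lambda>y. M * \<bar>y - x\<bar> powr a) \<longlongrightarrow> 0) (at x)" using a by simp
  then have "((\<lambda>y. deriv f y - deriv f x) \<longlongrightarrow> 0) (at x)"
    by (rule Lim_null_comparison[rotated]) (simp add: C1_hol_hoelder[OF f])
  then show "isCont (deriv f) x" by (simp add: isCont_def LIM_zero_iff)
qed

lemma C1_hol_delta_le: "C1_hol a M f \<Longrightarrow> \<bar>f x - f (x - s)\<bar> \<le> M * \<bar>s\<bar>"
  using lipschitz_from_deriv[of UNIV x "x - s" f "deriv f" M] by (simp add: C1_hol_deriv C1_hol_bound)

text \<open>The derivative in \<open>x\<close> of \<open>f x - f (x - s)\<close> is an increment of
  \<open>f'\<close>, hence of size \<open>|s|^a\<close>: a full power of \<open>|\<tau>|\<close> is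
  gained and only \<open>|s|^a\<close> remains of the factor \<open>|s|\<close>.\<close>

lemma C1_hol_delta_diff_le:
  assumes f: "C1_hol a M f"
  shows "\<bar>(f (x + \<tau>) - f (x + \<tau> - s)) - (f x - f (x - s))\<bar> \<le> M * \<bar>s\<bar> powr a * \<bar>\<tau>\<bar>"
proof -
  have "\<bar>(f (x + \<tau>) - f (x + \<tau> - s)) - (f x - f (x - s))\<bar> \<le> M * \<bar>s\<bar> powr a * \<bar>x + \<tau> - x\<bar>"
  proof (rule lipschitz_from_deriv[where S = UNIV and E' = "\<lambda>z. deriv f z - deriv f (z - s)"])
    fix z
    have "((\<lambda>z. f (z - s)) has_real_derivative deriv f (z - s) * (1 - 0)) (at z)"
      by (rule DERIV_chain2[OF C1_hol_deriv[OF f]]) (intro DERIV_diff DERIV_ident DERIV_const)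
    then show "((\<lambda>z. f z - f (z - s)) has_real_derivative deriv f z - deriv f (z - s)) (at z)"
      by (intro DERIV_diff C1_hol_deriv[OF f]) simp
    show "\<bar>deriv f z - deriv f (z - s)\<bar> \<le> M * \<bar>s\<bar> powr a"
      using C1_hol_hoelder[OF f, of z "z - s"] by simp
  qed auto
  then show ?thesis by simp
qed

lemma C1_hol_delta_taylor:
  assumes f: "C1_hol a M f" and a: "a > 0"
  shows "\<bar>(f x - f (x - s)) - s * deriv f x\<bar> \<le> M * \<bar>s\<bar> powr a * \<bar>s\<bar>"
proof -
  have "\<bar>(f x - deriv f x * x) - (f (x - s) - deriv f x * (x - s))\<bar> \<le> M * \<bar>s\<bar> powr a * \<bar>x - (x - s)\<bar>"
  proof (rule lipschitz_from_deriv[where S = "{x - \<bar>s\<bar>..x + \<bar>s\<bar>}" and E' = "\<lambda>z. deriv f z - deriv f x"])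
    fix z assume z: "z \<in> {x - \<bar>s\<bar>..x + \<bar>s\<bar>}"
    show "((\<lambda>z. f z - deriv f x * z) has_real_derivative deriv f z - deriv f x) (at z)"
      using C1_hol_deriv[OF f] by (auto intro!: derivative_eq_intros)
    have "\<bar>deriv f z - deriv f x\<bar> \<le> M * \<bar>z - x\<bar> powr a" by (rule C1_hol_hoelder[OF f])
    also have "\<dots> \<le> M * \<bar>s\<bar> powr a"
      using z a C1_hol_nonneg[OF f] by (intro mult_left_mono powr_mono2) auto
    finally show "\<bar>deriv f z - deriv f x\<bar> \<le> M * \<bar>s\<bar> powr a" .
  qed auto
  then show ?thesis by (simp add: algebra_simps)
qed

text \<open>A periodic substitute for the difference quotient: it tends to \<open>f' x\<close> as
  \<open>s\<close> tends to \<open>0\<close>, and the kernel is the cotangent times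
  \<open>psi\<close> of it.\<close>

definition slope :: "(real \<Rightarrow> real) \<Rightarrow> real \<Rightarrow> real \<Rightarrow> real" where
  "slope f x s = sinh ((f x - f (x - s)) / 2) / sin (s / 2)"

lemma Phi_ker_slope: "Phi_ker f x s = cot (s / 2) * psi (slope f x s)"
  by (simp add: Phi_ker_def psi_def slope_def)

lemma slope_zero [simp]: "slope (\<lambda>_. 0) x s = 0"
  by (simp add: slope_def)

lemma abs_half_diff_le: "\<bar>u - v\<bar> \<le> w \<Longrightarrow> \<bar>u / 2 - v / 2\<bar> \<le> w / (2::real)"
  by linarith

lemma abs_half_le: "d = u / 2 \<Longrightarrow> \<bar>u\<bar> \<le> w \<Longrightarrow> \<bar>d\<bar> \<le> w / (2::real)"
  by simp

lemma abs_le_add3: "d = u + v + w \<Longrightarrow> \<bar>u\<bar> \<le> x \<Longrightarrow> \<bar>v\<bar> \<le> y \<Longrightarrow> \<bar>w\<bar> \<le> z \<Longrightarrow> \<bar>d\<bar> \<le> x + y + (z::real)"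
  by linarith

lemma div_sin_half_le:
  assumes "0 < \<bar>s\<bar>" "\<bar>s\<bar> \<le> pi" "\<bar>n\<bar> \<le> B * \<bar>s\<bar>"
  shows "\<bar>n / sin (s / 2)\<bar> \<le> 4 * B"
proof -
  have "\<bar>n / sin (s / 2)\<bar> = \<bar>n\<bar> / \<bar>sin (s / 2)\<bar>" by simp
  also have "\<dots> \<le> (B * \<bar>s\<bar>) / (\<bar>s\<bar> / 4)"
    using sin_half_ge[OF assms(2)] assms by (intro frac_le) auto
  finally show ?thesis using assms by simp
qed

section \<open>Slopes of two functions and their increments\<close>

context
  fixes a M D :: real and f g :: "real \<Rightarrow> real"
  assumes a: "0 < a" "a \<le> 1" and f: "C1_hol a M f" and g: "C1_hol a M g" and fg: "C1_hol a D (\<lambda>x. f x - g x)"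
begin

text \<open>Half increments lie in \<open>[-2M, 2M]\<close> because \<open>|s| \<le> pi < 4\<close>,
  so \<open>K\<close> bounds \<open>sinh\<close> and \<open>cosh\<close> and their Lipschitz
  constants there.\<close>

private abbreviation "K \<equiv> cosh (2 * M)"

private lemma M0: "M \<ge> 0" and D0: "D \<ge> 0"
  using C1_hol_nonneg f fg by blast+

private lemma half_delta:
  assumes "C1_hol a M u" "\<bar>s\<bar> \<le> pi"
  shows "(u x - u (x - s)) / 2 \<in> {- (2 * M)..2 * M}"
proof -
  have "\<bar>u x - u (x - s)\<bar> \<le> M * \<bar>s\<bar>" by (rule C1_hol_delta_le[OF assms(1)])
  also have "\<dots> \<le> M * 4" using assms(2) pi_less_4 M0 by (intro mult_left_mono) auto
  finally show ?thesis by (auto simp: abs_le_iff)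
qed

lemma slope_diff:
  assumes s: "0 < \<bar>s\<bar>" "\<bar>s\<bar> \<le> pi"
  shows "\<bar>slope f x s - slope g x s\<bar> \<le> 2 * K * D"
proof -
  have "\<bar>sinh ((f x - f (x - s)) / 2) - sinh ((g x - g (x - s)) / 2)\<bar>
      \<le> K * \<bar>(f x - f (x - s)) / 2 - (g x - g (x - s)) / 2\<bar>"
    using s by (intro sinh_lipschitz half_delta f g)
  also have "(f x - f (x - s)) / 2 - (g x - g (x - s)) / 2 = ((f x - g x) - (f (x - s) - g (x - s))) / 2"
    by (simp add: field_simps)
  also have "K * \<bar>\<dots>\<bar> \<le> K * (D * \<bar>s\<bar> / 2)"
    using C1_hol_delta_le[OF fg, of x s] by (intro mult_left_mono) auto
  finally have "\<bar>sinh ((f x - f (x - s)) / 2) - sinh ((g x - g (x - s)) / 2)\<bar> \<le> K * D / 2 * \<bar>s\<bar>"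
    by simp
  from div_sin_half_le[OF s this] show ?thesis by (simp add: slope_def diff_divide_distrib mult_ac)
qed

lemma slope_shift:
  assumes s: "0 < \<bar>s\<bar>" "\<bar>s\<bar> \<le> pi"
  shows "\<bar>slope g (x + \<tau>) s - slope g x s\<bar> \<le> 2 * K * M * \<bar>\<tau>\<bar> * weight a s"
proof -
  have "\<bar>sinh ((g (x + \<tau>) - g (x + \<tau> - s)) / 2) - sinh ((g x - g (x - s)) / 2)\<bar>
      \<le> K * \<bar>(g (x + \<tau>) - g (x + \<tau> - s)) / 2 - (g x - g (x - s)) / 2\<bar>"
    using s by (intro sinh_lipschitz half_delta g)
  also have "\<dots> \<le> K * (M * \<bar>s\<bar> powr a * \<bar>\<tau>\<bar> / 2)"
    by (intro mult_left_mono abs_half_diff_le C1_hol_delta_diff_le[OF g]) simp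
  also have "\<bar>s\<bar> powr a = weight a s * \<bar>s\<bar>" using s by (simp add: weight_def powr_diff)
  finally have "\<bar>sinh ((g (x + \<tau>) - g (x + \<tau> - s)) / 2) - sinh ((g x - g (x - s)) / 2)\<bar> \<le> (K * M * weight a s * \<bar>\<tau>\<bar> / 2) * \<bar>s\<bar>"
    by (simp add: mult_ac)
  from div_sin_half_le[OF s this] show ?thesis by (simp add: slope_def diff_divide_distrib mult_ac)
qed

text \<open>Mixed second difference, in \<open>x\<close> and between \<open>f\<close> and
  \<open>g\<close>. Both terms of the bound for \<open>sinh\<close> carry
  \<open>D |\<tau>| |s|^a\<close>: the first through the shift of \<open>f - g\<close>, the second
  through \<open>|p - q|\<close>, of order \<open>D |s|\<close>, times the shift of
  \<open>g\<close>.\<close>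

lemma slope_shift_diff:
  assumes s: "0 < \<bar>s\<bar>" "\<bar>s\<bar> \<le> pi"
  shows "\<bar>slope f (x + \<tau>) s - slope f x s - (slope g (x + \<tau>) s - slope g x s)\<bar>
    \<le> 2 * K * (1 + 4 * M) * D * \<bar>\<tau>\<bar> * weight a s"
proof -
  define p p0 q q0 where "p = (f (x + \<tau>) - f (x + \<tau> - s)) / 2" and "p0 = (f x - f (x - s)) / 2"
    and "q = (g (x + \<tau>) - g (x + \<tau> - s)) / 2" and "q0 = (g x - g (x - s)) / 2"
  have "\<bar>sinh p - sinh p0 - (sinh q - sinh q0)\<bar> \<le> K * \<bar>(p - p0) - (q - q0)\<bar> + K * (\<bar>p - q\<bar> + \<bar>p0 - q0\<bar>) * \<bar>q - q0\<bar>"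
    unfolding p_def p0_def q_def q0_def using s by (intro sinh_double_difference half_delta f g)
  also have "\<dots> \<le> K * (D * \<bar>s\<bar> powr a * \<bar>\<tau>\<bar> / 2) + K * (D * \<bar>s\<bar> / 2 + D * \<bar>s\<bar> / 2) * (M * \<bar>s\<bar> powr a * \<bar>\<tau>\<bar> / 2)"
  proof (intro add_mono mult_mono mult_left_mono)
    have "(p - p0) - (q - q0) = ((f (x + \<tau>) - g (x + \<tau>) - (f (x + \<tau> - s) - g (x + \<tau> - s))) - ((f x - g x) - (f (x - s) - g (x - s)))) / 2"
      by (simp add: p_def p0_def q_def q0_def field_simps)
    then show "\<bar>(p - p0) - (q - q0)\<bar> \<le> D * \<bar>s\<bar> powr a * \<bar>\<tau>\<bar> / 2"
by (rule abs_half_le) (rule C1_hol_delta_diff_le[OF fg])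
    have "p - q = ((f (x + \<tau>) - g (x + \<tau>)) - (f (x + \<tau> - s) - g (x + \<tau> - s))) / 2"
      by (simp add: p_def q_def field_simps)
    then show "\<bar>p - q\<bar> \<le> D * \<bar>s\<bar> / 2" by (rule abs_half_le) (rule C1_hol_delta_le[OF fg])
    have "p0 - q0 = ((f x - g x) - (f (x - s) - g (x - s))) / 2"
      by (simp add: p0_def q0_def field_simps)
    then show "\<bar>p0 - q0\<bar> \<le> D * \<bar>s\<bar> / 2" by (rule abs_half_le) (rule C1_hol_delta_le[OF fg])
    show "\<bar>q - q0\<bar> \<le> M * \<bar>s\<bar> powr a * \<bar>\<tau>\<bar> / 2"
      unfolding q_def q0_def by (intro abs_half_diff_le C1_hol_delta_diff_le[OF g])
  qed (use D0 M0 in auto)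
  also have "\<dots> = K * D * (1 + M * \<bar>s\<bar>) * \<bar>\<tau>\<bar> / 2 * \<bar>s\<bar> powr a" by (simp add: field_simps)
  also have "\<dots> \<le> K * D * (1 + M * 4) * \<bar>\<tau>\<bar> / 2 * \<bar>s\<bar> powr a"
    using D0 M0 s pi_less_4 by (intro mult_right_mono mult_left_mono divide_right_mono add_left_mono) auto
  also have "\<bar>s\<bar> powr a = weight a s * \<bar>s\<bar>" using s by (simp add: weight_def powr_diff)
  finally have "\<bar>sinh p - sinh p0 - (sinh q - sinh q0)\<bar> \<le> (K * D * (1 + M * 4) * \<bar>\<tau>\<bar> / 2 * weight a s) * \<bar>s\<bar>"
    by (simp add: mult_ac)
  from div_sin_half_le[OF s this] show ?thesis
    by (simp add: slope_def diff_divide_distrib p_def p0_def q_def q0_def mult_ac)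
qed

text \<open>Three replacements lead from the slope to the derivative: \<open>sinh p\<close> by
  \<open>p\<close>, \<open>p\<close> by its Taylor polynomial, and \<open>s/2\<close> by
  \<open>sin (s/2)\<close>. Each error, taken for \<open>f\<close> minus \<open>g\<close>, is at
  most a multiple of \<open>D |s|^(1+a)\<close>; division by the sine removes one power of
  \<open>|s|\<close>.\<close>

lemma slope_limit_diff:
  assumes s: "0 < \<bar>s\<bar>" "\<bar>s\<bar> \<le> pi"
  shows "\<bar>slope f x s - deriv f x - (slope g x s - deriv g x)\<bar> \<le> 4 * (K * M + 2) * D * \<bar>s\<bar> powr a"
proof -
  define p q e where "p = (f x - f (x - s)) / 2" and "q = (g x - g (x - s)) / 2" and "e = deriv f x - deriv g x"
  \<comment> \<open>Quadratic errors are weakened to order \<open>1 + a\<close>; the factor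
    \<open>4\<close> comes from \<open>|s| < 4\<close>.\<close>
  have s2: "\<bar>s\<bar> * \<bar>s\<bar> \<le> 4 * \<bar>s\<bar> powr a * \<bar>s\<bar>"
  proof -
    have "\<bar>s\<bar> = \<bar>s\<bar> powr (1 - a) * \<bar>s\<bar> powr a" using s by (simp flip: powr_add)
    also have "\<bar>s\<bar> powr (1 - a) \<le> 4 powr (1 - a)" using s a pi_less_4 by (intro powr_mono2) auto
    also have "4 powr (1 - a) \<le> 4 powr (1::real)" using a by (intro powr_mono) auto
    finally have "\<bar>s\<bar> \<le> 4 * \<bar>s\<bar> powr a" by (simp add: mult_right_mono)
    then show ?thesis by (rule mult_right_mono) simp
  qed
  have e: "\<bar>e\<bar> \<le> D" using C1_hol_bound[OF fg, of x] by (simp add: e_def C1_hol_diff_deriv[OF f g])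
  have pq: "\<bar>p - q\<bar> \<le> D * \<bar>s\<bar> / 2"
  proof -
    have "p - q = ((f x - g x) - (f (x - s) - g (x - s))) / 2" by (simp add: p_def q_def field_simps)
    then show ?thesis by (rule abs_half_le) (rule C1_hol_delta_le[OF fg])
  qed
  have 1: "\<bar>(sinh p - p) - (sinh q - q)\<bar> \<le> K * M * D * \<bar>s\<bar> powr a * \<bar>s\<bar>"
  proof -
    have "\<bar>(sinh p - p) - (sinh q - q)\<bar> \<le> K * (M * \<bar>s\<bar> / 2) * \<bar>p - q\<bar>"
    proof (rule sinh_minus_id_lipschitz)
      show "\<bar>p\<bar> \<le> M * \<bar>s\<bar> / 2" using C1_hol_delta_le[OF f, of x s] by (simp add: p_def)
      show "\<bar>q\<bar> \<le> M * \<bar>s\<bar> / 2" using C1_hol_delta_le[OF g, of x s] by (simp add: q_def)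
      have "M * \<bar>s\<bar> \<le> M * 4" using M0 s pi_less_4 by (intro mult_left_mono) auto
      then show "M * \<bar>s\<bar> / 2 \<le> 2 * M" by simp
    qed
    also have "\<dots> \<le> K * (M * \<bar>s\<bar> / 2) * (D * \<bar>s\<bar> / 2)" using M0 by (intro mult_left_mono pq) auto
    also have "\<dots> = K * M * D / 4 * (\<bar>s\<bar> * \<bar>s\<bar>)" by simp
    also have "\<dots> \<le> K * M * D / 4 * (4 * \<bar>s\<bar> powr a * \<bar>s\<bar>)" using M0 D0 by (intro mult_left_mono s2) auto
    finally show ?thesis by simp
  qed
  have 2: "\<bar>p - q - s / 2 * e\<bar> \<le> D * \<bar>s\<bar> powr a * \<bar>s\<bar> / 2"
  proof -
    have "p - q - s / 2 * e = ((f x - g x) - (f (x - s) - g (x - s)) - s * deriv (\<lambda>x. f x - g x) x) / 2"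
      by (simp add: p_def q_def e_def C1_hol_diff_deriv[OF f g] field_simps)
    then show ?thesis by (rule abs_half_le) (rule C1_hol_delta_taylor[OF fg a(1)])
  qed
  have 3: "\<bar>(s / 2 - sin (s / 2)) * e\<bar> \<le> D * \<bar>s\<bar> powr a * \<bar>s\<bar>"
  proof -
    have "\<bar>(s / 2 - sin (s / 2)) * e\<bar> \<le> (s / 2)\<^sup>2 * D"
      unfolding abs_mult using e by (intro mult_mono sin_minus_id) auto
    also have "\<dots> = D / 4 * (\<bar>s\<bar> * \<bar>s\<bar>)" by (simp add: power2_eq_square field_simps)
    also have "\<dots> \<le> D / 4 * (4 * \<bar>s\<bar> powr a * \<bar>s\<bar>)" using D0 by (intro mult_left_mono s2) auto
    finally show ?thesis by simp
  qed
  have "sinh p - sinh q - sin (s / 2) * e = ((sinh p - p) - (sinh q - q)) + (p - q - s / 2 * e) + (s / 2 - sin (s / 2)) * e"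
    by (simp add: algebra_simps)
  then have "\<bar>sinh p - sinh q - sin (s / 2) * e\<bar> \<le> K * M * D * \<bar>s\<bar> powr a * \<bar>s\<bar> + D * \<bar>s\<bar> powr a * \<bar>s\<bar> / 2 + D * \<bar>s\<bar> powr a * \<bar>s\<bar>"
    using 1 2 3 by (rule abs_le_add3)
  also have "\<dots> \<le> ((K * M + 2) * D * \<bar>s\<bar> powr a) * \<bar>s\<bar>"
    using D0 by (simp add: algebra_simps)
  finally have "\<bar>(sinh p - sinh q - sin (s / 2) * e) / sin (s / 2)\<bar> \<le> 4 * ((K * M + 2) * D * \<bar>s\<bar> powr a)"
    by (rule div_sin_half_le[OF s])
  moreover have "(sinh p - sinh q - sin (s / 2) * e) / sin (s / 2) = slope f x s - deriv f x - (slope g x s - deriv g x)"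
    using sin_half_nonzero[of s] s by (simp add: slope_def p_def q_def e_def field_simps)
  ultimately show ?thesis by (simp only: mult.assoc)
qed

end

text \<open>The preceding estimate with the zero function in second place, so that
  \<open>D = M\<close>.\<close>

lemma slope_limit:
  assumes a: "0 < a" "a \<le> 1" and g: "C1_hol a M g" and s: "0 < \<bar>s\<bar>" "\<bar>s\<bar> \<le> pi"
  shows "\<bar>slope g x s - deriv g x\<bar> \<le> 4 * (cosh (2 * M) * M + 2) * M * \<bar>s\<bar> powr a"
  using slope_limit_diff[OF a g C1_hol_zero _ s, of M x] g C1_hol_nonneg[OF g] by simp

lemma Phi_ker_measurable:
  assumes "continuous_on UNIV f"
  shows "(\<lambda>(x, s). Phi_ker f x s) \<in> borel_measurable (borel \<Otimes>\<^sub>M borel)"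
proof -
  have [measurable]: "f \<in> borel_measurable borel" using assms by (rule borel_measurable_continuous_onI)
  have [measurable]: "(sinh :: real \<Rightarrow> real) \<in> borel_measurable borel" "(sin :: real \<Rightarrow> real) \<in> borel_measurable borel"
    by (intro borel_measurable_continuous_onI continuous_intros)+
  show ?thesis unfolding Phi_ker_def by measurable
qed

lemma Phi_ker_per:
  assumes "\<And>x. f (x + 2 * pi) = f x"
  shows "Phi_ker f (x + 2 * pi) s = Phi_ker f x s"
  using assms[of x] assms[of "x - s"] by (simp add: Phi_ker_def algebra_simps)

text \<open>The sum of the constants for the three bounds in \<open>singular_kernel\<close>:
  \<open>1\<close> for the leading coefficient, the term with \<open>16\<close> for the remainder,
  the last two for the shift in \<open>x\<close>. A factor \<open>4\<close> in the latter two bounds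
  stems from the cotangent.\<close>

definition ker_const :: "real \<Rightarrow> real" where
  "ker_const M = 1 + 16 * (cosh (2 * M) * M + 2) * (1 + 6 * (2 * cosh (2 * M) + 1) * M)
     + 8 * cosh (2 * M) * (1 + 4 * M) + 192 * (cosh (2 * M))\<^sup>2 * M"

text \<open>The leading coefficient is \<open>psi (f' x) - psi (g' x)\<close>. Remainder and shift
  are then the same mixed difference of \<open>psi\<close>, taken between slopes and their limits in
  one case, between slopes at \<open>x + \<tau>\<close> and at \<open>x\<close> in the
  other.\<close>

proposition singular_kernel_Phi_ker_diff:
  assumes a: "0 < a" "a \<le> 1" and f: "C1_hol a M f" and g: "C1_hol a M g" and fg: "C1_hol a D (\<lambda>x. f x - g x)"
    and per: "\<And>x. f (x + 2 * pi) = f x" "\<And>x. g (x + 2 * pi) = g x"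
  shows "singular_kernel a (ker_const M * D) (\<lambda>x s. Phi_ker f x s - Phi_ker g x s)"
proof -
  define K where "K = cosh (2 * M)"
  have M0: "M \<ge> 0" and D0: "D \<ge> 0" using C1_hol_nonneg f fg by blast+
  have K0: "K \<ge> 0" by (simp add: K_def)
  define C1 where "C1 = 16 * (K * M + 2) * (1 + 6 * (2 * K + 1) * M)"
  define C2 where "C2 = 8 * K * (1 + 4 * M) + 192 * K\<^sup>2 * M"
  have C: "C1 \<ge> 0" "C2 \<ge> 0" using M0 K0 by (auto simp: C1_def C2_def)
  have kc: "ker_const M * D = (1 + C1 + C2) * D" by (simp add: ker_const_def C1_def C2_def K_def)
  have le: "D \<le> ker_const M * D" "C1 * D \<le> ker_const M * D" "C2 * D \<le> ker_const M * D"
    using C D0 unfolding kc by (auto simp: distrib_right)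
  note meas = Phi_ker_measurable[OF C1_hol_cont[OF f]] Phi_ker_measurable[OF C1_hol_cont[OF g]]
  show ?thesis
    unfolding singular_kernel_def
  proof (intro conjI allI impI exI[of _ "\<lambda>x. psi (deriv f x) - psi (deriv g x)"])
    show "(\<lambda>(x, s). Phi_ker f x s - Phi_ker g x s) \<in> borel_measurable (borel \<Otimes>\<^sub>M borel)"
      using borel_measurable_diff[OF meas] by (simp add: case_prod_unfold)
    show "Phi_ker f (x + 2 * pi) s - Phi_ker g (x + 2 * pi) s = Phi_ker f x s - Phi_ker g x s" for x s
      by (simp add: Phi_ker_per per)
    have e: "\<bar>deriv f x - deriv g x\<bar> \<le> D" for x using C1_hol_bound[OF fg, of x] by (simp add: C1_hol_diff_deriv[OF f g])
    have "\<bar>psi (deriv f x) - psi (deriv g x)\<bar> \<le> 1 * \<bar>deriv f x - deriv g x\<bar>" for x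
      by (rule lipschitz_from_deriv[where S = UNIV, OF _ _ _ psi_deriv psi'_le]) auto
    then show "\<bar>psi (deriv f x) - psi (deriv g x)\<bar> \<le> ker_const M * D" for x
      using order_trans[OF e[of x] le(1)] order_trans by fastforce
    fix s :: real assume s: "0 < \<bar>s\<bar>" "\<bar>s\<bar> \<le> pi"
    show "\<bar>Phi_ker f x s - Phi_ker g x s - (psi (deriv f x) - psi (deriv g x)) * cot (s / 2)\<bar> \<le> ker_const M * D * weight a s" for x
    proof -
      have "\<bar>psi (slope f x s) - psi (deriv f x) - (psi (slope g x s) - psi (deriv g x))\<bar>
        \<le> \<bar>slope f x s - deriv f x - (slope g x s - deriv g x)\<bar>
          + 6 * (\<bar>slope f x s - slope g x s\<bar> + \<bar>deriv f x - deriv g x\<bar>) * \<bar>slope g x s - deriv g x\<bar>"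
        by (rule psi_double_difference)
      also have "\<dots> \<le> 4 * (K * M + 2) * D * \<bar>s\<bar> powr a + 6 * (2 * K * D + D) * (4 * (K * M + 2) * M * \<bar>s\<bar> powr a)"
        unfolding K_def using D0
        by (intro add_mono mult_mono mult_left_mono slope_limit_diff[OF a f g fg s] slope_diff[OF a f g fg s] slope_limit[OF a g s] e) auto
      also have "\<dots> = (4 * (K * M + 2) * (1 + 6 * (2 * K + 1) * M) * D) * \<bar>s\<bar> powr a"
        by (simp add: algebra_simps)
      finally have "\<bar>psi (slope f x s) - psi (deriv f x) - (psi (slope g x s) - psi (deriv g x))\<bar> * \<bar>cot (s / 2)\<bar>
         \<le> (4 * (K * M + 2) * (1 + 6 * (2 * K + 1) * M) * D) * \<bar>s\<bar> powr a * (4 / \<bar>s\<bar>)"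
        using M0 D0 K0 by (intro mult_mono cot_half_le s) auto
      also have "\<dots> = (4 * (K * M + 2) * (1 + 6 * (2 * K + 1) * M) * D) * (\<bar>s\<bar> powr a * (4 / \<bar>s\<bar>))" by simp
      also have "\<dots> = C1 * D * weight a s" unfolding powr_div_abs by (simp add: C1_def)
      also have "\<dots> \<le> ker_const M * D * weight a s" by (intro mult_right_mono le) simp
      finally have "\<bar>(psi (slope f x s) - psi (deriv f x) - (psi (slope g x s) - psi (deriv g x))) * cot (s / 2)\<bar> \<le> ker_const M * D * weight a s"
        unfolding abs_mult .
      moreover have "Phi_ker f x s - Phi_ker g x s - (psi (deriv f x) - psi (deriv g x)) * cot (s / 2)
          = (psi (slope f x s) - psi (deriv f x) - (psi (slope g x s) - psi (deriv g x))) * cot (s / 2)"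
        unfolding Phi_ker_slope by (simp add: algebra_simps)
      ultimately show ?thesis by (simp only:)
    qed
    show "\<bar>Phi_ker f (x + \<tau>) s - Phi_ker g (x + \<tau>) s - (Phi_ker f x s - Phi_ker g x s)\<bar> \<le> ker_const M * D * \<bar>\<tau>\<bar> * (weight a s / \<bar>s\<bar>)" for x \<tau>
    proof -
      have "\<bar>psi (slope f (x + \<tau>) s) - psi (slope f x s) - (psi (slope g (x + \<tau>) s) - psi (slope g x s))\<bar>
        \<le> \<bar>slope f (x + \<tau>) s - slope f x s - (slope g (x + \<tau>) s - slope g x s)\<bar>
          + 6 * (\<bar>slope f (x + \<tau>) s - slope g (x + \<tau>) s\<bar> + \<bar>slope f x s - slope g x s\<bar>) * \<bar>slope g (x + \<tau>) s - slope g x s\<bar>"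
        by (rule psi_double_difference)
      also have "\<dots> \<le> 2 * K * (1 + 4 * M) * D * \<bar>\<tau>\<bar> * weight a s + 6 * (2 * K * D + 2 * K * D) * (2 * K * M * \<bar>\<tau>\<bar> * weight a s)"
        unfolding K_def using D0
        by (intro add_mono mult_mono mult_left_mono slope_shift_diff[OF a f g fg s] slope_diff[OF a f g fg s] slope_shift[OF a f g fg s]) auto
      also have "\<dots> = (2 * K * (1 + 4 * M) + 48 * K\<^sup>2 * M) * D * \<bar>\<tau>\<bar> * weight a s"
        by (simp add: algebra_simps power2_eq_square)
      finally have "\<bar>psi (slope f (x + \<tau>) s) - psi (slope f x s) - (psi (slope g (x + \<tau>) s) - psi (slope g x s))\<bar> * \<bar>cot (s / 2)\<bar>
         \<le> ((2 * K * (1 + 4 * M) + 48 * K\<^sup>2 * M) * D * \<bar>\<tau>\<bar> * weight a s) * (4 / \<bar>s\<bar>)"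
        using M0 D0 K0 by (intro mult_mono cot_half_le s) auto
      also have "\<dots> = (4 * (2 * K * (1 + 4 * M) + 48 * K\<^sup>2 * M)) * D * \<bar>\<tau>\<bar> * (weight a s / \<bar>s\<bar>)" by simp
      also have "\<dots> = C2 * D * \<bar>\<tau>\<bar> * (weight a s / \<bar>s\<bar>)" by (simp only: C2_def distrib_left mult.assoc[symmetric]) simp
      also have "\<dots> \<le> ker_const M * D * \<bar>\<tau>\<bar> * (weight a s / \<bar>s\<bar>)" by (intro mult_right_mono le) auto
      finally have "\<bar>(psi (slope f (x + \<tau>) s) - psi (slope f x s) - (psi (slope g (x + \<tau>) s) - psi (slope g x s))) * cot (s / 2)\<bar>
          \<le> ker_const M * D * \<bar>\<tau>\<bar> * (weight a s / \<bar>s\<bar>)"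
        unfolding abs_mult .
      moreover have "Phi_ker f (x + \<tau>) s - Phi_ker g (x + \<tau>) s - (Phi_ker f x s - Phi_ker g x s)
          = (psi (slope f (x + \<tau>) s) - psi (slope f x s) - (psi (slope g (x + \<tau>) s) - psi (slope g x s))) * cot (s / 2)"
        unfolding Phi_ker_slope by (simp add: algebra_simps)
      ultimately show ?thesis by (simp only:)
    qed
  qed
qed

lemma singular_kernel_cot: "singular_kernel a 1 (\<lambda>x s. cot (s / 2))"
  unfolding singular_kernel_def by (auto intro!: exI[of _ "\<lambda>_. 1"])

lemma abs_diff_add_le: "\<bar>p - q\<bar> \<le> x \<Longrightarrow> \<bar>u - v\<bar> \<le> y \<Longrightarrow> \<bar>p + u - (q + v)\<bar> \<le> x + (y::real)"
  by linarith

lemma singular_kernel_add: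
  assumes "singular_kernel a A k" "singular_kernel a B l"
  shows "singular_kernel a (A + B) (\<lambda>x s. k x s + l x s)"
proof -
  note k = assms(1)[unfolded singular_kernel_def] and l = assms(2)[unfolded singular_kernel_def]
  obtain c d where c: "\<And>x. \<bar>c x\<bar> \<le> A" "\<And>x s. 0 < \<bar>s\<bar> \<Longrightarrow> \<bar>s\<bar> \<le> pi \<Longrightarrow> \<bar>k x s - c x * cot (s / 2)\<bar> \<le> A * weight a s"
    and d: "\<And>x. \<bar>d x\<bar> \<le> B" "\<And>x s. 0 < \<bar>s\<bar> \<Longrightarrow> \<bar>s\<bar> \<le> pi \<Longrightarrow> \<bar>l x s - d x * cot (s / 2)\<bar> \<le> B * weight a s"
    using k l by metis
  show ?thesis
    unfolding singular_kernel_def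
  proof (intro conjI allI impI exI[of _ "\<lambda>x. c x + d x"])
    show "(\<lambda>(x, s). k x s + l x s) \<in> borel_measurable (borel \<Otimes>\<^sub>M borel)"
      using borel_measurable_add[OF conjunct1[OF k] conjunct1[OF l]] by (simp add: case_prod_unfold)
    show "k (x + 2 * pi) s + l (x + 2 * pi) s = k x s + l x s" for x s using k l by simp
    show "\<bar>c x + d x\<bar> \<le> A + B" for x using c(1)[of x] d(1)[of x] by linarith
    fix s :: real assume s: "0 < \<bar>s\<bar>" "\<bar>s\<bar> \<le> pi"
    show "\<bar>k x s + l x s - (c x + d x) * cot (s / 2)\<bar> \<le> (A + B) * weight a s" for x
      using abs_diff_add_le[OF c(2)[OF s, of x] d(2)[OF s, of x]] by (simp only: distrib_right)
    have *: "\<bar>k (x + \<tau>) s - k x s\<bar> \<le> A * \<bar>\<tau>\<bar> * (weight a s / \<bar>s\<bar>)" "\<bar>l (x + \<tau>) s - l x s\<bar> \<le> B * \<bar>\<tau>\<bar> * (weight a s / \<bar>s\<bar>)" for x \<tau>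
      using k l s by auto
    show "\<bar>k (x + \<tau>) s + l (x + \<tau>) s - (k x s + l x s)\<bar> \<le> (A + B) * \<bar>\<tau>\<bar> * (weight a s / \<bar>s\<bar>)" for x \<tau>
      using abs_diff_add_le[OF *] by (simp only: distrib_right)
  qed
qed

text \<open>Comparison with the zero function, whose kernel is the cotangent, of constant
  \<open>1\<close>; here \<open>D = M\<close>.\<close>

lemma singular_kernel_Phi_ker:
  assumes a: "0 < a" "a \<le> 1" and f: "C1_hol a M f" and per: "\<And>x. f (x + 2 * pi) = f x"
  shows "singular_kernel a (ker_const M * M + 1) (Phi_ker f)"
proof -
  have "singular_kernel a (ker_const M * M) (\<lambda>x s. Phi_ker f x s - Phi_ker (\<lambda>_. 0) x s)"
    using singular_kernel_Phi_ker_diff[OF a f C1_hol_zero _ per, of M] f C1_hol_nonneg[OF f] by simp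
  note singular_kernel_add[OF this singular_kernel_cot]
  moreover have "(\<lambda>x s. Phi_ker f x s - Phi_ker (\<lambda>_. 0) x s + cot (s / 2)) = Phi_ker f"
    by (simp add: fun_eq_iff Phi_ker_def[of "\<lambda>_. 0"])
  ultimately show ?thesis by simp
qed

section \<open>Principal values\<close>

lemma PV_eq:
  assumes "has_PV G I"
  shows "PV G = I"
  unfolding PV_def
proof (rule the_equality[where P = "has_PV G", OF assms])
  fix J assume "has_PV G J"
  with assms show "J = I"
    unfolding has_PV_def using tendsto_unique[OF trivial_limit_at_right_real] by blast
qed

abbreviation annulus :: "real \<Rightarrow> real set" where
  "annulus e \<equiv> {s. e < \<bar>s\<bar> \<and> \<bar>s\<bar> < pi}"

text \<open>Only the annuli enter, so values at \<open>0\<close>, \<open>pi\<close> and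
  \<open>- pi\<close> do not matter.\<close>

lemma has_PV_cong:
  assumes "\<And>s. 0 < \<bar>s\<bar> \<Longrightarrow> \<bar>s\<bar> < pi \<Longrightarrow> G s = H s"
  shows "has_PV G I \<longleftrightarrow> has_PV H I"
proof -
  have int: "set_integrable lborel (annulus e) G \<longleftrightarrow> set_integrable lborel (annulus e) H"
    if "0 < e" for e
    by (rule set_integrable_cong[OF refl refl]) (use that assms in auto)
  have eq: "(LINT s:annulus e|lborel. G s) = (LINT s:annulus e|lborel. H s)"
    if "0 < e" for e
    by (rule set_lebesgue_integral_cong) (use that assms in auto)
  have "\<forall>\<^sub>F e in at_right 0. (LINT s:annulus e|lborel. G s) = (LINT s:annulus e|lborel. H s)"
    using eventually_at_right_less[of 0] by eventually_elim (rule eq)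
  from filterlim_cong[OF refl refl this] show ?thesis
    unfolding has_PV_def using int by auto
qed

lemma has_PV_add:
  assumes "has_PV G I" "has_PV H J"
  shows "has_PV (\<lambda>s. G s + H s) (I + J)"
  unfolding has_PV_def
proof (intro conjI ballI)
  fix e assume e: "e \<in> {0<..<pi}"
  show "set_integrable lborel (annulus e) (\<lambda>s. G s + H s)"
    using assms e unfolding has_PV_def by (intro set_integral_add) auto
next
  have "((\<lambda>e. (LINT s:annulus e|lborel. G s) + (LINT s:annulus e|lborel. H s)) \<longlongrightarrow> I + J) (at_right 0)"
    using assms unfolding has_PV_def by (intro tendsto_add) auto
  moreover have "\<forall>\<^sub>F e in at_right 0. (LINT s:annulus e|lborel. G s) + (LINT s:annulus e|lborel. H s)
      = (LINT s:annulus e|lborel. G s + H s)"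
  proof -
    have "\<forall>\<^sub>F e in at_right 0. e \<in> {0<..<pi}" by (rule eventually_at_right_real) simp
    then show ?thesis
      by eventually_elim (use assms in \<open>auto simp: has_PV_def set_integral_add\<close>)
  qed
  ultimately show "((\<lambda>e. LINT s:annulus e|lborel. G s + H s) \<longlongrightarrow> I + J) (at_right 0)"
    by (rule Lim_transform_eventually)
qed

text \<open>Dominated convergence along decreasing radii: the annuli exhaust the circle up to three
  points.\<close>

lemma has_PV_integrable:
  assumes G: "integrable circ G"
  shows "has_PV G (LINT s|circ. G s)"
  unfolding has_PV_def
proof (intro conjI ballI)
  have G': "set_integrable lborel {-pi..pi} G" using G by (simp add: set_integrable_circ)
  have sets: "annulus e \<in> sets lborel" for e :: real by measurable
  show int: "set_integrable lborel (annulus e) G" for e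
    by (rule set_integrable_subset[OF G' sets]) auto
  have AE: "AE s in lborel. s \<noteq> 0 \<and> s \<noteq> pi \<and> s \<noteq> (- pi :: real)"
    by (intro AE_conjI AE_lborel_singleton)
  show "((\<lambda>e. LINT s:annulus e|lborel. G s) \<longlongrightarrow> (LINT s|circ. G s)) (at_right 0)"
  proof (rule tendsto_at_right_sequentially[where b = pi])
    fix X :: "nat \<Rightarrow> real"
    assume X: "\<And>n. 0 < X n" "\<And>n. X n < pi" "decseq X" "X \<longlonglongrightarrow> 0"
    show "(\<lambda>n. LINT s:(annulus (X n))|lborel. G s) \<longlonglongrightarrow> (LINT s|circ. G s)"
      unfolding set_integral_circ[symmetric] set_lebesgue_integral_def
    proof (rule integral_dominated_convergence)
      show "integrable lborel (\<lambda>s. norm (indicator {-pi..pi} s *\<^sub>R G s))"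
        using G' unfolding set_integrable_def by (rule integrable_norm)
      show "(\<lambda>s. indicator {-pi..pi} s *\<^sub>R G s) \<in> borel_measurable lborel"
        using G' unfolding set_integrable_def by (rule borel_measurable_integrable)
      show "(\<lambda>s. indicator (annulus (X n)) s *\<^sub>R G s) \<in> borel_measurable lborel" for n
        using int unfolding set_integrable_def by (rule borel_measurable_integrable)
      show "AE s in lborel. norm (indicator (annulus (X n)) s *\<^sub>R G s) \<le> norm (indicator {-pi..pi} s *\<^sub>R G s)" for n
        by (intro AE_I2) (auto simp: indicator_def)
      show "AE s in lborel. (\<lambda>n. indicator (annulus (X n)) s *\<^sub>R G s) \<longlonglongrightarrow> indicator {-pi..pi} s *\<^sub>R G s"
        using AE
      proof eventually_elim
        case (elim s)
        then have "\<forall>\<^sub>F n in sequentially. X n < \<bar>s\<bar>" using X(4) by (intro order_tendstoD(2)) auto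
        then have "\<forall>\<^sub>F n in sequentially. indicator (annulus (X n)) s *\<^sub>R G s = indicator {-pi..pi} s *\<^sub>R G s"
          by eventually_elim (use elim in \<open>auto simp: indicator_def\<close>)
        then show ?case by (rule tendsto_eventually)
      qed
    qed
  qed simp
qed

lemma set_integral_Ioo_Icc:
  fixes f :: "real \<Rightarrow> real"
  shows "set_integrable lborel {a<..<b} f \<longleftrightarrow> set_integrable lborel {a..b} f"
    and "(LINT s:{a<..<b}|lborel. f s) = (LINT s:{a..b}|lborel. f s)"
proof -
  have "{a<..<b} - {a..b} \<union> ({a..b} - {a<..<b}) \<subseteq> {a, b}" by auto
  then show "set_integrable lborel {a<..<b} f \<longleftrightarrow> set_integrable lborel {a..b} f"
    and "(LINT s:{a<..<b}|lborel. f s) = (LINT s:{a..b}|lborel. f s)"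
    by (intro set_integrable_discrete_difference[where X = "{a, b}"] set_integral_discrete_difference[where X = "{a, b}"]; auto)+
qed

text \<open>The logarithmic derivative that carries the singularity of \<open>G1\<close>; its principal value vanishes
  because \<open>Lam\<close> is \<open>2\<pi>\<close>-periodic and \<open>Lam \<sigma> / \<sigma>\<^sup>2\<close> has a two-sided limit at \<open>0\<close>.\<close>

definition Lam :: "(real \<Rightarrow> real) \<Rightarrow> real \<Rightarrow> real \<Rightarrow> real" where
  "Lam f x s = (sin (s / 2))\<^sup>2 + (sinh ((f x - f (x - s)) / 2))\<^sup>2"

definition LamD :: "(real \<Rightarrow> real) \<Rightarrow> real \<Rightarrow> real \<Rightarrow> real" where
  "LamD f x s = sin (s / 2) * cos (s / 2) + sinh ((f x - f (x - s)) / 2) * cosh ((f x - f (x - s)) / 2) * deriv f (x - s)"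

section \<open>Singular and regular part of the integrand of \<open>Phi1\<close>\<close>

context
  fixes a M :: real and f :: "real \<Rightarrow> real"
  assumes a: "0 < a" "a \<le> 1" and f: "C1_hol a M f" and per: "\<And>x. f (x + 2 * pi) = f x"
begin

lemma f_cont: "continuous_on A f" and f'_cont: "continuous_on A (deriv f)"
  using C1_hol_cont[OF f] C1_hol_deriv_cont[OF f a(1)] continuous_on_subset by blast+

lemma f_measurable [measurable]: "f \<in> borel_measurable borel"
  and f'_measurable [measurable]: "deriv f \<in> borel_measurable borel"
  using f_cont f'_cont by (auto intro: borel_measurable_continuous_onI)

lemma Lam_pos: "0 < \<bar>s\<bar> \<Longrightarrow> \<bar>s\<bar> \<le> pi \<Longrightarrow> Lam f x s > 0"
  unfolding Lam_def using sin_half_nonzero[of s] by (intro add_pos_nonneg) auto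

lemma Lam_deriv: "(Lam f x has_real_derivative LamD f x s) (at s)"
proof -
  have "((\<lambda>s. f (x - s)) has_real_derivative deriv f (x - s) * (0 - 1)) (at s)"
    by (rule DERIV_chain2[OF C1_hol_deriv[OF f]]) (intro DERIV_diff DERIV_ident DERIV_const)
  then show ?thesis unfolding Lam_def[abs_def] LamD_def
    by (auto intro!: derivative_eq_intros simp: power2_eq_square)
qed

lemma LamD_cont: "continuous_on A (LamD f x)"
  unfolding LamD_def[abs_def]
  by (intro continuous_intros continuous_on_compose2[OF f_cont[of UNIV]] continuous_on_compose2[OF f'_cont[of UNIV]]) auto

lemma Lam_cont: "continuous_on A (Lam f x)"
  by (intro continuous_at_imp_continuous_on ballI) (metis DERIV_isCont Lam_deriv)

lemma log_deriv_integral: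
  assumes "p \<le> q" "\<And>s. s \<in> {p..q} \<Longrightarrow> 0 < \<bar>s\<bar> \<and> \<bar>s\<bar> \<le> pi"
  shows "set_integrable lborel {p..q} (\<lambda>s. LamD f x s / Lam f x s)"
    and "(LINT s:{p..q}|lborel. LamD f x s / Lam f x s) = ln (Lam f x q) - ln (Lam f x p)"
proof -
  have pos: "Lam f x s > 0" if "s \<in> {p..q}" for s using assms(2)[OF that] by (intro Lam_pos) auto
  have c: "continuous_on {p..q} (\<lambda>s. LamD f x s / Lam f x s)"
    using pos by (intro continuous_intros LamD_cont Lam_cont) fastforce
  show "set_integrable lborel {p..q} (\<lambda>s. LamD f x s / Lam f x s)"
    by (rule borel_integrable_atLeastAtMost'[OF c])
  show "(LINT s:{p..q}|lborel. LamD f x s / Lam f x s) = ln (Lam f x q) - ln (Lam f x p)"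
    unfolding set_lebesgue_integral_def
  proof (rule integral_FTC_Icc[OF assms(1) _ c])
    fix s assume "p \<le> s" "s \<le> q"
    then have "Lam f x s > 0" by (intro pos) simp
    then have "((\<lambda>s. ln (Lam f x s)) has_real_derivative LamD f x s / Lam f x s) (at s)"
      by (auto intro!: derivative_eq_intros Lam_deriv)
    then show "((\<lambda>s. ln (Lam f x s)) has_vector_derivative LamD f x s / Lam f x s) (at s within {p..q})"
      using has_field_derivative_at_within has_real_derivative_iff_has_vector_derivative by blast
  qed
qed

lemma Lam_pi: "Lam f x pi = Lam f x (- pi)"
  using per[of "x - pi"] by (simp add: Lam_def algebra_simps)

lemma Lam_limit: "((\<lambda>s. Lam f x s / s\<^sup>2) \<longlongrightarrow> (1 + (deriv f x)\<^sup>2) / 4) (at 0)"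
proof -
  have "((\<lambda>s::real. sin (s / 2)) has_real_derivative 1 / 2) (at 0)"
    by (auto intro!: derivative_eq_intros)
  then have 1: "((\<lambda>s::real. sin (s / 2) / s) \<longlongrightarrow> 1 / 2) (at 0)" by (simp add: DERIV_def)
  have "((\<lambda>s. f (x - s)) has_real_derivative deriv f x * (0 - 1)) (at 0)"
    by (rule DERIV_chain2[where f = f]) (auto intro!: derivative_eq_intros C1_hol_deriv[OF f])
  then have "((\<lambda>s. sinh ((f x - f (x - s)) / 2)) has_real_derivative deriv f x / 2) (at 0)"
    by (auto intro!: derivative_eq_intros)
  then have 2: "((\<lambda>s. sinh ((f x - f (x - s)) / 2) / s) \<longlongrightarrow> deriv f x / 2) (at 0)" by (simp add: DERIV_def)
  have "((\<lambda>s. (sin (s / 2) / s)\<^sup>2 + (sinh ((f x - f (x - s)) / 2) / s)\<^sup>2) \<longlongrightarrow> (1 / 2)\<^sup>2 + (deriv f x / 2)\<^sup>2) (at 0)"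
    by (rule tendsto_add[OF tendsto_power[OF 1] tendsto_power[OF 2]])
  then show ?thesis by (simp add: Lam_def power_divide add_divide_distrib)
qed

text \<open>On an annulus only boundary terms remain. Those at \<open>pi\<close> and
  \<open>- pi\<close> cancel; dividing \<open>Lam\<close> by \<open>e^2\<close> at both
  \<open>e\<close> and \<open>- e\<close> leaves the difference of logarithms unchanged and gives
  the two terms the same limit.\<close>

lemma has_PV_log_deriv: "has_PV (\<lambda>s. LamD f x s / Lam f x s) 0"
proof -
  define L where "L s = LamD f x s / Lam f x s" for s
  have ann: "annulus e = {-pi<..<-e} \<union> {e<..<pi}" if "0 < e" for e
    using that by auto
  have val: "set_integrable lborel (annulus e) L \<and>
      (LINT s:annulus e|lborel. L s) = ln (Lam f x (- e) / (- e)\<^sup>2) - ln (Lam f x e / e\<^sup>2)"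
    if e: "e \<in> {0<..<pi}" for e
  proof -
    have i: "set_integrable lborel {-pi<..<-e} L" "set_integrable lborel {e<..<pi} L"
      unfolding L_def set_integral_Ioo_Icc using e by (intro log_deriv_integral; auto)+
    have "(LINT s:annulus e|lborel. L s) = (LINT s:{-pi<..<-e}|lborel. L s) + (LINT s:{e<..<pi}|lborel. L s)"
      using e i by (subst ann) (auto intro!: set_integral_Un)
    also have "\<dots> = (ln (Lam f x (- e)) - ln (Lam f x (- pi))) + (ln (Lam f x pi) - ln (Lam f x e))"
      unfolding L_def set_integral_Ioo_Icc using e by (intro arg_cong2[where f = "(+)"] log_deriv_integral) auto
    also have "\<dots> = ln (Lam f x (- e) / (- e)\<^sup>2) - ln (Lam f x e / e\<^sup>2)"
      using e Lam_pos[of e x] Lam_pos[of "- e" x] by (simp add: Lam_pi ln_div)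
    finally show ?thesis using e i by (auto simp: ann intro!: set_integrable_Un)
  qed
  have l: "(1 + (deriv f x)\<^sup>2) / 4 \<noteq> 0" using one_plus_square_pos[of "deriv f x"] by simp
  have "((\<lambda>e. ln (Lam f x e / e\<^sup>2)) \<longlongrightarrow> ln ((1 + (deriv f x)\<^sup>2) / 4)) (at 0)"
    using l by (intro tendsto_ln Lam_limit) 
  then have lim: "((\<lambda>e. ln (Lam f x e / e\<^sup>2)) \<longlongrightarrow> ln ((1 + (deriv f x)\<^sup>2) / 4)) (at 0)" .
  have r: "filterlim (\<lambda>e. e) (at 0) (at_right (0::real))"
    by (simp add: filterlim_def at_le)
  have m: "filterlim (\<lambda>e. - e) (at 0) (at_right (0::real))"
    by (auto simp: filterlim_at eventually_at_filter intro!: tendsto_eq_intros)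
  have "((\<lambda>e. ln (Lam f x (- e) / (- e)\<^sup>2) - ln (Lam f x e / e\<^sup>2)) \<longlongrightarrow> 0) (at_right 0)"
    using tendsto_diff[OF filterlim_compose[OF lim m] filterlim_compose[OF lim r]] by simp
  moreover have "\<forall>\<^sub>F e in at_right 0. ln (Lam f x (- e) / (- e)\<^sup>2) - ln (Lam f x e / e\<^sup>2)
      = (LINT s:annulus e|lborel. L s)"
  proof -
    have "\<forall>\<^sub>F e in at_right 0. e \<in> {0<..<pi}" by (rule eventually_at_right_real) simp
    then show ?thesis by eventually_elim (use val in auto)
  qed
  ultimately have "((\<lambda>e. LINT s:annulus e|lborel. L s) \<longlongrightarrow> 0) (at_right 0)"
    by (rule Lim_transform_eventually)
  then show ?thesis using val unfolding has_PV_def L_def[abs_def] by blast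
qed

text \<open>The factor of \<open>h' (x - s)\<close> in \<open>G2b\<close>. It occurs in the regular
  part of \<open>G1\<close> as well, so that the two contributions can be merged.\<close>

definition "K2 x s = (T f x s / t s) * T f x s / (1 + (T f x s / t s)\<^sup>2)"

lemma T_measurable: "T f x \<in> borel_measurable borel" and t_measurable: "t \<in> borel_measurable borel"
proof -
  have [measurable]: "(tanh :: real \<Rightarrow> real) \<in> borel_measurable borel"
    by (intro borel_measurable_continuous_onI continuous_intros) auto
  have [measurable]: "(sin :: real \<Rightarrow> real) \<in> borel_measurable borel" "(cos :: real \<Rightarrow> real) \<in> borel_measurable borel"
    by (intro borel_measurable_continuous_onI continuous_intros)+
  show "T f x \<in> borel_measurable borel" unfolding T_def[abs_def] delta_def[abs_def] by measurable
  show "t \<in> borel_measurable borel" unfolding t_def[abs_def] tan_def by measurable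
qed

lemmas [measurable] = T_measurable t_measurable

lemma abs_T_le: "\<bar>T f x s\<bar> \<le> 1"
  unfolding T_def using tanh_real_bounds[of "delta f x s / 2"] by auto

lemma K2_bound: "\<bar>K2 x s\<bar> \<le> 1"
proof -
  define z where "z = T f x s / t s"
  have "\<bar>z * T f x s\<bar> \<le> \<bar>z\<bar> * 1" unfolding abs_mult by (intro mult_left_mono abs_T_le) simp
  also have "\<dots> \<le> 1 + z\<^sup>2" using zero_le_power2[of "\<bar>z\<bar> - 1 / 2"] by (simp add: power2_eq_square algebra_simps)
  finally show ?thesis unfolding K2_def z_def[symmetric] using one_plus_square_pos[of z] by (simp add: divide_le_eq)
qed

lemma frac_bound: "\<bar>1 / (1 + (T f x s / t s)\<^sup>2)\<bar> \<le> 1"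
  using one_plus_square_pos[of "T f x s / t s"] by (simp add: divide_le_eq)

lemma K2_measurable [measurable]: "K2 x \<in> borel_measurable borel"
  unfolding K2_def[abs_def] by measurable

lemma K2_integrable: "integrable circ (K2 x)"
proof (rule Bochner_Integration.integrable_bound[where f = "\<lambda>_. 1 :: real"])
  show "K2 x \<in> borel_measurable circ" by (rule borel_measurable_circ) measurable
qed (use K2_bound in auto)

lemma G2a_integrable: "integrable circ (G2a f x)"
proof (rule Bochner_Integration.integrable_bound[where f = "\<lambda>_. M"])
  show "G2a f x \<in> borel_measurable circ"
    unfolding G2a_def[abs_def] by (rule borel_measurable_circ) measurable
  show "AE s in circ. norm (G2a f x s) \<le> norm M"
  proof (rule AE_I2)
    fix s
    have "\<bar>G2a f x s\<bar> = \<bar>deriv f (x - s)\<bar> * (\<bar>T f x s\<bar> * \<bar>1 / (1 + (T f x s / t s)\<^sup>2)\<bar>)"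
      unfolding G2a_def by (simp add: abs_mult)
    also have "\<dots> \<le> M * (1 * 1)"
      using C1_hol_nonneg[OF f] by (intro mult_mono C1_hol_bound[OF f] abs_T_le frac_bound) auto
    finally show "norm (G2a f x s) \<le> norm M" by simp
  qed
qed simp

text \<open>In the sine, cosine, \<open>sinh\<close> and \<open>cosh\<close> of the half arguments
  every term is a polynomial over \<open>L = n^2 + S^2\<close>, because
  \<open>n^2 C^2 + S^2 c^2 = L\<close>. The first claim then follows from
  \<open>C^2 = 1 + S^2\<close> and \<open>c^2 = 1 - n^2\<close>, the second from
  \<open>C^2 - S^2 = 1\<close>.\<close>

lemma G1_decomp:
  assumes s: "0 < \<bar>s\<bar>" "\<bar>s\<bar> < pi"
  shows "G1 f x s = LamD f x s / Lam f x s + (K2 x s - G2a f x s)"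
    and "1 / t s * (1 / (1 + (T f x s / t s)\<^sup>2)) - K2 x s = Phi_ker f x s"
proof -
  define n c S C d L where "n = sin (s / 2)" and "c = cos (s / 2)" and "S = sinh (delta f x s / 2)"
    and "C = cosh (delta f x s / 2)" and "d = deriv f (x - s)" and "L = n\<^sup>2 + S\<^sup>2"
  have n: "n \<noteq> 0" unfolding n_def using s by (intro sin_half_nonzero) auto
  have c: "c \<noteq> 0" unfolding c_def using s cos_gt_zero_pi[of "s / 2"] by (auto simp: abs_less_iff)
  have C: "C \<noteq> 0" unfolding C_def using cosh_real_pos[of "delta f x s / 2"] by linarith
  have nc: "c\<^sup>2 = 1 - n\<^sup>2" by (simp add: n_def c_def cos_squared_eq)
  have CS: "C\<^sup>2 = 1 + S\<^sup>2" by (simp add: C_def S_def cosh_square_eq)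
  have L: "L > 0" unfolding L_def using n by (intro add_pos_nonneg) auto
  have T: "T f x s = S / C" by (simp add: T_def S_def C_def tanh_def)
  have t: "t s = n / c" by (simp add: t_def n_def c_def tan_def)
  have LL: "L = n\<^sup>2 * C\<^sup>2 + S\<^sup>2 * c\<^sup>2" unfolding L_def nc CS by algebra
  have r: "1 / (1 + (T f x s / t s)\<^sup>2) = n\<^sup>2 * C\<^sup>2 / L"
  proof -
    have "1 + (T f x s / t s)\<^sup>2 = (n\<^sup>2 * C\<^sup>2 + S\<^sup>2 * c\<^sup>2) / (n\<^sup>2 * C\<^sup>2)"
      unfolding T t using n c C by (simp add: add_divide_distrib power_divide power_mult_distrib)
    then show ?thesis by (simp add: LL)
  qed
  have Lnz: "L \<noteq> 0" using L by simp
  have Lam: "Lam f x s = L" by (simp add: Lam_def L_def n_def S_def delta_def)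
  have LamD: "LamD f x s = n * c + S * C * d" by (simp add: LamD_def n_def c_def S_def C_def d_def delta_def)
  have K2: "K2 x s = S\<^sup>2 * n * c / L"
  proof -
    have "K2 x s = (T f x s / t s) * T f x s * (1 / (1 + (T f x s / t s)\<^sup>2))" by (simp add: K2_def)
    also have "\<dots> = (T f x s / t s) * T f x s * (n\<^sup>2 * C\<^sup>2 / L)" by (simp only: r)
    finally show ?thesis unfolding T t using n c C Lnz by (simp add: field_simps power2_eq_square)
  qed
  have G2a: "G2a f x s = d * S * C * n\<^sup>2 / L"
  proof -
    have "G2a f x s = d * T f x s * (1 / (1 + (T f x s / t s)\<^sup>2))" by (simp add: G2a_def d_def)
    also have "\<dots> = d * T f x s * (n\<^sup>2 * C\<^sup>2 / L)" by (simp only: r)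
    finally show ?thesis unfolding T t using n c C Lnz by (simp add: field_simps power2_eq_square)
  qed
  have "G1 f x s = (d / t s * (T f x s / t s) + 1 / t s) * (n\<^sup>2 * C\<^sup>2 / L)"
    unfolding G1_def r d_def ..
  also have "\<dots> = (d * S * C * c\<^sup>2 + n * c * C\<^sup>2) / L"
    unfolding T t using n c C Lnz by (simp add: field_simps power2_eq_square)
  also have "d * S * C * c\<^sup>2 + n * c * C\<^sup>2 = (n * c + S * C * d) + (S\<^sup>2 * n * c - d * S * C * n\<^sup>2)"
    unfolding nc CS by algebra
  finally show "G1 f x s = LamD f x s / Lam f x s + (K2 x s - G2a f x s)"
    unfolding Lam LamD K2 G2a by (simp add: add_divide_distrib diff_divide_distrib)
  have "1 / t s * (1 / (1 + (T f x s / t s)\<^sup>2)) = n * c * C\<^sup>2 / L"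
    unfolding r unfolding t using n c Lnz by (simp add: field_simps power2_eq_square)
  moreover have "Phi_ker f x s = n * c / L"
  proof -
    have "Phi_ker f x s = (c / n) / (1 + (S / n)\<^sup>2)"
      by (simp add: Phi_ker_def cot_def n_def c_def S_def delta_def)
    also have "1 + (S / n)\<^sup>2 = L / n\<^sup>2" unfolding L_def using n by (simp add: field_simps)
    finally show ?thesis using n by (simp add: power2_eq_square)
  qed
  ultimately show "1 / t s * (1 / (1 + (T f x s / t s)\<^sup>2)) - K2 x s = Phi_ker f x s"
    unfolding K2 CS by (simp add: diff_divide_distrib[symmetric] algebra_simps)
qed

lemma has_PV_G1: "has_PV (G1 f x) ((LINT s|circ. K2 x s) - (LINT s|circ. G2a f x s))"
proof -
  have "has_PV (\<lambda>s. K2 x s - G2a f x s) (LINT s|circ. K2 x s - G2a f x s)"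
    by (rule has_PV_integrable) (intro Bochner_Integration.integrable_diff K2_integrable G2a_integrable)
  from has_PV_add[OF has_PV_log_deriv this]
  have "has_PV (\<lambda>s. LamD f x s / Lam f x s + (K2 x s - G2a f x s)) ((LINT s|circ. K2 x s) - (LINT s|circ. G2a f x s))"
    using K2_integrable G2a_integrable by simp
  then show ?thesis by (subst has_PV_cong[OF G1_decomp(1)])
qed

section \<open>Representation of \<open>Phi\<close> by a single kernel\<close>

context
  fixes N :: real and h :: "real \<Rightarrow> real"
  assumes h: "C1_hol a N h"
begin

lemma h'_measurable [measurable]: "deriv h \<in> borel_measurable borel"
  by (rule borel_measurable_continuous_onI[OF C1_hol_deriv_cont[OF h a(1)]])

lemma G2b_eq: "G2b f h x = (\<lambda>s. deriv h (x - s) * K2 x s)"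
  by (simp add: G2b_def[abs_def] K2_def)

lemma G2b_integrable: "integrable circ (G2b f h x)"
  unfolding G2b_eq
proof (rule Bochner_Integration.integrable_bound[where f = "\<lambda>_. N"])
  show "(\<lambda>s. deriv h (x - s) * K2 x s) \<in> borel_measurable circ"
    by (rule borel_measurable_circ) measurable
  show "AE s in circ. norm (deriv h (x - s) * K2 x s) \<le> norm N"
  proof (rule AE_I2)
    fix s
    have "\<bar>deriv h (x - s) * K2 x s\<bar> \<le> N * 1"
      unfolding abs_mult using C1_hol_nonneg[OF h] by (intro mult_mono C1_hol_bound[OF h] K2_bound) auto
    then show "norm (deriv h (x - s) * K2 x s) \<le> norm N" by simp
  qed
qed simp

lemma G0_integrable: "integrable circ (G0 f h x)"
proof (rule Bochner_Integration.integrable_bound)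
  show "integrable circ (\<lambda>s. 4 * N * weight a s)" using integrable_weight[OF a(1)] by simp
  show "G0 f h x \<in> borel_measurable circ"
    unfolding G0_def[abs_def] delta_def[abs_def] by (rule borel_measurable_circ) measurable
  show "AE s in circ. norm (G0 f h x s) \<le> norm (4 * N * weight a s)"
  proof (rule AE_I2)
    fix s assume s: "s \<in> space circ"
    have "\<bar>G0 f h x s\<bar> = \<bar>deriv h x - deriv h (x - s)\<bar> * (\<bar>cot (s / 2)\<bar> * \<bar>1 / (1 + (T f x s / t s)\<^sup>2)\<bar>)"
      unfolding G0_def delta_def t_def by (simp add: abs_mult cot_def tan_def)
    also have "\<dots> \<le> (N * \<bar>s\<bar> powr a) * ((4 / \<bar>s\<bar>) * 1)"
      using s C1_hol_nonneg[OF h] C1_hol_hoelder[OF h, of x "x - s"]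
      by (intro mult_mono cot_half_le frac_bound) auto
    also have "\<dots> = N * (\<bar>s\<bar> powr a * (4 / \<bar>s\<bar>))" by simp
    also have "\<dots> = 4 * N * weight a s" unfolding powr_div_abs by simp
    finally show "norm (G0 f h x s) \<le> norm (4 * N * weight a s)" by simp
  qed
qed

lemma Phi_exists_C1_hol: "Phi_exists f h x"
  unfolding Phi_exists_def set_integrable_circ
  by (intro conjI exI) (rule has_PV_integrable[OF G0_integrable] has_PV_G1 G2a_integrable G2b_integrable)+

text \<open>The integrals of \<open>G2a\<close> cancel between \<open>Phi1\<close> and
  \<open>Phi2\<close>. The \<open>K2\<close> terms carry \<open>h' x\<close> and
  \<open>h' (x - s)\<close> with opposite signs, so they join the increment of \<open>h'\<close> in
  \<open>G0\<close> and turn its kernel into \<open>Phi_ker\<close>.\<close>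

theorem Phi_kernel_op: "Phi f h = kernel_op (Phi_ker f) (deriv h)"
proof
  fix x
  have "Phi f h x = (LINT s|circ. G0 f h x s) - deriv h x * ((LINT s|circ. K2 x s) - (LINT s|circ. G2a f x s))
      - (deriv h x * (LINT s|circ. G2a f x s) - (LINT s|circ. G2b f h x s))"
    unfolding Phi_def Phi0_def Phi1_def Phi2_def set_integral_circ
      PV_eq[OF has_PV_integrable[OF G0_integrable]] PV_eq[OF has_PV_G1] ..
  also have "\<dots> = (LINT s|circ. G0 f h x s) - deriv h x * (LINT s|circ. K2 x s) + (LINT s|circ. G2b f h x s)"
    by (simp only: right_diff_distrib)
  also have "\<dots> = (LINT s|circ. G0 f h x s - deriv h x * K2 x s + G2b f h x s)"
    using G0_integrable[of x] K2_integrable[of x] G2b_integrable[of x] by simp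
  also have "\<dots> = kernel_op (Phi_ker f) (deriv h) x"
    unfolding kernel_op_def
  proof (rule integral_cong_AE)
    have "AE s in lborel. s \<noteq> 0 \<and> s \<noteq> pi \<and> s \<noteq> (- pi :: real)"
      by (intro AE_conjI AE_lborel_singleton)
    then have "AE s in circ. s \<noteq> 0 \<and> s \<noteq> pi \<and> s \<noteq> - pi"
      unfolding circ_def by (subst AE_restrict_space_iff) auto
    then show "AE s in circ. G0 f h x s - deriv h x * K2 x s + G2b f h x s = (deriv h x - deriv h (x - s)) * Phi_ker f x s"
    proof (rule AE_mp, intro AE_I2 impI)
      fix s assume "s \<in> space circ" "s \<noteq> 0 \<and> s \<noteq> pi \<and> s \<noteq> - pi"
      then have s: "0 < \<bar>s\<bar>" "\<bar>s\<bar> < pi" by auto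
      have "G0 f h x s = (deriv h x - deriv h (x - s)) * (1 / t s * (1 / (1 + (T f x s / t s)\<^sup>2)))"
        by (simp add: G0_def delta_def)
      then show "G0 f h x s - deriv h x * K2 x s + G2b f h x s = (deriv h x - deriv h (x - s)) * Phi_ker f x s"
        unfolding G1_decomp(2)[OF s, symmetric] G2b_eq by (simp add: algebra_simps)
    qed
    have [measurable]: "Phi_ker f x \<in> borel_measurable borel"
      using measurable_compose[OF measurable_Pair1' Phi_ker_measurable[OF f_cont], of x] by simp
    show "(\<lambda>s. (deriv h x - deriv h (x - s)) * Phi_ker f x s) \<in> borel_measurable circ"
      by (rule borel_measurable_circ) measurable
    show "(\<lambda>s. G0 f h x s - deriv h x * K2 x s + G2b f h x s) \<in> borel_measurable circ"
      using G0_integrable[of x] K2_integrable[of x] G2b_integrable[of x]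
      by (intro borel_measurable_integrable) simp
  qed
  finally show "Phi f h x = kernel_op (Phi_ker f) (deriv h) x" .
qed

end

end

section \<open>The main result\<close>

lemma sobolev_diff:
  assumes f: "f \<in> sobolev r" and g: "g \<in> sobolev r" and r: "r > 1 / 2"
  shows "(\<lambda>x. f x - g x) \<in> sobolev r"
proof -
  note c = sobolev_cont[OF f r] sobolev_cont[OF g r]
  have cd: "continuous_on UNIV (\<lambda>x. f x - g x)" by (intro continuous_intros c)
  have fc: "fourier_coeff (\<lambda>x. f x - g x) j = fourier_coeff f j - fourier_coeff g j" for j
  proof -
    have "integrable circ (\<lambda>x. of_real (f x) * mode (- j) x)" "integrable circ (\<lambda>x. of_real (g x) * mode (- j) x)"
      by (intro integrable_circ_continuous continuous_intros c)+
    then show ?thesis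
      by (simp add: fourier_coeff_fourier fourier_def left_diff_distrib diff_divide_distrib)
  qed
  have le: "sobolev_term r (\<lambda>x. f x - g x) j \<le> 2 * (sobolev_term r f j + sobolev_term r g j)" for j
  proof -
    have "(cmod (fourier_coeff f j - fourier_coeff g j))\<^sup>2 \<le> (cmod (fourier_coeff f j) + cmod (fourier_coeff g j))\<^sup>2"
      by (intro power_mono norm_triangle_ineq4) simp
    also have "\<dots> \<le> 2 * ((cmod (fourier_coeff f j))\<^sup>2 + (cmod (fourier_coeff g j))\<^sup>2)"
      using zero_le_power2[of "cmod (fourier_coeff f j) - cmod (fourier_coeff g j)"]
      by (simp add: power2_eq_square algebra_simps)
    finally have "(1 + (real_of_int j)\<^sup>2) powr r * (cmod (fourier_coeff f j - fourier_coeff g j))\<^sup>2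
      \<le> (1 + (real_of_int j)\<^sup>2) powr r * (2 * ((cmod (fourier_coeff f j))\<^sup>2 + (cmod (fourier_coeff g j))\<^sup>2))"
      by (rule mult_left_mono) simp
    then show ?thesis unfolding sobolev_term_def fc by (simp add: algebra_simps)
  qed
  have "sobolev_term r f summable_on UNIV" "sobolev_term r g summable_on UNIV"
    using f g by (auto simp: sobolev_def)
  then have "(\<lambda>j. 2 * (sobolev_term r f j + sobolev_term r g j)) summable_on UNIV"
    by (intro summable_on_cmult_right summable_on_add)
  then have "sobolev_term r (\<lambda>x. f x - g x) summable_on UNIV"
    by (rule summable_on_comparison_test) (rule le sobolev_term_nonneg)+
  then show ?thesis
    using sobolev_per[OF f] sobolev_per[OF g] cd
    by (auto simp: sobolev_def set_integrable_circ intro!: borel_measurable_continuous_onI integrable_circ_continuous continuous_intros)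
qed

lemma zero_sobolev: "(\<lambda>_. 0) \<in> sobolev r" and sobolev_norm_zero: "sobolev_norm r (\<lambda>_. 0) = 0"
  by (auto simp: sobolev_def sobolev_norm_def sobolev_term_def[abs_def] fourier_coeff_def set_integrable_circ)

text \<open>The root in \<open>u_sobolev_norm\<close> after the \<open>H^2\<close> norm of
  \<open>h\<close> is taken out: the Hoelder constant is linear in that norm and \<open>Q\<close> is
  its square.\<close>

definition op_const :: "real \<Rightarrow> real" where
  "op_const a = sqrt (64 * (2 * embed_const (1 - a))\<^sup>2 * (weight_mass a)\<^sup>2 + (8 * pi\<^sup>2 + 20 * (weight_mass a)\<^sup>2))"

lemma op_const_nonneg: "op_const a \<ge> 0"
  by (simp add: op_const_def)

text \<open>The embedding applies to \<open>h\<close> because \<open>3/2 + a < 2\<close>, and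
  \<open>1 - a\<close> is \<open>2 - (1 + a)\<close>. In the weighted sum the factor
  \<open>|j|\<close> of the derivative costs \<open>bracket j powr (1 / 2)\<close>, which raises the
  order from \<open>a\<close> to \<open>1 + a\<close>.\<close>

lemma kernel_data_sobolev:
  assumes a: "0 < a" "a < 1 / 2" and k: "singular_kernel a A k" and h: "h \<in> sobolev 2"
  shows "kernel_data a A (2 * embed_const (1 - a) * sobolev_norm 2 h) ((sobolev_norm 2 h)\<^sup>2) k (deriv h)
    (\<lambda>j. \<i> * of_int j * fourier_coeff h j)"
proof
  have r: "2 > 3 / 2 + a" "a \<le> 1" using a by auto
  note emb = sobolev_embedding[OF h a(1) r(2,1)]
  show ser: "fourier_series (\<lambda>j. \<i> * of_int j * fourier_coeff h j) (\<lambda>x. of_real (deriv h x))" by (rule emb(1))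
  show "deriv h (x + 2 * pi) = deriv h x" for x
  proof -
    \<comment> \<open>Periodicity of the derivative is read off from its Fourier series.\<close>
    have "complex_of_real (deriv h (x + 2 * pi)) = of_real (deriv h x)"
      using has_sum_unique[OF fourier_series_has_sum[OF ser, of "x + 2 * pi", unfolded mode_periodic] fourier_series_has_sum[OF ser, of x]] .
    then show ?thesis by simp
  qed
  show "\<bar>deriv h x - deriv h y\<bar> \<le> 2 * embed_const (1 - a) * sobolev_norm 2 h * \<bar>x - y\<bar> powr a" for x y
    using C1_hol_hoelder[OF emb(2), of x y] by (simp add: diff_diff_eq[symmetric])
  show "(\<lambda>j. bracket j powr (a / 2) * cmod (\<i> * of_int j * fourier_coeff h j)) summable_on UNIV"
  proof (rule summable_on_comparison_test)
    show "(\<lambda>j. bracket j powr ((1 + a) / 2) * cmod (fourier_coeff h j)) summable_on UNIV"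
      by (rule sobolev_embedding_sum(1)[OF h]) (use a in simp)
    fix j
    have "\<bar>real_of_int j\<bar> powr 1 \<le> bracket j powr (1 / 2)" by (rule abs_le_bracket) simp
    then have "bracket j powr (a / 2) * (\<bar>real_of_int j\<bar> powr 1 * cmod (fourier_coeff h j))
        \<le> bracket j powr (a / 2) * (bracket j powr (1 / 2) * cmod (fourier_coeff h j))"
      by (intro mult_left_mono mult_right_mono) auto
    also have "\<dots> = bracket j powr ((1 + a) / 2) * cmod (fourier_coeff h j)"
      by (simp add: powr_add[symmetric] add_divide_distrib add.commute mult.assoc[symmetric])
    finally show "bracket j powr (a / 2) * cmod (\<i> * of_int j * fourier_coeff h j) \<le> bracket j powr ((1 + a) / 2) * cmod (fourier_coeff h j)"
      by (simp add: norm_mult)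
  qed auto
  show "(\<Sum>j\<in>F. (\<bar>real_of_int j\<bar> * cmod (\<i> * of_int j * fourier_coeff h j))\<^sup>2) \<le> (sobolev_norm 2 h)\<^sup>2" if F: "finite F" for F
  proof (rule order_trans[OF sum_mono sobolev_term_sum_le[OF h F]])
    fix j
    have "(\<bar>real_of_int j\<bar> * cmod (\<i> * of_int j * fourier_coeff h j))\<^sup>2 = ((real_of_int j)\<^sup>2)\<^sup>2 * (cmod (fourier_coeff h j))\<^sup>2"
      by (simp add: norm_mult power_mult_distrib power2_eq_square)
    also have "\<dots> \<le> (1 + (real_of_int j)\<^sup>2)\<^sup>2 * (cmod (fourier_coeff h j))\<^sup>2"
      by (intro mult_right_mono power_mono) auto
    also have "\<dots> = sobolev_term 2 h j"
      using bracket_pos[of j] by (simp add: sobolev_term_def bracket_def)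
    finally show "(\<bar>real_of_int j\<bar> * cmod (\<i> * of_int j * fourier_coeff h j))\<^sup>2 \<le> sobolev_term 2 h j" .
  qed
qed (use a k in auto)

lemma kernel_op_sobolev:
  assumes a: "0 < a" "a < 1 / 2" and k: "singular_kernel a A k" and h: "h \<in> sobolev 2"
  shows "kernel_op k (deriv h) \<in> sobolev 1"
    and "sobolev_norm 1 (kernel_op k (deriv h)) \<le> A * op_const a * sobolev_norm 2 h"
proof -
  interpret kernel_data a A "2 * embed_const (1 - a) * sobolev_norm 2 h" "(sobolev_norm 2 h)\<^sup>2" k "deriv h"
    "\<lambda>j. \<i> * of_int j * fourier_coeff h j"
    by (rule kernel_data_sobolev[OF a k h])
  show "kernel_op k (deriv h) \<in> sobolev 1" by (rule u_sobolev)
  have "64 * (2 * embed_const (1 - a) * sobolev_norm 2 h)\<^sup>2 * (weight_mass a)\<^sup>2 + (sobolev_norm 2 h)\<^sup>2 * (8 * pi\<^sup>2 + 20 * (weight_mass a)\<^sup>2)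
     = (64 * (2 * embed_const (1 - a))\<^sup>2 * (weight_mass a)\<^sup>2 + (8 * pi\<^sup>2 + 20 * (weight_mass a)\<^sup>2)) * (sobolev_norm 2 h)\<^sup>2"
    by (simp add: power_mult_distrib algebra_simps)
  then have "sqrt (64 * (2 * embed_const (1 - a) * sobolev_norm 2 h)\<^sup>2 * (weight_mass a)\<^sup>2 + (sobolev_norm 2 h)\<^sup>2 * (8 * pi\<^sup>2 + 20 * (weight_mass a)\<^sup>2))
     = op_const a * sobolev_norm 2 h"
    using sobolev_norm_nonneg[of 2 h] by (simp add: real_sqrt_mult op_const_def)
  then show "sobolev_norm 1 (kernel_op k (deriv h)) \<le> A * op_const a * sobolev_norm 2 h"
    using u_sobolev_norm by (simp add: mult.assoc)
qed

lemma kernel_op_integrable: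
  assumes "0 < a" "a < 1 / 2" "singular_kernel a A k" "h \<in> sobolev 2"
  shows "integrable circ (\<lambda>s. (deriv h x - deriv h (x - s)) * k x s)"
  by (rule kernel_data.integrand_integrable[OF kernel_data_sobolev[OF assms]])

theorem proposition3p1:
  fixes s :: real
  assumes "s \<in> {3/2<..<2}"
  shows "(\<forall>f\<in>sobolev s. \<forall>h\<in>sobolev 2. \<forall>x. Phi_exists f h x) \<and>
         Phi \<in> locally_Lipschitz_ops s 2 1"
proof -
  \<comment> \<open>Half of the available exponent \<open>s - 3/2\<close>; since
    \<open>s < 2\<close>, it is below \<open>1/2\<close>, as the embedding of \<open>H^2\<close>
    also requires.\<close>
  define a where "a = (s - 3 / 2) / 2"
  have a: "0 < a" "a < 1 / 2" "a \<le> 1" "s > 3 / 2 + a" "(2::real) > 3 / 2 + a" and s: "s > 1 / 2"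
    using assms by (auto simp: a_def field_simps)
  define E where "E = 2 * embed_const (s - (1 + a))"
  have E: "C1_hol a (E * sobolev_norm s f) f" if "f \<in> sobolev s" for f
    unfolding E_def by (rule sobolev_embedding(2)[OF that a(1,3,4)])
  have E0: "E \<ge> 0" by (simp add: E_def embed_const_nonneg)
  have holh: "\<exists>N. C1_hol a N h" if "h \<in> sobolev 2" for h
    using sobolev_embedding(2)[OF that a(1,3,5)] by blast
  have rep: "Phi f h = kernel_op (Phi_ker f) (deriv h)" if "f \<in> sobolev s" "C1_hol a N h" for f h N
    by (rule Phi_kernel_op[OF a(1,3) E[OF that(1)] sobolev_per[OF that(1)] that(2)])
  have Phi_ker: "singular_kernel a (ker_const (E * sobolev_norm s f) * (E * sobolev_norm s f) + 1) (Phi_ker f)" if "f \<in> sobolev s" for f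
    by (rule singular_kernel_Phi_ker[OF a(1,3) E[OF that] sobolev_per[OF that]])
  have exists: "Phi_exists f h x" if f: "f \<in> sobolev s" and h: "h \<in> sobolev 2" for f h x
    using holh[OF h] Phi_exists_C1_hol[OF a(1,3) E[OF f] sobolev_per[OF f]] by blast
  have bdd: "Phi f \<in> bounded_ops 2 1" if f: "f \<in> sobolev s" for f
    unfolding bounded_ops_def
  proof (intro CollectI conjI ballI allI)
    fix h assume h: "h \<in> sobolev 2"
    then obtain N where N: "C1_hol a N h" using holh by blast
    show "Phi f h \<in> sobolev 1"
      unfolding rep[OF f N] by (rule kernel_op_sobolev(1)[OF a(1,2) Phi_ker[OF f] h])
    show "Phi f (\<lambda>x. c * h x) = (\<lambda>x. c * Phi f h x)" for c
      unfolding rep[OF f N] rep[OF f C1_hol_cmult[OF N]] kernel_op_def C1_hol_cmult_deriv[OF N]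
      by (simp add: right_diff_distrib[symmetric] mult.assoc)
    fix k assume k: "k \<in> sobolev 2"
    then obtain N' where N': "C1_hol a N' k" using holh by blast
    show "Phi f (\<lambda>x. h x + k x) = (\<lambda>x. Phi f h x + Phi f k x)"
    proof
      fix x
      have "Phi f (\<lambda>x. h x + k x) x = (LINT s|circ. (deriv h x - deriv h (x - s)) * Phi_ker f x s + (deriv k x - deriv k (x - s)) * Phi_ker f x s)"
        unfolding rep[OF f C1_hol_add[OF N N']] kernel_op_def C1_hol_add_deriv[OF N N'] by (simp add: algebra_simps)
      also have "\<dots> = Phi f h x + Phi f k x"
        unfolding rep[OF f N] rep[OF f N'] kernel_op_def
        by (rule Bochner_Integration.integral_add; rule kernel_op_integrable[OF a(1,2) Phi_ker[OF f]]; fact)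
      finally show "Phi f (\<lambda>x. h x + k x) x = Phi f h x + Phi f k x" .
    qed
  next
    show "\<exists>C. \<forall>h\<in>sobolev 2. sobolev_norm 1 (Phi f h) \<le> C * sobolev_norm 2 h"
      using holh rep[OF f] kernel_op_sobolev(2)[OF a(1,2) Phi_ker[OF f]] by metis
  qed
  have lip: "\<exists>\<epsilon>>0. \<exists>K. \<forall>f\<in>sobolev s. \<forall>g\<in>sobolev s.
        sobolev_norm s (\<lambda>x. f x - f\<^sub>0 x) < \<epsilon> \<longrightarrow> sobolev_norm s (\<lambda>x. g x - f\<^sub>0 x) < \<epsilon> \<longrightarrow>
        op_norm 2 1 (\<lambda>h x. Phi f h x - Phi g h x) \<le> K * sobolev_norm s (\<lambda>x. f x - g x)"
    if f0: "f\<^sub>0 \<in> sobolev s" for f\<^sub>0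
  \<comment> \<open>The radius \<open>1\<close> works at every center, and the Lipschitz constant
    depends on \<open>f\<^sub>0\<close> through its norm only.\<close>
  proof (rule exI[of _ 1], intro conjI exI[of _ "ker_const (E * sobolev_norm s f\<^sub>0 + E * 1) * E * op_const a"] ballI impI)
    define M where "M = E * sobolev_norm s f\<^sub>0 + E * 1"
    fix f g assume f: "f \<in> sobolev s" and g: "g \<in> sobolev s"
      and fb: "sobolev_norm s (\<lambda>x. f x - f\<^sub>0 x) < 1" and gb: "sobolev_norm s (\<lambda>x. g x - f\<^sub>0 x) < 1"
    have ball: "C1_hol a M u" if u: "u \<in> sobolev s" and ub: "sobolev_norm s (\<lambda>x. u x - f\<^sub>0 x) < 1" for u
    proof -
      \<comment> \<open>Writing \<open>u\<close> as \<open>f\<^sub>0\<close> plus a small difference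
        puts the triangle inequality into the constants of \<open>C1_hol\<close>; none is needed for
        \<open>sobolev_norm\<close>.\<close>
      have "C1_hol a (E * sobolev_norm s f\<^sub>0 + E * sobolev_norm s (\<lambda>x. u x - f\<^sub>0 x)) (\<lambda>x. f\<^sub>0 x + (u x - f\<^sub>0 x))"
        by (intro C1_hol_add E f0 sobolev_diff u s)
      then have "C1_hol a (E * sobolev_norm s f\<^sub>0 + E * sobolev_norm s (\<lambda>x. u x - f\<^sub>0 x)) u" by simp
      then show ?thesis
        unfolding M_def by (rule C1_hol_mono) (intro add_left_mono mult_left_mono E0 less_imp_le ub)
    qed
    define A where "A = ker_const M * (E * sobolev_norm s (\<lambda>x. f x - g x))"
    have kd: "singular_kernel a A (\<lambda>x s. Phi_ker f x s - Phi_ker g x s)"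
      unfolding A_def
      by (rule singular_kernel_Phi_ker_diff[OF a(1,3) ball[OF f fb] ball[OF g gb] E[OF sobolev_diff[OF f g s]] sobolev_per[OF f] sobolev_per[OF g]])
    have A0: "A \<ge> 0" using kd unfolding singular_kernel_def by (meson abs_ge_zero order_trans)
    have "op_norm 2 1 (\<lambda>h x. Phi f h x - Phi g h x) \<le> A * op_const a"
      unfolding op_norm_def
    proof (rule cSUP_least)
      show "{h \<in> sobolev 2. sobolev_norm 2 h \<le> 1} \<noteq> {}"
        using zero_sobolev sobolev_norm_zero by fastforce
      fix h assume "h \<in> {h \<in> sobolev 2. sobolev_norm 2 h \<le> 1}"
      then have h: "h \<in> sobolev 2" "sobolev_norm 2 h \<le> 1" by auto
      obtain N where N: "C1_hol a N h" using holh[OF h(1)] by blast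
      have "(\<lambda>x. Phi f h x - Phi g h x) = kernel_op (\<lambda>x s. Phi_ker f x s - Phi_ker g x s) (deriv h)"
      proof
        fix x
        show "Phi f h x - Phi g h x = kernel_op (\<lambda>x s. Phi_ker f x s - Phi_ker g x s) (deriv h) x"
          unfolding rep[OF f N] rep[OF g N] kernel_op_def right_diff_distrib
          by (rule Bochner_Integration.integral_diff[symmetric])
             (use kernel_op_integrable[OF a(1,2) Phi_ker[OF f] h(1)] kernel_op_integrable[OF a(1,2) Phi_ker[OF g] h(1)] in auto)
      qed
      then have "sobolev_norm 1 (\<lambda>x. Phi f h x - Phi g h x) \<le> A * op_const a * sobolev_norm 2 h"
        using kernel_op_sobolev(2)[OF a(1,2) kd h(1)] by simp
      also have "\<dots> \<le> A * op_const a * 1"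
        using A0 op_const_nonneg by (intro mult_left_mono h(2)) auto
      finally show "sobolev_norm 1 (\<lambda>x. Phi f h x - Phi g h x) \<le> A * op_const a" by simp
    qed
    then show "op_norm 2 1 (\<lambda>h x. Phi f h x - Phi g h x)
        \<le> (ker_const (E * sobolev_norm s f\<^sub>0 + E * 1) * E * op_const a) * sobolev_norm s (\<lambda>x. f x - g x)"
      by (simp add: A_def M_def mult_ac)
  qed simp
  show ?thesis
    using exists bdd lip unfolding locally_Lipschitz_ops_def by blast
qed

end
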